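(* Let $A\to M$ and $\widetilde A\to\widetilde M$ be first-order Lie algebroids with anchors $\mathbf a$, $\widetilde{\mathbf a}$, and let $F:A\to\widetilde A$ be a first-order Lie algebroid morphism over $f:M\to\widetilde M$. Then: (1) $\widetilde{\mathbf a}\circ F=Tf\circ\mathbf a$; (2) if $U\subseteq M$ and $\widetilde U\subseteq\widetilde M$ are open with $f(U)\subseteq\widetilde U$, and $\xi,\eta\in\Gamma(A|_U)$, $\widetilde\xi,\widetilde\eta\in\Gamma(\widetilde A|_{\widetilde U})$ satisfy $F\circ\xi=\widetilde\xi\circ f$ and $F\circ\eta=\widetilde\eta\circ f$ on $U$, then $F\circ[\xi,\eta]=[\widetilde\xi,\widetilde\eta]\circ f$ on $U$. Furthermore, if $f$ is a local diffeomorphism, then the converse is true: a smooth vector bundle morphism $F:A\to\widetilde A$ over a local diffeomorphism $f$ which satisfies (1) and (2) is a first-order Lie algebroid morphism.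
   Context: Smoothness is in the sense of Bastiani calculus; locally convex spaces are real and Hausdorff; manifolds are Hausdorff and modelled on locally convex spaces. A vector bundle $p:E\to M$ has locally convex fibers and local trivializations $\phi:E|_U\to U\times\mathsf F_\phi$ (diffeomorphisms over $U$, topological linear isomorphisms on fibers, whose transition maps are smooth, fiberwise linear bundle isomorphisms). A vector bundle morphism over a smooth map $f$ is a smooth map covering $f$ that is fiberwise linear. In a local trivialization $\phi$ over $U$, the local representative of a section $\xi$ is $\xi^\phi:=\mathrm{pr}_2\circ\phi\circ\xi\in C^\infty(U,\mathsf F_\phi)$. For a vector field $X$ and a smooth map $h$ into a locally convex space, $X.h:=\mathrm{pr}_2\circ Th\circ X$. First-order Lie algebroid: a vector bundle $p:A\to M$ with a vector bundle morphism $\mathbf a:A\to TM$ over $\mathrm{id}_M$ (the anchor) and a morphism of sheaves of $\mathbb R$-modules $[\cdot,\cdot]:\mathcal A\otimes_{\mathbb R}\mathcal A\to\mathcal A$ on the sheaf $\mathcal A$ of smooth sections of $A$ such that: (1) $[\cdot,\cdot]$ makes each $\mathcal A(U)$ a Lie algebra; (2) $[\xi,h\eta]=h[\xi,\eta]+(\mathbf a(\xi).h)\eta$ for $\xi,\eta\in\mathcal A(U)$, $h\in C^\infty(U)$; (3) for every local trivialization $\phi:A|_U\to U\times\mathsf F_\phi$ there is a smooth map $C_\phi:U\times\mathsf F_\phi\times\mathsf F_\phi\to\mathsf F_\phi$, alternating bilinear in the last two arguments, with $[\xi,\eta]^\phi(x)=\mathbf a(\xi).\eta^\phi(x)-\mathbf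 a(\eta).\xi^\phi(x)+C_\phi(x,\xi^\phi(x),\eta^\phi(x))$ for all $\xi,\eta\in\mathcal A(U)$. Forms: for $k\ge1$, $\Omega^k_A(U)$ is the space of families $\omega=(\omega_x)_{x\in U}$ of continuous alternating $k$-linear maps $\omega_x:A_x^k\to\mathbb R$ such that in local trivializations $\phi$ of $A$ the map $(x,v_1,\dots,v_k)\mapsto\omega_x(\phi^{-1}(x,v_1),\dots,\phi^{-1}(x,v_k))$ is smooth; $\Omega^0_A(U)=C^\infty(U)$. The differential is $(d_A\omega)(\xi_0,\dots,\xi_k)=\sum_j(-1)^j\mathbf a(\xi_j).\omega(\xi_0,\dots,\widehat{\xi_j},\dots,\xi_k)+\sum_{i<j}(-1)^{i+j}\omega([\xi_i,\xi_j],\xi_0,\dots,\widehat{\xi_i},\dots,\widehat{\xi_j},\dots,\xi_k)$, and $\Omega^\bullet_A$ with the wedge product is a sheaf of differential graded (dg) $\mathbb R$-algebras. Morphisms: for a vector bundle morphism $F:A\to\widetilde A$ over $f:M\to\widetilde M$, let $F^\sharp:f^{-1}\Omega^\bullet_{\widetilde A}\to\Omega^\bullet_A$ be the sheaf morphism induced by $[\widetilde U,\alpha]\mapsto F^*\alpha$, $(F^*\alpha)_x(a_1,\dots,a_k)=\alpha_{f(x)}(F(a_1),\dots,F(a_k))$ (for $k=0$, $g\mapsto g\circ f$). $F$ is a first-order Lie algebroid morphism if $F^\sharp\circ f^{-1}d_{\widetilde A}=d_A\circ F^\sharp$. *)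

theory Defs
  imports "HOL-Analysis.Analysis" "HOL-Library.Function_Algebras"
begin

section \<open>Locally convex spaces and Bastiani calculus\<close>

text \<open>Function spaces as real vector spaces with pointwise operations; addition comes from
  \<^theory>\<open>HOL-Library.Function_Algebras\<close>.\<close>

instantiation "fun" :: (type, real_vector) real_vector
begin

definition scaleR_fun :: "real \<Rightarrow> ('a \<Rightarrow> 'b) \<Rightarrow> 'a \<Rightarrow> 'b"
  where "scaleR_fun r f = (\<lambda>x. r *\<^sub>R f x)"

instance
  by standard (auto simp: scaleR_fun_def plus_fun_def fun_eq_iff algebra_simps)

end

text \<open>A locally convex space is a topology on a linear subspace of an ambient real vector space.
  The ambient type supplies only the algebraic operations, never a topology.  In this way the charts
  of one manifold (or the trivializations of one bundle) may have different model spaces, since any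
  set of vector spaces embeds into their direct sum.\<close>

definition lcs :: "'e::real_vector topology \<Rightarrow> bool"
  where "lcs E \<longleftrightarrow>
    subspace (topspace E) \<and>
    Hausdorff_space E \<and>
    continuous_map (prod_topology E E) E (\<lambda>(x, y). x + y) \<and>
    continuous_map (prod_topology euclideanreal E) E (\<lambda>(r, x). r *\<^sub>R x) \<and>
    (\<forall>U. openin E U \<and> 0 \<in> U \<longrightarrow> (\<exists>V. openin E V \<and> 0 \<in> V \<and> convex V \<and> V \<subseteq> U))"

text \<open>The power $E^k$, with tuples encoded as functions vanishing from index $k$ on, so that it is
  again a linear subspace of a real vector space.\<close>

definition power_lcs :: "'e::real_vector topology \<Rightarrow> nat \<Rightarrow> (nat \<Rightarrow> 'e) topology"
  where "power_lcs E k =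
    pullback_topology {v. (\<forall>i<k. v i \<in> topspace E) \<and> (\<forall>i\<ge>k. v i = 0)}
      (\<lambda>v. restrict v {..<k}) (product_topology (\<lambda>_. E) {..<k})"

definition diff_quot :: "('e::real_vector \<Rightarrow> 'f::real_vector) \<Rightarrow> 'e \<Rightarrow> 'e \<Rightarrow> real \<Rightarrow> 'f"
  where "diff_quot f x v = (\<lambda>t. (1 / t) *\<^sub>R (f (x + t *\<^sub>R v) - f x))"

definition dirderiv ::
    "'f::real_vector topology \<Rightarrow> ('e::real_vector \<Rightarrow> 'f) \<Rightarrow> 'e \<Rightarrow> 'e \<Rightarrow> 'f"
  where "dirderiv F f x v = (THE l. limitin F (diff_quot f x v) l (at 0))"

text \<open>The iterated directional derivative
  $d^{(j)}f(x; v_0, \dots, v_{j-1}) = (D_{v_{j-1}} \cdots D_{v_0} f)(x)$.\<close>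

primrec iter_dirderiv ::
    "'f::real_vector topology \<Rightarrow> ('e::real_vector \<Rightarrow> 'f) \<Rightarrow> nat \<Rightarrow> (nat \<Rightarrow> 'e) \<Rightarrow> 'e \<Rightarrow> 'f"
  where
    "iter_dirderiv F f 0 v x = f x"
  | "iter_dirderiv F f (Suc j) v x = dirderiv F (iter_dirderiv F f j v) x (v j)"

text \<open>Smoothness in the sense of Bastiani: all iterated directional derivatives exist and define
  continuous maps $U \times E^j \to F$.\<close>

definition bastiani_smooth ::
    "'e::real_vector topology \<Rightarrow> 'e set \<Rightarrow> 'f::real_vector topology \<Rightarrow> ('e \<Rightarrow> 'f) \<Rightarrow> bool"
  where "bastiani_smooth E U F f \<longleftrightarrow>
    openin E U \<and> f \<in> U \<rightarrow> topspace F \<and>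
    (\<forall>j. (\<forall>x\<in>U. \<forall>v. (\<forall>i\<le>j. v i \<in> topspace E) \<longrightarrow>
            (\<exists>l. limitin F (diff_quot (iter_dirderiv F f j v) x (v j)) l (at 0))) \<and>
         continuous_map (prod_topology (subtopology E U) (power_lcs E j)) F
            (\<lambda>(x, v). iter_dirderiv F f j v x))"

section \<open>Manifolds\<close>

record ('m, 'e) chart =
  cdom :: "'m set"
  cmodel :: "'e topology"
  cmap :: "'m \<Rightarrow> 'e"

abbreviation cinv :: "('m, 'e) chart \<Rightarrow> 'e \<Rightarrow> 'm"
  where "cinv \<kappa> \<equiv> inv_into (cdom \<kappa>) (cmap \<kappa>)"

record ('m, 'e) mfd =
  mtop :: "'m topology"
  atlas :: "('m, 'e) chart set"

abbreviation pts :: "('m, 'e) mfd \<Rightarrow> 'm set"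
  where "pts M \<equiv> topspace (mtop M)"

definition manifold :: "('m, 'e::real_vector) mfd \<Rightarrow> bool"
  where "manifold M \<longleftrightarrow>
    Hausdorff_space (mtop M) \<and>
    pts M = (\<Union>\<kappa>\<in>atlas M. cdom \<kappa>) \<and>
    (\<forall>\<kappa>\<in>atlas M. lcs (cmodel \<kappa>) \<and> openin (mtop M) (cdom \<kappa>) \<and>
       openin (cmodel \<kappa>) (cmap \<kappa> ` cdom \<kappa>) \<and>
       homeomorphic_map (subtopology (mtop M) (cdom \<kappa>))
         (subtopology (cmodel \<kappa>) (cmap \<kappa> ` cdom \<kappa>)) (cmap \<kappa>)) \<and>
    (\<forall>\<kappa>\<in>atlas M. \<forall>\<kappa>'\<in>atlas M.
       bastiani_smooth (cmodel \<kappa>) (cmap \<kappa> ` (cdom \<kappa> \<inter> cdom \<kappa>')) (cmodel \<kappa>')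
         (cmap \<kappa>' \<circ> cinv \<kappa>))"

definition smooth_map_on ::
    "('m, 'e::real_vector) mfd \<Rightarrow> 'm set \<Rightarrow> ('n, 'g::real_vector) mfd \<Rightarrow> ('m \<Rightarrow> 'n) \<Rightarrow> bool"
  where "smooth_map_on M U N f \<longleftrightarrow>
    openin (mtop M) U \<and>
    continuous_map (subtopology (mtop M) U) (mtop N) f \<and>
    (\<forall>\<kappa>\<in>atlas M. \<forall>\<kappa>'\<in>atlas N.
       bastiani_smooth (cmodel \<kappa>) (cmap \<kappa> ` {x \<in> cdom \<kappa> \<inter> U. f x \<in> cdom \<kappa>'}) (cmodel \<kappa>')
         (cmap \<kappa>' \<circ> f \<circ> cinv \<kappa>))"

abbreviation smooth_map ::
    "('m, 'e::real_vector) mfd \<Rightarrow> ('n, 'g::real_vector) mfd \<Rightarrow> ('m \<Rightarrow> 'n) \<Rightarrow> bool"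
  where "smooth_map M N f \<equiv> smooth_map_on M (pts M) N f"

definition diffeo_on ::
    "('m, 'e::real_vector) mfd \<Rightarrow> 'm set \<Rightarrow> ('n, 'g::real_vector) mfd \<Rightarrow> 'n set \<Rightarrow> ('m \<Rightarrow> 'n) \<Rightarrow> bool"
  where "diffeo_on M U N V f \<longleftrightarrow>
    bij_betw f U V \<and> smooth_map_on M U N f \<and> smooth_map_on N V M (inv_into U f)"

definition local_diffeo ::
    "('m, 'e::real_vector) mfd \<Rightarrow> ('n, 'g::real_vector) mfd \<Rightarrow> ('m \<Rightarrow> 'n) \<Rightarrow> bool"
  where "local_diffeo M N f \<longleftrightarrow>
    (\<forall>x\<in>pts M. \<exists>U. openin (mtop M) U \<and> x \<in> U \<and> openin (mtop N) (f ` U) \<and> diffeo_on M U N (f ` U) f)"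

definition lcs_chart :: "'e topology \<Rightarrow> ('e, 'e) chart"
  where "lcs_chart E = \<lparr>cdom = topspace E, cmodel = E, cmap = id\<rparr>"

definition lcs_mfd :: "'e topology \<Rightarrow> ('e, 'e) mfd"
  where "lcs_mfd E = \<lparr>mtop = E, atlas = {lcs_chart E}\<rparr>"

definition prod_mfd :: "('m, 'e) mfd \<Rightarrow> ('n, 'g) mfd \<Rightarrow> ('m \<times> 'n, 'e \<times> 'g) mfd"
  where "prod_mfd M N =
    \<lparr>mtop = prod_topology (mtop M) (mtop N),
     atlas = {\<lparr>cdom = cdom \<kappa> \<times> cdom \<kappa>', cmodel = prod_topology (cmodel \<kappa>) (cmodel \<kappa>'),
               cmap = map_prod (cmap \<kappa>) (cmap \<kappa>')\<rparr> |\<kappa> \<kappa>'. \<kappa> \<in> atlas M \<and> \<kappa>' \<in> atlas N}\<rparr>"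

section \<open>Vector bundles\<close>

text \<open>A local trivialization is a map \<open>triv\<close> from the part of the total space over \<open>tdom\<close> to
  \<open>tdom \<times> tfib\<close>.\<close>

record ('m, 'a, 'f) triv =
  tdom :: "'m set"
  tfib :: "'f topology"
  triv :: "'a \<Rightarrow> 'm \<times> 'f"

text \<open>The vector space operations \<open>vadd\<close> and \<open>vscale\<close> are meaningful only within single fibers; the
  zero of the fiber through \<open>a\<close> is \<open>vscale 0 a\<close>.  The type \<open>'f\<close> is the ambient vector space of the
  typical fibers.\<close>

record ('a, 'ae, 'm, 'e, 'f) vbundle =
  total :: "('a, 'ae) mfd"
  base :: "('m, 'e) mfd"
  proj :: "'a \<Rightarrow> 'm"
  vadd :: "'a \<Rightarrow> 'a \<Rightarrow> 'a"
  vscale :: "real \<Rightarrow> 'a \<Rightarrow> 'a"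
  batlas :: "('m, 'a, 'f) triv set"

definition over :: "('a, 'ae, 'm, 'e, 'f, 'z) vbundle_scheme \<Rightarrow> 'm set \<Rightarrow> 'a set"
  where "over A U = {a \<in> pts (total A). proj A a \<in> U}"

abbreviation fiber :: "('a, 'ae, 'm, 'e, 'f, 'z) vbundle_scheme \<Rightarrow> 'm \<Rightarrow> 'a set"
  where "fiber A x \<equiv> over A {x}"

text \<open>The restriction of \<open>\<phi>\<close> to a fiber is automatically a homeomorphism onto \<open>tfib \<phi>\<close>, where
  fibers carry the subspace topology of the total space.\<close>

definition local_trivialization ::
    "('a, 'ae::real_vector, 'm, 'e::real_vector, 'f::real_vector, 'z) vbundle_scheme
      \<Rightarrow> ('m, 'a, 'f) triv \<Rightarrow> bool"
  where "local_trivialization A \<phi> \<longleftrightarrow>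
    openin (mtop (base A)) (tdom \<phi>) \<and> lcs (tfib \<phi>) \<and>
    diffeo_on (total A) (over A (tdom \<phi>))
      (prod_mfd (base A) (lcs_mfd (tfib \<phi>))) (tdom \<phi> \<times> topspace (tfib \<phi>)) (triv \<phi>) \<and>
    (\<forall>a\<in>over A (tdom \<phi>). fst (triv \<phi> a) = proj A a) \<and>
    (\<forall>x\<in>tdom \<phi>. \<forall>a\<in>fiber A x. \<forall>b\<in>fiber A x.
       snd (triv \<phi> (vadd A a b)) = snd (triv \<phi> a) + snd (triv \<phi> b)) \<and>
    (\<forall>x\<in>tdom \<phi>. \<forall>a\<in>fiber A x. \<forall>r. snd (triv \<phi> (vscale A r a)) = r *\<^sub>R snd (triv \<phi> a))"

text \<open>The vector space axioms in the fibers follow from the existence of local trivializations, as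
  does smoothness of the transition maps.  Local trivializations outside the bundle atlas are
  admitted wherever a condition refers to all of them.\<close>

definition vector_bundle ::
    "('a, 'ae::real_vector, 'm, 'e::real_vector, 'f::real_vector, 'z) vbundle_scheme \<Rightarrow> bool"
  where "vector_bundle A \<longleftrightarrow>
    manifold (total A) \<and> manifold (base A) \<and> smooth_map (total A) (base A) (proj A) \<and>
    (\<forall>x\<in>pts (base A). \<forall>a\<in>fiber A x. \<forall>b\<in>fiber A x. vadd A a b \<in> fiber A x) \<and>
    (\<forall>x\<in>pts (base A). \<forall>a\<in>fiber A x. \<forall>r. vscale A r a \<in> fiber A x) \<and>
    (\<forall>\<phi>\<in>batlas A. local_trivialization A \<phi>) \<and>
    pts (base A) = (\<Union>\<phi>\<in>batlas A. tdom \<phi>)"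

definition vb_morphism ::
    "('a, 'ae::real_vector, 'm, 'e::real_vector, 'f, 'z) vbundle_scheme
      \<Rightarrow> ('b, 'be::real_vector, 'n, 'g::real_vector, 'h, 'y) vbundle_scheme
      \<Rightarrow> ('a \<Rightarrow> 'b) \<Rightarrow> ('m \<Rightarrow> 'n) \<Rightarrow> bool"
  where "vb_morphism A B F f \<longleftrightarrow>
    smooth_map (base A) (base B) f \<and> smooth_map (total A) (total B) F \<and>
    (\<forall>a\<in>pts (total A). proj B (F a) = f (proj A a)) \<and>
    (\<forall>x\<in>pts (base A). \<forall>a\<in>fiber A x. \<forall>b\<in>fiber A x. F (vadd A a b) = vadd B (F a) (F b)) \<and>
    (\<forall>x\<in>pts (base A). \<forall>a\<in>fiber A x. \<forall>r. F (vscale A r a) = vscale B r (F a))"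

definition sections ::
    "('a, 'ae::real_vector, 'm, 'e::real_vector, 'f, 'z) vbundle_scheme \<Rightarrow> 'm set \<Rightarrow> ('m \<Rightarrow> 'a) set"
  where "sections A U =
    {\<xi> \<in> extensional U. smooth_map_on (base A) U (total A) \<xi> \<and> (\<forall>x\<in>U. proj A (\<xi> x) = x)}"

definition sec_add ::
    "('a, 'ae, 'm, 'e, 'f, 'z) vbundle_scheme \<Rightarrow> 'm set \<Rightarrow> ('m \<Rightarrow> 'a) \<Rightarrow> ('m \<Rightarrow> 'a) \<Rightarrow> 'm \<Rightarrow> 'a"
  where "sec_add A U \<xi> \<eta> = (\<lambda>x\<in>U. vadd A (\<xi> x) (\<eta> x))"

definition sec_scale ::
    "('a, 'ae, 'm, 'e, 'f, 'z) vbundle_scheme \<Rightarrow> 'm set \<Rightarrow> ('m \<Rightarrow> real) \<Rightarrow> ('m \<Rightarrow> 'a) \<Rightarrow> 'm \<Rightarrow> 'a"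
  where "sec_scale A U h \<xi> = (\<lambda>x\<in>U. vscale A (h x) (\<xi> x))"

definition sec_rep :: "('m, 'a, 'f) triv \<Rightarrow> ('m \<Rightarrow> 'a) \<Rightarrow> 'm \<Rightarrow> 'f"
  where "sec_rep \<phi> \<xi> = snd \<circ> triv \<phi> \<circ> \<xi>"

section \<open>Tangent bundles\<close>

text \<open>A tangent vector at \<open>x\<close> is a pair \<open>(x, v)\<close>, where \<open>v\<close> assigns to every chart around \<open>x\<close> the
  representative of the vector in that chart; representatives are related by the derivatives of the
  chart changes.  Off the charts around \<open>x\<close> the function \<open>v\<close> is set to \<open>0\<close>.\<close>

type_synonym ('m, 'e) tvec = "'m \<times> (('m, 'e) chart \<Rightarrow> 'e)"

definition charts_at :: "('m, 'e) mfd \<Rightarrow> 'm \<Rightarrow> ('m, 'e) chart set"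
  where "charts_at M x = {\<kappa> \<in> atlas M. x \<in> cdom \<kappa>}"

definition tangent_vectors :: "('m, 'e::real_vector) mfd \<Rightarrow> ('m, 'e) tvec set"
  where "tangent_vectors M =
    {(x, v). x \<in> pts M \<and>
       (\<forall>\<kappa>. \<kappa> \<notin> charts_at M x \<longrightarrow> v \<kappa> = 0) \<and>
       (\<forall>\<kappa>\<in>charts_at M x. v \<kappa> \<in> topspace (cmodel \<kappa>)) \<and>
       (\<forall>\<kappa>\<in>charts_at M x. \<forall>\<kappa>'\<in>charts_at M x.
          v \<kappa>' = dirderiv (cmodel \<kappa>') (cmap \<kappa>' \<circ> cinv \<kappa>) (cmap \<kappa> x) (v \<kappa>))}"

definition tangent_mfd :: "('m, 'e::real_vector) mfd \<Rightarrow> (('m, 'e) tvec, 'e \<times> 'e) mfd"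
  where "tangent_mfd M =
    \<lparr>mtop = topology_generated_by
       {{(x, v) \<in> tangent_vectors M. x \<in> cdom \<kappa> \<and> (cmap \<kappa> x, v \<kappa>) \<in> W} |\<kappa> W.
          \<kappa> \<in> atlas M \<and> openin (prod_topology (cmodel \<kappa>) (cmodel \<kappa>)) W},
     atlas =
       {\<lparr>cdom = {(x, v) \<in> tangent_vectors M. x \<in> cdom \<kappa>},
         cmodel = prod_topology (cmodel \<kappa>) (cmodel \<kappa>),
         cmap = (\<lambda>(x, v). (cmap \<kappa> x, v \<kappa>))\<rparr> |\<kappa>. \<kappa> \<in> atlas M}\<rparr>"

definition tangent_bundle ::
    "('m, 'e::real_vector) mfd \<Rightarrow> (('m, 'e) tvec, 'e \<times> 'e, 'm, 'e, 'e) vbundle"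
  where "tangent_bundle M =
    \<lparr>total = tangent_mfd M,
     base = M,
     proj = fst,
     vadd = (\<lambda>(x, v) (y, w). (x, v + w)),
     vscale = (\<lambda>r (x, v). (x, r *\<^sub>R v)),
     batlas = {\<lparr>tdom = cdom \<kappa>, tfib = cmodel \<kappa>, triv = (\<lambda>(x, v). (x, v \<kappa>))\<rparr> |\<kappa>. \<kappa> \<in> atlas M}\<rparr>"

text \<open>The tangent map $Tf$; it is also used for maps defined near the base point only.  By the chain
  rule the result does not depend on the chosen chart of \<open>M\<close>.\<close>

definition tangent_map ::
    "('m, 'e::real_vector) mfd \<Rightarrow> ('n, 'g::real_vector) mfd \<Rightarrow> ('m \<Rightarrow> 'n) \<Rightarrow> ('m, 'e) tvec \<Rightarrow> ('n, 'g) tvec"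
  where "tangent_map M N f = (\<lambda>(x, v).
    (f x, \<lambda>\<kappa>'. if \<kappa>' \<in> charts_at N (f x)
            then let \<kappa> = (SOME \<kappa>. \<kappa> \<in> charts_at M x)
                 in dirderiv (cmodel \<kappa>') (cmap \<kappa>' \<circ> f \<circ> cinv \<kappa>) (cmap \<kappa> x) (v \<kappa>)
            else 0))"

text \<open>The derivative $X.h = \mathrm{pr}_2 \circ Th \circ X$, where $TF = F \times F$ through the
  global chart of \<open>F\<close>.\<close>

definition lie_deriv ::
    "('m, 'e::real_vector) mfd \<Rightarrow> 'f::real_vector topology \<Rightarrow> ('m \<Rightarrow> ('m, 'e) tvec) \<Rightarrow> ('m \<Rightarrow> 'f) \<Rightarrow> 'm \<Rightarrow> 'f"
  where "lie_deriv M F X h x = snd (tangent_map M (lcs_mfd F) h (X x)) (lcs_chart F)"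

section \<open>First-order Lie algebroids\<close>

record ('a, 'ae, 'm, 'e, 'f) algebroid = "('a, 'ae, 'm, 'e, 'f) vbundle" +
  anchor :: "'a \<Rightarrow> ('m, 'e) tvec"
  bracket :: "'m set \<Rightarrow> ('m \<Rightarrow> 'a) \<Rightarrow> ('m \<Rightarrow> 'a) \<Rightarrow> 'm \<Rightarrow> 'a"

text \<open>A morphism of sheaves on the sheaf tensor product is the same as a family of bilinear maps on
  sections commuting with restrictions.\<close>

definition sheaf_bilinear ::
    "('a, 'ae::real_vector, 'm, 'e::real_vector, 'f::real_vector) algebroid \<Rightarrow> bool"
  where "sheaf_bilinear A \<longleftrightarrow>
    (\<forall>U. openin (mtop (base A)) U \<longrightarrow>
      (\<forall>\<xi>\<in>sections A U. \<forall>\<eta>\<in>sections A U. bracket A U \<xi> \<eta> \<in> sections A U) \<and>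
      (\<forall>\<xi>\<in>sections A U. \<forall>\<eta>\<in>sections A U. \<forall>\<zeta>\<in>sections A U.
         bracket A U (sec_add A U \<xi> \<eta>) \<zeta> = sec_add A U (bracket A U \<xi> \<zeta>) (bracket A U \<eta> \<zeta>) \<and>
         bracket A U \<zeta> (sec_add A U \<xi> \<eta>) = sec_add A U (bracket A U \<zeta> \<xi>) (bracket A U \<zeta> \<eta>)) \<and>
      (\<forall>\<xi>\<in>sections A U. \<forall>\<eta>\<in>sections A U. \<forall>r.
         bracket A U (sec_scale A U (\<lambda>_. r) \<xi>) \<eta> = sec_scale A U (\<lambda>_. r) (bracket A U \<xi> \<eta>) \<and>
         bracket A U \<xi> (sec_scale A U (\<lambda>_. r) \<eta>) = sec_scale A U (\<lambda>_. r) (bracket A U \<xi> \<eta>)) \<and>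
      (\<forall>V. openin (mtop (base A)) V \<and> V \<subseteq> U \<longrightarrow>
         (\<forall>\<xi>\<in>sections A U. \<forall>\<eta>\<in>sections A U.
            restrict (bracket A U \<xi> \<eta>) V = bracket A V (restrict \<xi> V) (restrict \<eta> V))))"

definition lie_bracket ::
    "('a, 'ae::real_vector, 'm, 'e::real_vector, 'f::real_vector) algebroid \<Rightarrow> bool"
  where "lie_bracket A \<longleftrightarrow>
    (\<forall>U. openin (mtop (base A)) U \<longrightarrow>
      (\<forall>\<xi>\<in>sections A U. bracket A U \<xi> \<xi> = sec_scale A U (\<lambda>_. 0) \<xi>) \<and>
      (\<forall>\<xi>\<in>sections A U. \<forall>\<eta>\<in>sections A U. \<forall>\<zeta>\<in>sections A U.
         sec_add A U (bracket A U \<xi> (bracket A U \<eta> \<zeta>))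
           (sec_add A U (bracket A U \<eta> (bracket A U \<zeta> \<xi>)) (bracket A U \<zeta> (bracket A U \<xi> \<eta>)))
         = sec_scale A U (\<lambda>_. 0) \<xi>))"

definition leibniz ::
    "('a, 'ae::real_vector, 'm, 'e::real_vector, 'f::real_vector) algebroid \<Rightarrow> bool"
  where "leibniz A \<longleftrightarrow>
    (\<forall>U. openin (mtop (base A)) U \<longrightarrow>
      (\<forall>\<xi>\<in>sections A U. \<forall>\<eta>\<in>sections A U. \<forall>h. smooth_map_on (base A) U (lcs_mfd euclideanreal) h \<longrightarrow>
         bracket A U \<xi> (sec_scale A U h \<eta>) =
           sec_add A U (sec_scale A U h (bracket A U \<xi> \<eta>))
             (sec_scale A U (lie_deriv (base A) euclideanreal (anchor A \<circ> \<xi>) h) \<eta>)))"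

definition alternating_bilinear :: "'f::real_vector topology \<Rightarrow> ('f \<Rightarrow> 'f \<Rightarrow> 'f) \<Rightarrow> bool"
  where "alternating_bilinear F b \<longleftrightarrow>
    (\<forall>u\<in>topspace F. \<forall>v\<in>topspace F. \<forall>w\<in>topspace F.
       b (u + v) w = b u w + b v w \<and> b w (u + v) = b w u + b w v) \<and>
    (\<forall>u\<in>topspace F. \<forall>v\<in>topspace F. \<forall>r. b (r *\<^sub>R u) v = r *\<^sub>R b u v \<and> b u (r *\<^sub>R v) = r *\<^sub>R b u v) \<and>
    (\<forall>u\<in>topspace F. b u u = 0)"

definition first_order ::
    "('a, 'ae::real_vector, 'm, 'e::real_vector, 'f::real_vector) algebroid \<Rightarrow> bool"
  where "first_order A \<longleftrightarrow>
    (\<forall>\<phi>. local_trivialization A \<phi> \<longrightarrow>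
      (\<exists>C. smooth_map_on
             (prod_mfd (base A) (prod_mfd (lcs_mfd (tfib \<phi>)) (lcs_mfd (tfib \<phi>))))
             (tdom \<phi> \<times> (topspace (tfib \<phi>) \<times> topspace (tfib \<phi>)))
             (lcs_mfd (tfib \<phi>)) (\<lambda>(x, u, v). C x u v) \<and>
           (\<forall>x\<in>tdom \<phi>. alternating_bilinear (tfib \<phi>) (C x)) \<and>
           (\<forall>\<xi>\<in>sections A (tdom \<phi>). \<forall>\<eta>\<in>sections A (tdom \<phi>). \<forall>x\<in>tdom \<phi>.
              sec_rep \<phi> (bracket A (tdom \<phi>) \<xi> \<eta>) x =
                lie_deriv (base A) (tfib \<phi>) (anchor A \<circ> \<xi>) (sec_rep \<phi> \<eta>) x
                - lie_deriv (base A) (tfib \<phi>) (anchor A \<circ> \<eta>) (sec_rep \<phi> \<xi>) x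
                + C x (sec_rep \<phi> \<xi> x) (sec_rep \<phi> \<eta> x))))"

definition lie_algebroid ::
    "('a, 'ae::real_vector, 'm, 'e::real_vector, 'f::real_vector) algebroid \<Rightarrow> bool"
  where "lie_algebroid A \<longleftrightarrow>
    vector_bundle A \<and>
    vb_morphism A (tangent_bundle (base A)) (anchor A) id \<and>
    sheaf_bilinear A \<and> lie_bracket A \<and> leibniz A \<and> first_order A"

section \<open>Forms and the differential\<close>

text \<open>A $k$-form takes its $k$ arguments as a list, and is \<open>0\<close> on all arguments outside its proper
  domain.  A $0$-form \<open>g\<close> is the family \<open>\<lambda>x _. g x\<close> on empty argument lists.\<close>

type_synonym ('m, 'a) family = "'m \<Rightarrow> 'a list \<Rightarrow> real"

definition args :: "('a, 'ae, 'm, 'e, 'f, 'z) vbundle_scheme \<Rightarrow> nat \<Rightarrow> 'm \<Rightarrow> 'a list set"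
  where "args A k x = {vs. length vs = k \<and> set vs \<subseteq> fiber A x}"

definition fiber_form ::
    "('a, 'ae, 'm, 'e, 'f, 'z) vbundle_scheme \<Rightarrow> nat \<Rightarrow> 'm \<Rightarrow> ('a list \<Rightarrow> real) \<Rightarrow> bool"
  where "fiber_form A k x w \<longleftrightarrow>
    continuous_map (product_topology (\<lambda>_. subtopology (mtop (total A)) (fiber A x)) {..<k}) euclideanreal
      (\<lambda>v. w (map v [0..<k])) \<and>
    (\<forall>vs\<in>args A k x. \<forall>i<k. \<forall>a\<in>fiber A x. \<forall>b\<in>fiber A x.
       w (vs[i := vadd A a b]) = w (vs[i := a]) + w (vs[i := b])) \<and>
    (\<forall>vs\<in>args A k x. \<forall>i<k. \<forall>a\<in>fiber A x. \<forall>r. w (vs[i := vscale A r a]) = r * w (vs[i := a])) \<and>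
    (\<forall>vs\<in>args A k x. \<forall>i<k. \<forall>j<k. i \<noteq> j \<and> vs ! i = vs ! j \<longrightarrow> w vs = 0)"

definition form_smooth ::
    "('a, 'ae::real_vector, 'm, 'e::real_vector, 'f::real_vector, 'z) vbundle_scheme
      \<Rightarrow> nat \<Rightarrow> 'm set \<Rightarrow> ('m, 'a) family \<Rightarrow> bool"
  where "form_smooth A k U \<omega> \<longleftrightarrow>
    (\<forall>\<phi>. local_trivialization A \<phi> \<longrightarrow>
       smooth_map_on (prod_mfd (base A) (lcs_mfd (power_lcs (tfib \<phi>) k)))
         ((U \<inter> tdom \<phi>) \<times> topspace (power_lcs (tfib \<phi>) k)) (lcs_mfd euclideanreal)
         (\<lambda>(x, v). \<omega> x (map (\<lambda>i. inv_into (over A (tdom \<phi>)) (triv \<phi>) (x, v i)) [0..<k])))"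

definition forms ::
    "('a, 'ae::real_vector, 'm, 'e::real_vector, 'f::real_vector, 'z) vbundle_scheme
      \<Rightarrow> nat \<Rightarrow> 'm set \<Rightarrow> ('m, 'a) family set"
  where "forms A k U =
    {\<omega>. (\<forall>x vs. \<not> (x \<in> U \<and> vs \<in> args A k x) \<longrightarrow> \<omega> x vs = 0) \<and>
        (if k = 0 then smooth_map_on (base A) U (lcs_mfd euclideanreal) (\<lambda>x. \<omega> x [])
         else (\<forall>x\<in>U. fiber_form A k x (\<omega> x)) \<and> form_smooth A k U \<omega>)}"

text \<open>The value at \<open>x\<close> of the defining formula of $(d_A\omega)(\xi_0,\dots,\xi_k)$ for sections over
  an open neighborhood \<open>V\<close> of \<open>x\<close>.\<close>

definition koszul ::
    "('a, 'ae::real_vector, 'm, 'e::real_vector, 'f::real_vector) algebroid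
      \<Rightarrow> nat \<Rightarrow> 'm set \<Rightarrow> ('m, 'a) family \<Rightarrow> (nat \<Rightarrow> 'm \<Rightarrow> 'a) \<Rightarrow> 'm \<Rightarrow> real"
  where "koszul A k V \<omega> \<xi> x =
    (\<Sum>j\<le>k. (-1) ^ j *
       lie_deriv (base A) euclideanreal (anchor A \<circ> \<xi> j)
         (\<lambda>y. \<omega> y (map (\<lambda>l. \<xi> l y) [l\<leftarrow>[0..<Suc k]. l \<noteq> j])) x) +
    (\<Sum>(i, j) | i < j \<and> j \<le> k. (-1) ^ (i + j) *
       \<omega> x (bracket A V (\<xi> i) (\<xi> j) x # map (\<lambda>l. \<xi> l x) [l\<leftarrow>[0..<Suc k]. l \<noteq> i \<and> l \<noteq> j]))"

text \<open>The differential of a $k$-form on \<open>U\<close>: its value on vectors in a fiber is the value of the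
  formula on any local sections through these vectors.\<close>

definition differential ::
    "('a, 'ae::real_vector, 'm, 'e::real_vector, 'f::real_vector) algebroid
      \<Rightarrow> nat \<Rightarrow> 'm set \<Rightarrow> ('m, 'a) family \<Rightarrow> ('m, 'a) family"
  where "differential A k U \<omega> = (\<lambda>x vs.
    if x \<in> U \<and> vs \<in> args A (Suc k) x
    then THE r. \<forall>V \<xi>. openin (mtop (base A)) V \<and> x \<in> V \<and> V \<subseteq> U \<and>
           (\<forall>i\<le>k. \<xi> i \<in> sections A V \<and> \<xi> i x = vs ! i) \<longrightarrow> koszul A k V \<omega> \<xi> x = r
    else 0)"

section \<open>Morphisms of Lie algebroids\<close>

definition pullback_form ::
    "('a, 'ae, 'm, 'e, 'f, 'z) vbundle_scheme \<Rightarrow> ('a \<Rightarrow> 'b) \<Rightarrow> ('m \<Rightarrow> 'n)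
      \<Rightarrow> nat \<Rightarrow> 'm set \<Rightarrow> ('n, 'b) family \<Rightarrow> ('m, 'a) family"
  where "pullback_form A F f k U \<alpha> =
    (\<lambda>x vs. if x \<in> U \<and> vs \<in> args A k x then \<alpha> (f x) (map F vs) else 0)"

text \<open>Germs at \<open>y\<close>, as equivalence classes of families on open neighborhoods of \<open>y\<close>.  The
  representatives in a class are not required to be smooth forms; this requirement is part of the
  definition of the inverse image sheaf below.\<close>

type_synonym ('n, 'b) germ = "('n set \<times> ('n, 'b) family) set"

definition germ_at :: "('n, 'g) mfd \<Rightarrow> 'n \<Rightarrow> 'n set \<times> ('n, 'b) family \<Rightarrow> ('n, 'b) germ"
  where "germ_at N y = (\<lambda>(V, \<alpha>).
    {(V', \<beta>). openin (mtop N) V' \<and> y \<in> V' \<and>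
       (\<exists>W. openin (mtop N) W \<and> y \<in> W \<and> W \<subseteq> V \<inter> V' \<and> (\<forall>z\<in>W. \<alpha> z = \<beta> z))})"

text \<open>Sections over \<open>U\<close> of the inverse image sheaf $f^{-1}\Omega^k_B$: families of germs
  $s(x) \in (\Omega^k_B)_{f(x)}$ that are locally induced by single forms (the pullback along \<open>f\<close> of
  the etale space of $\Omega^k_B$).\<close>

definition inv_image_forms ::
    "('m, 'e) mfd \<Rightarrow> ('b, 'be::real_vector, 'n, 'g::real_vector, 'h::real_vector, 'y) vbundle_scheme
      \<Rightarrow> ('m \<Rightarrow> 'n) \<Rightarrow> nat \<Rightarrow> 'm set \<Rightarrow> ('m \<Rightarrow> ('n, 'b) germ) set"
  where "inv_image_forms M B f k U =
    {s \<in> extensional U. \<forall>x\<in>U. \<exists>U' V \<alpha>.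
       openin (mtop M) U' \<and> x \<in> U' \<and> U' \<subseteq> U \<and> openin (mtop (base B)) V \<and> f ` U' \<subseteq> V \<and>
       \<alpha> \<in> forms B k V \<and> (\<forall>z\<in>U'. s z = germ_at (base B) (f z) (V, \<alpha>))}"

text \<open>The sheaf morphisms $f^{-1}d_B$ and $F^\sharp$, evaluated on representatives of germs.\<close>

definition inv_image_differential ::
    "('b, 'be::real_vector, 'n, 'g::real_vector, 'h::real_vector) algebroid
      \<Rightarrow> ('m \<Rightarrow> 'n) \<Rightarrow> nat \<Rightarrow> 'm set \<Rightarrow> ('m \<Rightarrow> ('n, 'b) germ) \<Rightarrow> 'm \<Rightarrow> ('n, 'b) germ"
  where "inv_image_differential B f k U s =
    (\<lambda>x\<in>U. let (V, \<alpha>) = (SOME p. p \<in> s x) in germ_at (base B) (f x) (V, differential B k V \<alpha>))"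

definition sharp ::
    "('a, 'ae, 'm, 'e, 'f, 'z) vbundle_scheme \<Rightarrow> ('a \<Rightarrow> 'b) \<Rightarrow> ('m \<Rightarrow> 'n)
      \<Rightarrow> nat \<Rightarrow> 'm set \<Rightarrow> ('m \<Rightarrow> ('n, 'b) germ) \<Rightarrow> ('m, 'a) family"
  where "sharp A F f k U s =
    (\<lambda>x. let (V, \<alpha>) = (SOME p. p \<in> s x) in pullback_form A F f k U \<alpha> x)"

definition lie_algebroid_morphism ::
    "('a, 'ae::real_vector, 'm, 'e::real_vector, 'f::real_vector) algebroid
      \<Rightarrow> ('b, 'be::real_vector, 'n, 'g::real_vector, 'h::real_vector) algebroid
      \<Rightarrow> ('a \<Rightarrow> 'b) \<Rightarrow> ('m \<Rightarrow> 'n) \<Rightarrow> bool"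
  where "lie_algebroid_morphism A B F f \<longleftrightarrow>
    vb_morphism A B F f \<and>
    (\<forall>k U. openin (mtop (base A)) U \<longrightarrow>
       (\<forall>s\<in>inv_image_forms (base A) B f k U.
          sharp A F f (Suc k) U (inv_image_differential B f k U s) =
          differential A k U (sharp A F f k U s)))"

definition anchor_compatible ::
    "('a, 'ae, 'm, 'e::real_vector, 'f) algebroid \<Rightarrow> ('b, 'be, 'n, 'g::real_vector, 'h) algebroid
      \<Rightarrow> ('a \<Rightarrow> 'b) \<Rightarrow> ('m \<Rightarrow> 'n) \<Rightarrow> bool"
  where "anchor_compatible A B F f \<longleftrightarrow>
    (\<forall>a\<in>pts (total A). anchor B (F a) = tangent_map (base A) (base B) f (anchor A a))"

definition bracket_compatible ::
    "('a, 'ae::real_vector, 'm, 'e::real_vector, 'f) algebroid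
      \<Rightarrow> ('b, 'be::real_vector, 'n, 'g::real_vector, 'h) algebroid
      \<Rightarrow> ('a \<Rightarrow> 'b) \<Rightarrow> ('m \<Rightarrow> 'n) \<Rightarrow> bool"
  where "bracket_compatible A B F f \<longleftrightarrow>
    (\<forall>U V. openin (mtop (base A)) U \<and> openin (mtop (base B)) V \<and> f ` U \<subseteq> V \<longrightarrow>
      (\<forall>\<xi>\<in>sections A U. \<forall>\<eta>\<in>sections A U. \<forall>\<xi>'\<in>sections B V. \<forall>\<eta>'\<in>sections B V.
         (\<forall>x\<in>U. F (\<xi> x) = \<xi>' (f x)) \<and> (\<forall>x\<in>U. F (\<eta> x) = \<eta>' (f x)) \<longrightarrow>
         (\<forall>x\<in>U. F (bracket A U \<xi> \<eta> x) = bracket B V \<xi>' \<eta>' (f x))))"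

end

theory Submission
  imports Defs
begin

text \<open>
  Everything rests on the Bastiani chain rule, including its higher-order form (smooth maps compose).
  It follows from a mean value theorem which needs no functionals: if all derivatives of a curve lie in
  a convex open set, then so do its difference quotients.

  The differential is well defined because the Koszul formula at \<open>x\<close> depends only on the values
  $\xi_i(x)$: if $\xi_i$ is replaced by $\zeta$ with $\zeta(x) = \xi_i(x)$, the Lie derivative terms change by
  $\omega(\dots, D(\xi_i - \zeta), \dots)$, and by the first-order formula for the bracket this cancels against the
  change of the bracket terms.

  A morphism is compatible with anchors and brackets because continuous functionals separate points
  (Hahn--Banach): test the condition in degree 0 on functionals of a chart and in degree 1 on functionals
  of the fiber coordinate of a trivialization.  Conversely, where \<open>f\<close> is a diffeomorphism every
  section of \<open>A\<close> is \<open>F\<close>-related to $F \circ \xi \circ f^{-1}$, and the Koszul formulas of related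
  sections agree summand by summand.
\<close>

section \<open>Limits in locally convex spaces\<close>

text \<open>In infinite dimensions a section that vanishes at a point need not be a finite sum of
  sections multiplied by functions vanishing there, so the Leibniz rule alone does not make the
  Koszul formula depend on values only. This is why the first-order axiom carries the proof: it
  writes the bracket at \<open>x\<close> through values at \<open>x\<close> and directional
  derivatives of local representatives. The axiom speaks of sections over the whole domain of a
  trivialization, so trivializations are shrunk to the open set on which the given sections live.

  The model spaces are not assumed complete, so the mean value theorem is obtained by bisection and
  convexity instead of an integral.

  A germ in the inverse image sheaf is evaluated on a representative chosen among arbitrary
  families, not only among smooth forms. Locality of \<open>differential\<close> is therefore proved
  for arbitrary families, by comparing the defining descriptions themselves. In the converse the
  pullback is treated in the same spirit: its Koszul values on all systems of sections are
  identified with one value of the differential on the target.\<close>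

lemma limitin_compose_filterlim:
  assumes "limitin X f l F" "filterlim g F G"
  shows "limitin X (\<lambda>x. f (g x)) l G"
  unfolding limitin_def
proof (intro conjI allI impI)
  show "l \<in> topspace X" using assms(1) by (rule limitin_topspace)
  fix U assume "openin X U \<and> l \<in> U"
  then have "\<forall>\<^sub>F x in F. f x \<in> U" using limitinD[OF assms(1)] by simp
  from eventually_compose_filterlim[OF this assms(2)] show "\<forall>\<^sub>F x in G. f (g x) \<in> U" .
qed

lemma limitin_cong_ev:
  assumes "limitin X f l F" "\<forall>\<^sub>F x in F. f x = g x"
  shows "limitin X g l F"
  by (rule limitin_transform_eventually[OF assms(2,1)])

lemma limitin_ev_topspace: "limitin X f l F \<Longrightarrow> \<forall>\<^sub>F x in F. f x \<in> topspace X"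
  by (simp add: limitin_def)

lemma limitin_Pair:
  assumes "limitin X f a F" "limitin Y g b F"
  shows "limitin (prod_topology X Y) (\<lambda>x. (f x, g x)) (a, b) F"
  using assms by (simp add: limitin_pairwise o_def)

lemma limitin_map:
  assumes "continuous_map X Y g" "limitin X f l F"
  shows "limitin Y (\<lambda>x. g (f x)) (g l) F"
  using continuous_map_limit[OF assms] by (simp add: o_def)

lemma limitin_map2:
  assumes "continuous_map (prod_topology X Y) Z (\<lambda>(x, y). h x y)" "limitin X f a F" "limitin Y g b F"
  shows "limitin Z (\<lambda>x. h (f x) (g x)) (h a b) F"
  using limitin_map[OF assms(1) limitin_Pair[OF assms(2,3)]] by simp

lemma limitin_id_atin: "x \<in> topspace X \<Longrightarrow> limitin X (\<lambda>y. y) x (atin X x)"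
  by (rule limitin_continuous_map) auto

text \<open>Continuity as preservation of limits along \<open>atin X x\<close>. The second premise
  hands over the limit of the identity, from which the limit rules build up algebraic
  expressions.\<close>

lemma continuous_mapI_limitin:
  assumes "\<And>x. x \<in> topspace X \<Longrightarrow> limitin X (\<lambda>y. y) x (atin X x) \<Longrightarrow> limitin Y f (f x) (atin X x)"
  shows "continuous_map X Y f"
  unfolding continuous_map_atin by (intro ballI assms limitin_id_atin)

lemma lcs_subspace: "lcs E \<Longrightarrow> subspace (topspace E)"
  and lcs_Hausdorff: "lcs E \<Longrightarrow> Hausdorff_space E"
  by (auto simp: lcs_def)

lemma lcs_topspace:
  assumes "lcs E"
  shows "0 \<in> topspace E"
    and "\<And>x y. x \<in> topspace E \<Longrightarrow> y \<in> topspace E \<Longrightarrow> x + y \<in> topspace E"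
    and "\<And>x y. x \<in> topspace E \<Longrightarrow> y \<in> topspace E \<Longrightarrow> x - y \<in> topspace E"
    and "\<And>r x. x \<in> topspace E \<Longrightarrow> r *\<^sub>R x \<in> topspace E"
  using lcs_subspace[OF assms] by (auto simp: subspace_def dest: subspace_diff[OF lcs_subspace[OF assms]])

lemma limitin_add:
  assumes "lcs E" "limitin E f a F" "limitin E g b F"
  shows "limitin E (\<lambda>x. f x + g x) (a + b) F"
  using assms limitin_map2[of E E E "(+)"] by (auto simp: lcs_def)

lemma limitin_scaleR:
  assumes "lcs E" "(r \<longlongrightarrow> c) F" "limitin E f a F"
  shows "limitin E (\<lambda>x. r x *\<^sub>R f x) (c *\<^sub>R a) F"
  using assms limitin_map2[of euclideanreal E E "(*\<^sub>R)" r c F] by (auto simp: lcs_def)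

lemma limitin_minus:
  assumes "lcs E" "limitin E f a F"
  shows "limitin E (\<lambda>x. - f x) (- a) F"
  using limitin_scaleR[OF assms(1) tendsto_const assms(2), of "-1"] by simp

lemma limitin_diff:
  assumes "lcs E" "limitin E f a F" "limitin E g b F"
  shows "limitin E (\<lambda>x. f x - g x) (a - b) F"
  using limitin_add[OF assms(1,2) limitin_minus[OF assms(1,3)]] by simp

lemma limitin_sum:
  assumes "lcs E" "\<And>i. i \<in> I \<Longrightarrow> limitin E (f i) (a i) F"
  shows "limitin E (\<lambda>x. \<Sum>i\<in>I. f i x) (\<Sum>i\<in>I. a i) F"
  using assms(2)
proof (induction I rule: infinite_finite_induct)
  case (insert x A)
  then show ?case by (simp add: limitin_add[OF assms(1)])
qed (use lcs_topspace(1)[OF assms(1)] in simp_all)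

lemma limitin_sum_list:
  assumes "lcs E" "\<And>i. i \<in> set I \<Longrightarrow> limitin E (f i) (a i) F"
  shows "limitin E (\<lambda>x. \<Sum>i\<leftarrow>I. f i x) (\<Sum>i\<leftarrow>I. a i) F"
  using assms(2)
proof (induction I)
  case (Cons x A)
  then show ?case by (simp add: limitin_add[OF assms(1)])
qed (use lcs_topspace(1)[OF assms(1)] in simp_all)

lemma limitin_unique:
  assumes "lcs E" "limitin E f a F" "limitin E f b F" "F \<noteq> bot"
  shows "a = b"
  using limitin_Hausdorff_unique[OF assms(2,3,4) lcs_Hausdorff[OF assms(1)]] .

text \<open>\<open>lcs\<close> grants small convex neighbourhoods of 0 only; they are moved to
  \<open>x\<close> by translation, which is continuous and preserves convexity.\<close>

lemma lcs_convex_nhd: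
  assumes E: "lcs E" and "openin E W" "x \<in> W"
  obtains C where "openin E C" "convex C" "x \<in> C" "C \<subseteq> W"
proof -
  have x: "x \<in> topspace E" using assms openin_subset by blast
  have c1: "continuous_map E E (\<lambda>y. x + y)"
    using x by (intro continuous_mapI_limitin limitin_add[OF E]) auto
  have c2: "continuous_map E E (\<lambda>y. y - x)"
    using x by (intro continuous_mapI_limitin limitin_diff[OF E]) auto
  have "openin E {y \<in> topspace E. x + y \<in> W}"
    using openin_continuous_map_preimage[OF c1 assms(2)] .
  moreover have "0 \<in> {y \<in> topspace E. x + y \<in> W}" using assms lcs_topspace(1) by auto
  ultimately obtain V where V: "openin E V" "0 \<in> V" "convex V" "V \<subseteq> {y \<in> topspace E. x + y \<in> W}"
    using E unfolding lcs_def by blast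
  have "openin E {y \<in> topspace E. y - x \<in> V}" (is "openin E ?C")
    using openin_continuous_map_preimage[OF c2 V(1)] .
  moreover have "x \<in> ?C" using x V by simp
  moreover have "?C \<subseteq> W" using V(4) by auto
  moreover have "convex ?C"
  proof (rule convexI)
    fix a b and u v :: real
    assume h: "a \<in> ?C" "b \<in> ?C" "0 \<le> u" "0 \<le> v" "u + v = 1"
    have "u *\<^sub>R (a - x) + v *\<^sub>R (b - x) \<in> V" using convexD[OF V(3)] h by simp
    moreover have "u *\<^sub>R (a - x) + v *\<^sub>R (b - x) = u *\<^sub>R a + v *\<^sub>R b - x"
      using h(5) by (simp add: algebra_simps flip: scaleR_add_left)
    ultimately show "u *\<^sub>R a + v *\<^sub>R b \<in> ?C"
      using h lcs_topspace[OF E] by auto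
  qed
  ultimately show thesis using that by blast
qed

text \<open>Differentiability at 0 gives continuity there: \<open>w t\<close> is \<open>v\<close>
  plus \<open>t\<close> times a convergent quotient.\<close>

lemma limitin_zero_quotient:
  assumes E: "lcs E" and q: "limitin E (\<lambda>t. (1 / t) *\<^sub>R (w t - v)) w' (at (0::real))" and "v \<in> topspace E"
  shows "limitin E w v (at 0)"
proof -
  have "limitin E (\<lambda>t. v + t *\<^sub>R ((1 / t) *\<^sub>R (w t - v))) (v + 0 *\<^sub>R w') (at 0)"
    using assms by (intro limitin_add limitin_scaleR) auto
  moreover have "\<forall>\<^sub>F t in at (0::real). v + t *\<^sub>R ((1 / t) *\<^sub>R (w t - v)) = w t"
    by (auto simp: eventually_at_filter)
  ultimately show ?thesis using limitin_cong_ev by fastforce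
qed

text \<open>The quotient over \<open>[u, w]\<close> is the convex combination of those over
  \<open>[u, v]\<close> and \<open>[v, w]\<close>, weighted by relative length, so membership in
  \<open>C\<close> passes to unions of adjacent intervals (\<open>mix\<close>). Since
  \<open>C\<close> is open, differentiability at \<open>x\<close> gives it for short intervals with
  endpoint \<open>x\<close>, hence for short intervals containing \<open>x\<close>.\<close>

lemma lcs_mean_value:
  fixes \<gamma> :: "real \<Rightarrow> 'e::real_vector"
  assumes C: "convex C" "openin E C" and ab: "a < b"
    and d: "\<And>r. a \<le> r \<Longrightarrow> r \<le> b \<Longrightarrow> \<exists>l\<in>C. limitin E (\<lambda>h. (1 / h) *\<^sub>R (\<gamma> (r + h) - \<gamma> r)) l (at 0)"
  shows "(1 / (b - a)) *\<^sub>R (\<gamma> b - \<gamma> a) \<in> C"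
proof -
  have mix: "(1 / (w - u)) *\<^sub>R (\<gamma> w - \<gamma> u) \<in> C"
    if "u < v" "v < w" "(1 / (v - u)) *\<^sub>R (\<gamma> v - \<gamma> u) \<in> C" "(1 / (w - v)) *\<^sub>R (\<gamma> w - \<gamma> v) \<in> C" for u v w
  proof -
    let ?s = "(v - u) / (w - u)" and ?t = "(w - v) / (w - u)"
    have "?s + ?t = 1" using that(1,2) by (simp flip: add_divide_distrib)
    then have "?s *\<^sub>R ((1 / (v - u)) *\<^sub>R (\<gamma> v - \<gamma> u)) + ?t *\<^sub>R ((1 / (w - v)) *\<^sub>R (\<gamma> w - \<gamma> v)) \<in> C"
      using that by (intro convexD[OF C(1)]) auto
    moreover have "?s *\<^sub>R ((1 / (v - u)) *\<^sub>R (\<gamma> v - \<gamma> u)) + ?t *\<^sub>R ((1 / (w - v)) *\<^sub>R (\<gamma> w - \<gamma> v))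
      = (1 / (w - u)) *\<^sub>R (\<gamma> w - \<gamma> u)"
    proof -
      have "?s * (1 / (v - u)) = 1 / (w - u)" "?t * (1 / (w - v)) = 1 / (w - u)" using that by simp_all
      then show ?thesis by (simp only: scaleR_scaleR flip: scaleR_add_right) simp
    qed
    ultimately show ?thesis by simp
  qed
  \<comment> \<open>Bisection: a property of intervals that survives concatenation and holds for all
    short intervals around every point holds for \<open>[a, b]\<close>. The guard
    \<open>u < v\<close> makes degenerate intervals harmless.\<close>
  have "a < b \<longrightarrow> (1 / (b - a)) *\<^sub>R (\<gamma> b - \<gamma> a) \<in> C"
  proof (rule Bolzano[of a b "\<lambda>u v. u < v \<longrightarrow> (1 / (v - u)) *\<^sub>R (\<gamma> v - \<gamma> u) \<in> C"])
    show "a \<le> b" using ab by simp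
  next
    fix u v w :: real
    assume "u < v \<longrightarrow> (1 / (v - u)) *\<^sub>R (\<gamma> v - \<gamma> u) \<in> C" "v < w \<longrightarrow> (1 / (w - v)) *\<^sub>R (\<gamma> w - \<gamma> v) \<in> C" "u \<le> v" "v \<le> w"
    then show "u < w \<longrightarrow> (1 / (w - u)) *\<^sub>R (\<gamma> w - \<gamma> u) \<in> C"
      using mix[of u v w] by (metis order_le_less)
  next
    fix x assume "a \<le> x" "x \<le> b"
    then obtain l where l: "l \<in> C" "limitin E (\<lambda>h. (1 / h) *\<^sub>R (\<gamma> (x + h) - \<gamma> x)) l (at 0)" using d by blast
    have "\<forall>\<^sub>F h in at 0. (1 / h) *\<^sub>R (\<gamma> (x + h) - \<gamma> x) \<in> C" by (rule limitinD[OF l(2) C(2) l(1)])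
    then obtain e where e: "e > 0" "\<And>h. h \<noteq> 0 \<Longrightarrow> \<bar>h\<bar> < e \<Longrightarrow> (1 / h) *\<^sub>R (\<gamma> (x + h) - \<gamma> x) \<in> C"
      by (auto simp: eventually_at)
    show "\<exists>e>0. \<forall>u v. u \<le> x \<and> x \<le> v \<and> v - u < e \<longrightarrow> u < v \<longrightarrow> (1 / (v - u)) *\<^sub>R (\<gamma> v - \<gamma> u) \<in> C"
    proof (intro exI conjI allI impI)
      show "e > 0" by fact
      fix u v assume uv: "u \<le> x \<and> x \<le> v \<and> v - u < e" "u < v"
      have r: "(1 / (v - x)) *\<^sub>R (\<gamma> v - \<gamma> x) \<in> C" if "x < v" using e(2)[of "v - x"] that uv by auto
      have l: "(1 / (x - u)) *\<^sub>R (\<gamma> x - \<gamma> u) \<in> C" if "u < x"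
      proof -
        have "(1 / (u - x)) *\<^sub>R (\<gamma> u - \<gamma> x) \<in> C" using e(2)[of "u - x"] that uv by auto
        moreover have "(1 / (u - x)) *\<^sub>R (\<gamma> u - \<gamma> x) = (1 / (x - u)) *\<^sub>R (\<gamma> x - \<gamma> u)"
        proof -
          have "1 / (u - x) = - (1 / (x - u))" using that by (simp add: divide_simps)
          then show ?thesis by (metis minus_diff_eq scaleR_minus_left scaleR_minus_right)
        qed
        ultimately show ?thesis by simp
      qed
      show "(1 / (v - u)) *\<^sub>R (\<gamma> v - \<gamma> u) \<in> C"
      proof (cases "u = x \<or> x = v")
        case True
        then show ?thesis using l r uv by auto
      next
        case False
        then have "u < x" "x < v" using uv by auto
        then show ?thesis using mix[OF _ _ l r] by simp
      qed
    qed
  qed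
  then show ?thesis using ab by simp
qed

subsection \<open>Powers and products\<close>

lemma topspace_power_lcs: "topspace (power_lcs E k) = {v. (\<forall>i<k. v i \<in> topspace E) \<and> (\<forall>i\<ge>k. v i = 0)}"
  unfolding power_lcs_def topspace_pullback_topology by auto

lemma limitin_power_lcs:
  assumes "\<And>i. i < k \<Longrightarrow> limitin E (\<lambda>t. w t i) (v i) F" "\<And>i. i \<ge> k \<Longrightarrow> v i = 0"
    "\<forall>\<^sub>F t in F. \<forall>i\<ge>k. w t i = 0"
  shows "limitin (power_lcs E k) w v F"
proof -
  have top: "\<forall>\<^sub>F t in F. \<forall>i\<in>{..<k}. w t i \<in> topspace E"
    using assms(1) by (intro eventually_ball_finite) (auto dest: limitin_ev_topspace)
  have *: "limitin (product_topology (\<lambda>_. E) {..<k}) (\<lambda>t. restrict (w t) {..<k}) (restrict v {..<k}) F"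
    unfolding limitin_componentwise using assms(1) top by (auto elim!: eventually_mono)
  show ?thesis
    unfolding limitin_def
  proof (intro conjI allI impI)
    show "v \<in> topspace (power_lcs E k)" using assms by (auto simp: topspace_power_lcs limitin_def)
    fix U assume "openin (power_lcs E k) U \<and> v \<in> U"
    then obtain W where W: "openin (product_topology (\<lambda>_. E) {..<k}) W" "restrict v {..<k} \<in> W"
      "U = (\<lambda>v. restrict v {..<k}) -` W \<inter> {v. (\<forall>i<k. v i \<in> topspace E) \<and> (\<forall>i\<ge>k. v i = 0)}"
      unfolding power_lcs_def openin_pullback_topology by auto
    have "\<forall>\<^sub>F t in F. restrict (w t) {..<k} \<in> W" using limitinD[OF *] W by blast
    with top assms(3) show "\<forall>\<^sub>F t in F. w t \<in> U"
      by eventually_elim (use W(3) in auto)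
  qed
qed

lemma continuous_map_power_proj:
  assumes "i < k"
  shows "continuous_map (power_lcs E k) E (\<lambda>v. v i)"
proof -
  have "continuous_map (power_lcs E k) E ((\<lambda>v. v i) \<circ> (\<lambda>v. restrict v {..<k}))"
    unfolding power_lcs_def using assms
    by (intro continuous_map_pullback continuous_map_product_projection) auto
  then show ?thesis using assms by (auto simp: o_def)
qed

lemma limitin_power_proj: "limitin (power_lcs E k) w v F \<Longrightarrow> i < k \<Longrightarrow> limitin E (\<lambda>t. w t i) (v i) F"
  using limitin_map[OF continuous_map_power_proj] .

lemma limitin_fst: "limitin (prod_topology X Y) f l F \<Longrightarrow> limitin X (\<lambda>t. fst (f t)) (fst l) F"
  and limitin_snd: "limitin (prod_topology X Y) f l F \<Longrightarrow> limitin Y (\<lambda>t. snd (f t)) (snd l) F"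
  by (simp_all add: limitin_pairwise o_def)

lemma continuous_map_into_power:
  assumes "\<And>i. i < k \<Longrightarrow> continuous_map X E (\<lambda>x. g x i)" "\<And>x i. x \<in> topspace X \<Longrightarrow> i \<ge> k \<Longrightarrow> g x i = 0"
  shows "continuous_map X (power_lcs E k) g"
proof (rule continuous_mapI_limitin)
  fix x assume x: "x \<in> topspace X" "limitin X (\<lambda>y. y) x (atin X x)"
  show "limitin (power_lcs E k) g (g x) (atin X x)"
  proof (rule limitin_power_lcs)
    show "limitin E (\<lambda>t. g t i) (g x i) (atin X x)" if "i < k" for i
      using limitin_map[OF assms(1)[OF that] x(2)] .
    show "\<forall>\<^sub>F t in atin X x. \<forall>i\<ge>k. g t i = 0"
      using limitin_ev_topspace[OF x(2)] by eventually_elim (use assms in auto)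
  qed (use x assms in auto)
qed

lemma lcs_power:
  assumes E: "lcs E"
  shows "lcs (power_lcs E k)"
  unfolding lcs_def
proof (intro conjI allI impI)
  let ?P = "power_lcs E k"
  show "subspace (topspace ?P)"
    using lcs_topspace[OF E] by (auto simp: subspace_def topspace_power_lcs plus_fun_def scaleR_fun_def)
  show "Hausdorff_space ?P"
    unfolding Hausdorff_space_def
  proof (intro allI impI)
    fix v w assume vw: "v \<in> topspace ?P \<and> w \<in> topspace ?P \<and> v \<noteq> w"
    then obtain i where i: "v i \<noteq> w i" by blast
    then have ik: "i < k" using vw by (auto simp: topspace_power_lcs)
    then obtain U V where UV: "openin E U" "openin E V" "v i \<in> U" "w i \<in> V" "disjnt U V"
    proof -
      have "v i \<in> topspace E" "w i \<in> topspace E" using vw ik by (auto simp: topspace_power_lcs)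
      then show ?thesis using lcs_Hausdorff[OF E] i that unfolding Hausdorff_space_def by meson
    qed
    let ?p = "\<lambda>U. {v \<in> topspace ?P. v i \<in> U}"
    have "openin ?P (?p U)" "openin ?P (?p V)"
      by (intro openin_continuous_map_preimage[OF continuous_map_power_proj[OF ik]] UV)+
    then show "\<exists>U V. openin ?P U \<and> openin ?P V \<and> v \<in> U \<and> w \<in> V \<and> disjnt U V"
      using UV vw by (intro exI[of _ "?p U"] exI[of _ "?p V"]) (auto simp: disjnt_def)
  qed
  show "continuous_map (prod_topology ?P ?P) ?P (\<lambda>(x, y). x + y)"
  proof (rule continuous_map_into_power)
    fix i assume "i < k"
    have "continuous_map (prod_topology ?P ?P) E (\<lambda>z. fst z i + snd z i)"
    proof (rule continuous_mapI_limitin)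
      fix z assume l: "limitin (prod_topology ?P ?P) (\<lambda>y. y) z (atin (prod_topology ?P ?P) z)"
      show "limitin E (\<lambda>z. fst z i + snd z i) (fst z i + snd z i) (atin (prod_topology ?P ?P) z)"
        using limitin_add[OF E limitin_power_proj[OF limitin_fst[OF l] \<open>i < k\<close>]
            limitin_power_proj[OF limitin_snd[OF l] \<open>i < k\<close>]] .
    qed
    then show "continuous_map (prod_topology ?P ?P) E (\<lambda>x. (case x of (x, y) \<Rightarrow> x + y) i)"
      by (simp add: case_prod_unfold plus_fun_def)
  qed (auto simp: topspace_power_lcs)
  show "continuous_map (prod_topology euclideanreal ?P) ?P (\<lambda>(r, x). r *\<^sub>R x)"
  proof (rule continuous_map_into_power)
    fix i assume "i < k"
    have "continuous_map (prod_topology euclideanreal ?P) E (\<lambda>z. fst z *\<^sub>R snd z i)"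
    proof (rule continuous_mapI_limitin)
      fix z assume l: "limitin (prod_topology euclideanreal ?P) (\<lambda>y. y) z (atin (prod_topology euclideanreal ?P) z)"
      show "limitin E (\<lambda>z. fst z *\<^sub>R snd z i) (fst z *\<^sub>R snd z i) (atin (prod_topology euclideanreal ?P) z)"
        using limitin_scaleR[OF E _ limitin_power_proj[OF limitin_snd[OF l] \<open>i < k\<close>]] limitin_fst[OF l] by simp
    qed
    then show "continuous_map (prod_topology euclideanreal ?P) E (\<lambda>x. (case x of (r, x) \<Rightarrow> r *\<^sub>R x) i)"
      by (simp add: case_prod_unfold scaleR_fun_def)
  qed (auto simp: topspace_power_lcs scaleR_fun_def)
  fix U assume U: "openin ?P U \<and> 0 \<in> U"
  then obtain W where W: "openin (product_topology (\<lambda>_. E) {..<k}) W" "restrict (\<lambda>_. 0) {..<k} \<in> W"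
    "U = (\<lambda>v. restrict v {..<k}) -` W \<inter> {v. (\<forall>i<k. v i \<in> topspace E) \<and> (\<forall>i\<ge>k. v i = 0)}"
    unfolding power_lcs_def openin_pullback_topology by (auto simp: zero_fun_def)
  obtain T where T': "\<forall>i\<in>{..<k}. openin E (T i)" "restrict (\<lambda>_. 0) {..<k} \<in> Pi\<^sub>E {..<k} T" "Pi\<^sub>E {..<k} T \<subseteq> W"
    using W(1,2) unfolding openin_product_topology_alt by meson
  then have T: "\<forall>i<k. openin E (T i)" "\<forall>i<k. 0 \<in> T i" "Pi\<^sub>E {..<k} T \<subseteq> W"
    by (auto simp: PiE_iff)
  have "\<exists>V. openin E V \<and> 0 \<in> V \<and> convex V \<and> V \<subseteq> T i" if "i < k" for i
    using E T that unfolding lcs_def by blast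
  then obtain V where V: "\<And>i. i < k \<Longrightarrow> openin E (V i) \<and> 0 \<in> V i \<and> convex (V i) \<and> V i \<subseteq> T i" by metis
  let ?V = "{v \<in> topspace ?P. \<forall>i<k. v i \<in> V i}"
  have Vi: "openin ?P {v \<in> topspace ?P. v i \<in> V i}" if "i < k" for i
    using V[OF that] by (intro openin_continuous_map_preimage[OF continuous_map_power_proj[OF that]]) simp
  \<comment> \<open>For \<open>k = 0\<close> the intersection over the indices is the whole type;
    the factor \<open>topspace ?P\<close> keeps the set inside the space.\<close>
  have "openin ?P (topspace ?P \<inter> (\<Inter>i\<in>{..<k}. {v \<in> topspace ?P. v i \<in> V i}))"
    using Vi by (cases "k = 0") (auto intro!: openin_Int openin_Inter)
  moreover have "topspace ?P \<inter> (\<Inter>i\<in>{..<k}. {v \<in> topspace ?P. v i \<in> V i}) = ?V" by auto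
  ultimately have "openin ?P ?V" by simp
  moreover have "0 \<in> ?V" using V lcs_topspace(1)[OF E] by (auto simp: topspace_power_lcs)
  moreover have "?V \<subseteq> U"
  proof
    fix v assume v: "v \<in> ?V"
    have "v i \<in> T i" if "i < k" for i using v V[OF that] that by blast
    then have "restrict v {..<k} \<in> Pi\<^sub>E {..<k} T" by auto
    then have "restrict v {..<k} \<in> W" using T(3) by blast
    then show "v \<in> U" using W(3) v by (simp add: topspace_power_lcs)
  qed
  moreover have "convex ?V"
  proof (rule convexI)
    fix a b :: "nat \<Rightarrow> 'a" and u v :: real
    assume h: "a \<in> ?V" "b \<in> ?V" "0 \<le> u" "0 \<le> v" "u + v = 1"
    then have "\<forall>i<k. u *\<^sub>R a i + v *\<^sub>R b i \<in> V i" using V by (auto intro!: convexD)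
    then show "u *\<^sub>R a + v *\<^sub>R b \<in> ?V"
      using h lcs_topspace[OF E] by (auto simp: topspace_power_lcs plus_fun_def scaleR_fun_def)
  qed
  ultimately show "\<exists>V. openin ?P V \<and> 0 \<in> V \<and> convex V \<and> V \<subseteq> U" by blast
qed

lemma lcs_prod:
  assumes E: "lcs E" and F: "lcs F"
  shows "lcs (prod_topology E F)"
  unfolding lcs_def
proof (intro conjI allI impI)
  let ?P = "prod_topology E F"
  show "subspace (topspace ?P)"
    using lcs_topspace[OF E] lcs_topspace[OF F] by (auto simp: subspace_def zero_prod_def)
  show "Hausdorff_space ?P" using assms by (simp add: lcs_Hausdorff Hausdorff_space_prod_topology)
  have "continuous_map (prod_topology ?P ?P) ?P (\<lambda>z. (fst (fst z) + fst (snd z), snd (fst z) + snd (snd z)))"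
  proof (rule continuous_mapI_limitin)
    fix z assume l: "limitin (prod_topology ?P ?P) (\<lambda>y. y) z (atin (prod_topology ?P ?P) z)"
    show "limitin ?P (\<lambda>z. (fst (fst z) + fst (snd z), snd (fst z) + snd (snd z)))
      (fst (fst z) + fst (snd z), snd (fst z) + snd (snd z)) (atin (prod_topology ?P ?P) z)"
      using limitin_Pair[OF limitin_add[OF E limitin_fst[OF limitin_fst[OF l]] limitin_fst[OF limitin_snd[OF l]]]
          limitin_add[OF F limitin_snd[OF limitin_fst[OF l]] limitin_snd[OF limitin_snd[OF l]]]] .
  qed
  then show "continuous_map (prod_topology ?P ?P) ?P (\<lambda>(x, y). x + y)"
    by (simp add: case_prod_unfold plus_prod_def)
  have "continuous_map (prod_topology euclideanreal ?P) ?P (\<lambda>z. (fst z *\<^sub>R fst (snd z), fst z *\<^sub>R snd (snd z)))"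
  proof (rule continuous_mapI_limitin)
    let ?Q = "prod_topology euclideanreal ?P"
    fix z assume l: "limitin ?Q (\<lambda>y. y) z (atin ?Q z)"
    show "limitin ?P (\<lambda>z. (fst z *\<^sub>R fst (snd z), fst z *\<^sub>R snd (snd z)))
      (fst z *\<^sub>R fst (snd z), fst z *\<^sub>R snd (snd z)) (atin ?Q z)"
      using limitin_Pair[OF limitin_scaleR[OF E _ limitin_fst[OF limitin_snd[OF l]]]
          limitin_scaleR[OF F _ limitin_snd[OF limitin_snd[OF l]]]] limitin_fst[OF l] by simp
  qed
  then show "continuous_map (prod_topology euclideanreal ?P) ?P (\<lambda>(r, x). r *\<^sub>R x)"
    by (simp add: case_prod_unfold scaleR_prod_def)
  fix U assume "openin ?P U \<and> 0 \<in> U"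
  then obtain A B where AB: "openin E A" "openin F B" "0 \<in> A" "0 \<in> B" "A \<times> B \<subseteq> U"
    unfolding openin_prod_topology_alt zero_prod_def by blast
  obtain A' where A': "openin E A'" "0 \<in> A'" "convex A'" "A' \<subseteq> A" using E AB unfolding lcs_def by blast
  obtain B' where B': "openin F B'" "0 \<in> B'" "convex B'" "B' \<subseteq> B" using F AB unfolding lcs_def by blast
  show "\<exists>V. openin ?P V \<and> 0 \<in> V \<and> convex V \<and> V \<subseteq> U"
    using A' B' AB by (intro exI[of _ "A' \<times> B'"]) (auto simp: openin_prod_Times_iff zero_prod_def convex_Times)
qed

lemma lcs_real: "lcs euclideanreal"
proof -
  have "\<exists>V. open V \<and> 0 \<in> V \<and> convex V \<and> V \<subseteq> U" if "open U" "0 \<in> U" for U :: "real set"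
    using that by (meson centre_in_ball convex_ball open_ball open_contains_ball)
  then show ?thesis
    unfolding lcs_def by (auto simp: euclidean_product_topology case_prod_unfold intro!: continuous_intros)
qed

section \<open>Bastiani calculus\<close>

lemma iter_cong_dirs:
  assumes "\<And>i. i < j \<Longrightarrow> v i = w i"
  shows "iter_dirderiv F f j v x = iter_dirderiv F f j w x"
proof -
  have "iter_dirderiv F f j v = iter_dirderiv F f j w" using assms
  proof (induction j)
    case (Suc j)
    then have "iter_dirderiv F f j v = iter_dirderiv F f j w" "v j = w j" by auto
    then show ?case by (intro ext) simp
  qed (auto intro!: ext)
  then show ?thesis by simp
qed

lemma iter_dirderiv_0: "iter_dirderiv F f 0 v = f"
  by (rule ext) simp

lemma dirderivI:
  assumes "lcs F" "limitin F (diff_quot f x v) l (at 0)"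
  shows "dirderiv F f x v = l"
  unfolding dirderiv_def using assms by (intro the_equality) (auto dest: limitin_unique[OF assms(1)])

lemma diff_quot_cong:
  assumes "\<forall>\<^sub>F t in at 0. f (x + t *\<^sub>R v) = g (x + t *\<^sub>R v)" "f x = g x"
  shows "limitin F (diff_quot f x v) l (at 0) \<longleftrightarrow> limitin F (diff_quot g x v) l (at 0)"
proof -
  have "\<forall>\<^sub>F t in at 0. diff_quot f x v t = diff_quot g x v t"
    using assms(1) by eventually_elim (simp add: diff_quot_def assms(2))
  moreover from this have "\<forall>\<^sub>F t in at 0. diff_quot g x v t = diff_quot f x v t"
    by (rule eventually_mono) simp
  ultimately show ?thesis
    using limitin_transform_eventually[of "diff_quot f x v" "diff_quot g x v"]
      limitin_transform_eventually[of "diff_quot g x v" "diff_quot f x v"] by metis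
qed

lemma dirderiv_cong:
  assumes "\<forall>\<^sub>F t in at 0. f (x + t *\<^sub>R v) = g (x + t *\<^sub>R v)" "f x = g x"
  shows "dirderiv F f x v = dirderiv F g x v"
  unfolding dirderiv_def diff_quot_cong[OF assms] ..

lemma line_limit:
  assumes "lcs E" "x \<in> topspace E" "v \<in> topspace E"
  shows "limitin E (\<lambda>t. x + t *\<^sub>R v) x (at (0::real))"
proof -
  have "limitin E (\<lambda>t. x + t *\<^sub>R v) (x + 0 *\<^sub>R v) (at (0::real))"
    using assms by (intro limitin_add limitin_scaleR) auto
  then show ?thesis by simp
qed

lemma line_in_open:
  assumes "lcs E" "openin E U" "x \<in> U" "v \<in> topspace E"
  shows "\<forall>\<^sub>F t in at (0::real). x + t *\<^sub>R v \<in> U"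
  using limitinD[OF line_limit[OF assms(1) _ assms(4)] assms(2,3)] assms openin_subset by auto

lemma iter_cong:
  assumes E: "lcs E" and U: "openin E U" and fg: "\<And>x. x \<in> U \<Longrightarrow> f x = g x"
    and "x \<in> U" "\<And>i. i < j \<Longrightarrow> v i \<in> topspace E"
  shows "iter_dirderiv F f j v x = iter_dirderiv F g j v x"
  using assms(4,5)
proof (induction j arbitrary: x)
  case (Suc j)
  have "\<forall>\<^sub>F t in at 0. iter_dirderiv F f j v (x + t *\<^sub>R v j) = iter_dirderiv F g j v (x + t *\<^sub>R v j)"
    using line_in_open[OF E U Suc.prems(1), of "v j"] Suc by (auto elim!: eventually_mono)
  then show ?case using Suc by (auto intro!: dirderiv_cong)
qed (use fg in auto)

lemma filterlim_mult_const_at_0: "c \<noteq> 0 \<Longrightarrow> filterlim (\<lambda>h. h * c) (at 0) (at (0::real))"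
proof -
  assume c: "c \<noteq> 0"
  have "((\<lambda>h. h * c) \<longlongrightarrow> 0 * c) (at (0::real))" by (intro tendsto_intros)
  then show ?thesis using c by (auto simp: filterlim_at eventually_at_filter)
qed

lemma ev_nz: "\<forall>\<^sub>F t in at (0::real). t \<noteq> 0"
  by (simp add: eventually_at_filter)

lemma bs_openin: "bastiani_smooth E U F f \<Longrightarrow> openin E U"
  and bs_maps: "bastiani_smooth E U F f \<Longrightarrow> x \<in> U \<Longrightarrow> f x \<in> topspace F"
  by (auto simp: bastiani_smooth_def)

lemma bs_subset_topspace: "bastiani_smooth E U F f \<Longrightarrow> x \<in> U \<Longrightarrow> x \<in> topspace E"
  using bs_openin openin_subset by blast

text \<open>The workhorse for proving smoothness: candidates \<open>\<Phi> j\<close> replace the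
  description operator in \<open>dirderiv\<close>, and it suffices that each candidate is the
  derivative of the preceding one. Continuity is asked along arbitrary filters, so that it can be
  checked by limit rules. The filters live on pairs of points and direction tuples because the
  filter finally inserted is \<open>atin\<close> of the product space.\<close>

lemma bastiani_by_derivatives:
  fixes f :: "'e::real_vector \<Rightarrow> 'f::real_vector" and \<Phi> :: "nat \<Rightarrow> (nat \<Rightarrow> 'e) \<Rightarrow> 'e \<Rightarrow> 'f"
  assumes E: "lcs E" and F: "lcs F" and U: "openin E U" and zero: "\<And>v x. x \<in> U \<Longrightarrow> \<Phi> 0 v x = f x"
    and step: "\<And>j v x. x \<in> U \<Longrightarrow> (\<And>i. i \<le> j \<Longrightarrow> v i \<in> topspace E) \<Longrightarrow>
      limitin F (diff_quot (\<Phi> j v) x (v j)) (\<Phi> (Suc j) v x) (at 0)"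
    and cont: "\<And>j x v (L :: ('e \<times> (nat \<Rightarrow> 'e)) filter) y w. x \<in> U \<Longrightarrow> limitin E y x L \<Longrightarrow>
      (\<And>i. i < j \<Longrightarrow> limitin E (\<lambda>t. w t i) (v i) L) \<Longrightarrow> limitin F (\<lambda>t. \<Phi> j (w t) (y t)) (\<Phi> j v x) L"
  shows "bastiani_smooth E U F f"
proof -
  have lim: "limitin F (diff_quot (iter_dirderiv F f j v) x (v j)) (\<Phi> (Suc j) v x) (at 0)"
    if eq: "\<And>y. y \<in> U \<Longrightarrow> iter_dirderiv F f j v y = \<Phi> j v y"
      and x: "x \<in> U" and v: "\<And>i. i \<le> j \<Longrightarrow> v i \<in> topspace E" for j v x
  proof (rule limitin_cong_ev[OF step[OF x v]])
    show "\<forall>\<^sub>F t in at 0. diff_quot (\<Phi> j v) x (v j) t = diff_quot (iter_dirderiv F f j v) x (v j) t"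
      using line_in_open[OF E U x v[OF order_refl]] by eventually_elim (simp add: diff_quot_def eq x)
  qed
  have iter: "iter_dirderiv F f j v x = \<Phi> j v x" if "x \<in> U" "\<And>i. i < j \<Longrightarrow> v i \<in> topspace E" for j v x
    using that
  proof (induction j arbitrary: x)
    case (Suc j)
    then have "limitin F (diff_quot (iter_dirderiv F f j v) x (v j)) (\<Phi> (Suc j) v x) (at 0)" by (intro lim) auto
    then show ?case by (simp add: dirderivI[OF F])
  qed (simp add: zero)
  show "bastiani_smooth E U F f"
    unfolding bastiani_smooth_def
  proof (intro conjI allI ballI impI U)
    \<comment> \<open>Along the trivial filter \<open>bot\<close> a limit asserts nothing except
      that the limit point lies in the space, which is what is wanted here.\<close>
    have "limitin F (\<lambda>_ :: 'e \<times> (nat \<Rightarrow> 'e). \<Phi> 0 (\<lambda>_. 0) x) (\<Phi> 0 (\<lambda>_. 0) x) bot" if "x \<in> U" for x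
      by (rule cont[OF that, where y = "\<lambda>_. x" and w = "\<lambda>_ _. 0"]) (use that openin_subset[OF U] in auto)
    then show "f \<in> U \<rightarrow> topspace F" using limitin_topspace zero by fastforce
    fix j
    show "\<exists>l. limitin F (diff_quot (iter_dirderiv F f j v) x (v j)) l (at 0)"
      if "x \<in> U" "\<forall>i\<le>j. v i \<in> topspace E" for x v
      using that lim[of j v x, OF iter] by auto
    let ?P = "prod_topology (subtopology E U) (power_lcs E j)"
    show "continuous_map ?P F (\<lambda>(x, v). iter_dirderiv F f j v x)"
    proof (rule continuous_map_eq)
      show "continuous_map ?P F (\<lambda>z. \<Phi> j (snd z) (fst z))"
      proof (rule continuous_mapI_limitin)
        fix z assume z: "z \<in> topspace ?P" and l: "limitin ?P (\<lambda>y. y) z (atin ?P z)"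
        show "limitin F (\<lambda>z. \<Phi> j (snd z) (fst z)) (\<Phi> j (snd z) (fst z)) (atin ?P z)"
        proof (rule cont)
          show "fst z \<in> U" using z by auto
          show "limitin E fst (fst z) (atin ?P z)" using limitin_fst[OF l] by (simp add: limitin_subtopology)
          show "limitin E (\<lambda>t. snd t i) (snd z i) (atin ?P z)" if "i < j" for i
            using limitin_power_proj[OF limitin_snd[OF l] that] .
        qed
      qed
    qed (auto simp: topspace_power_lcs iter)
  qed
qed

section \<open>Derivatives of one smooth map: uniformity, multilinearity, behaviour along
  curves\<close>

locale bastiani_map =
  fixes E :: "'e::real_vector topology" and U and G :: "'g::real_vector topology" and g
  assumes E: "lcs E" and G: "lcs G" and bs: "bastiani_smooth E U G g"
begin

abbreviation "D \<equiv> iter_dirderiv G g"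

lemma U_top: "x \<in> U \<Longrightarrow> x \<in> topspace E"
  using bs by (rule bs_subset_topspace)

lemma limit:
  assumes "x \<in> U" "\<And>i. i \<le> j \<Longrightarrow> v i \<in> topspace E"
  shows "limitin G (diff_quot (D j v) x (v j)) (D (Suc j) v x) (at 0)"
proof -
  obtain l where l: "limitin G (diff_quot (D j v) x (v j)) l (at 0)"
    using bs assms unfolding bastiani_smooth_def by blast
  then show ?thesis using dirderivI[OF G l] by simp
qed

lemma limit':
  assumes "x \<in> U" "\<And>i. i < j \<Longrightarrow> v i \<in> topspace E" "a \<in> topspace E"
  shows "limitin G (diff_quot (D j v) x a) (D (Suc j) (v(j := a)) x) (at 0)"
proof -
  have "D j (v(j := a)) = D j v" by (intro ext iter_cong_dirs) simp
  then show ?thesis using limit[of x j "v(j := a)"] assms by simp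
qed

lemma cont:
  assumes "x \<in> U" "limitin E y x L" "\<And>i. i < j \<Longrightarrow> limitin E (\<lambda>t. w t i) (v i) L"
  shows "limitin G (\<lambda>t. D j (w t) (y t)) (D j v x) L"
proof -
  \<comment> \<open>Points of \<open>power_lcs E j\<close> vanish from index \<open>j\<close> on.
    Truncation brings arbitrary direction sequences into this form and leaves the
    \<open>j\<close>-th derivative unchanged.\<close>
  let ?tr = "\<lambda>v i. if i < j then v i else 0"
  have c: "continuous_map (prod_topology (subtopology E U) (power_lcs E j)) G (\<lambda>(x, v). D j v x)"
    using bs unfolding bastiani_smooth_def by blast
  have "limitin (subtopology E U) y x L"
    using assms(1,2) limitinD[OF assms(2) bs_openin[OF bs]] by (simp add: limitin_subtopology)
  moreover have "limitin (power_lcs E j) (\<lambda>t. ?tr (w t)) (?tr v) L"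
    using assms(3) by (intro limitin_power_lcs) auto
  ultimately have "limitin G (\<lambda>t. D j (?tr (w t)) (y t)) (D j (?tr v) x) L"
    using limitin_map[OF c limitin_Pair] by simp
  moreover have "D j (?tr v) x = D j v x" for v x by (rule iter_cong_dirs) simp
  ultimately show ?thesis by simp
qed

lemma top:
  assumes "x \<in> U" "\<And>i. i < j \<Longrightarrow> v i \<in> topspace E"
  shows "D j v x \<in> topspace G"
proof -
  \<comment> \<open>As before, a limit along \<open>bot\<close> only records membership in the
    space.\<close>
  have "limitin G (\<lambda>t::nat. D j v x) (D j v x) bot"
    by (rule cont) (use assms U_top in auto)
  then show ?thesis by (rule limitin_topspace)
qed

text \<open>The directional derivative is uniform in the base point and the direction: by the mean value
  theorem the difference quotient stays in every convex neighbourhood of the limit.\<close>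

lemma strict:
  fixes z :: "real \<Rightarrow> 'e"
  assumes x: "x \<in> U" and z: "limitin E z x (at 0)" and u: "limitin E u a (at 0)"
    and w: "\<And>i. i < j \<Longrightarrow> limitin E (\<lambda>t. w t i) (v i) (at 0)"
  shows "limitin G (\<lambda>t. (1 / t) *\<^sub>R (D j (w t) (z t + t *\<^sub>R u t) - D j (w t) (z t)))
    (D (Suc j) (v(j := a)) x) (at 0)"
  unfolding limitin_def
proof (intro conjI allI impI)
  have va: "(v(j := a)) i \<in> topspace E" if "i < Suc j" for i
    using limitin_topspace[OF w] limitin_topspace[OF u] that by (auto simp: less_Suc_eq)
  show "D (Suc j) (v(j := a)) x \<in> topspace G" by (rule top[OF x va])
  fix W assume W: "openin G W \<and> D (Suc j) (v(j := a)) x \<in> W"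
  obtain C where C: "openin G C" "convex C" "D (Suc j) (v(j := a)) x \<in> C" "C \<subseteq> W"
    using lcs_convex_nhd[OF G] W by blast
  \<comment> \<open>Along \<open>L\<close> the parameter \<open>t\<close> tends to 0 while
    \<open>s\<close> is any number in \<open>[0, 1]\<close>. A limit along \<open>L\<close> is thus
    a limit in \<open>t\<close> uniform in \<open>s\<close>, and \<open>s * t\<close> still tends to
    0; this controls the whole segment from \<open>z t\<close> to \<open>z t + t u t\<close> at
    once.\<close>
  define L where "L = at (0::real) \<times>\<^sub>F principal {0..1::real}"
  have f1: "filterlim fst (at 0) L" unfolding L_def by (rule filterlim_fst)
  have f2: "filterlim snd (principal {0..1}) L" unfolding L_def by (rule filterlim_snd)
  have ev01: "\<forall>\<^sub>F p in L. snd p \<in> {0..1}" using f2 by (simp add: filterlim_principal)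
  have "(fst \<longlongrightarrow> 0) L" using f1 filterlim_at by blast
  then have "((\<lambda>p. \<bar>fst p\<bar>) \<longlongrightarrow> 0) L" by (rule tendsto_rabs_zero)
  then have sf: "((\<lambda>p. snd p * fst p) \<longlongrightarrow> 0) L"
    by (rule Lim_null_comparison[rotated])
       (use ev01 in eventually_elim, auto simp: abs_mult mult_left_le_one_le)
  have u': "limitin E (\<lambda>p. u (fst p)) a L" by (rule limitin_compose_filterlim[OF u f1])
  have "limitin E (\<lambda>p. z (fst p) + (snd p * fst p) *\<^sub>R u (fst p)) (x + 0 *\<^sub>R a) L"
    by (rule limitin_add[OF E limitin_compose_filterlim[OF z f1] limitin_scaleR[OF E sf u']])
  then have zl: "limitin E (\<lambda>p. z (fst p) + (snd p * fst p) *\<^sub>R u (fst p)) x L" by simp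
  have wl: "limitin E (\<lambda>p. ((w (fst p))(j := u (fst p))) i) ((v(j := a)) i) L" if "i < Suc j" for i
    using that u' limitin_compose_filterlim[OF w f1] by (cases "i = j") auto
  have "limitin G (\<lambda>p. D (Suc j) ((w (fst p))(j := u (fst p))) (z (fst p) + (snd p * fst p) *\<^sub>R u (fst p)))
    (D (Suc j) (v(j := a)) x) L"
    by (rule cont[OF x zl wl])
  from limitinD[OF this C(1,3)]
  have evC: "\<forall>\<^sub>F p in L. D (Suc j) ((w (fst p))(j := u (fst p))) (z (fst p) + (snd p * fst p) *\<^sub>R u (fst p)) \<in> C" .
  have evU: "\<forall>\<^sub>F p in L. z (fst p) + (snd p * fst p) *\<^sub>R u (fst p) \<in> U"
    using limitinD[OF zl bs_openin[OF bs] x] .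
  from evC evU have "\<forall>\<^sub>F p in L. (\<lambda>(t, s). D (Suc j) ((w t)(j := u t)) (z t + (s * t) *\<^sub>R u t) \<in> C \<and> z t + (s * t) *\<^sub>R u t \<in> U) p"
    by eventually_elim auto
  then have "\<forall>\<^sub>F t in at 0. \<forall>s\<in>{0..1}. D (Suc j) ((w t)(j := u t)) (z t + (s * t) *\<^sub>R u t) \<in> C \<and> z t + (s * t) *\<^sub>R u t \<in> U"
    unfolding L_def eventually_prod_filter eventually_principal by (auto elim!: eventually_mono)
  moreover have "\<forall>\<^sub>F t in at 0. u t \<in> topspace E" by (rule limitin_ev_topspace[OF u])
  moreover have "\<forall>\<^sub>F t in at 0. \<forall>i\<in>{..<j}. w t i \<in> topspace E"
    using limitin_ev_topspace[OF w] by (intro eventually_ball_finite) auto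
  ultimately show "\<forall>\<^sub>F t in at 0. (1 / t) *\<^sub>R (D j (w t) (z t + t *\<^sub>R u t) - D j (w t) (z t)) \<in> W"
    using ev_nz
  proof eventually_elim
    case (elim t)
    \<comment> \<open>The segment is run through in unit time. The factor \<open>1 / t\<close>
      cancels the inner derivative \<open>t\<close>, so the derivatives of \<open>?\<gamma>\<close>
      are the values already known to lie in \<open>C\<close>, and its increment over
      \<open>[0, 1]\<close> is the quotient in question.\<close>
    let ?\<gamma> = "\<lambda>r. (1 / t) *\<^sub>R D j (w t) (z t + (r * t) *\<^sub>R u t)"
    have "(1 / (1 - 0)) *\<^sub>R (?\<gamma> 1 - ?\<gamma> 0) \<in> C"
    proof (rule lcs_mean_value[OF C(2,1)])
      fix r :: real assume r: "0 \<le> r" "r \<le> 1"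
      let ?p = "z t + (r * t) *\<^sub>R u t"
      let ?\<Phi> = "D (Suc j) ((w t)(j := u t)) ?p"
      have p: "?\<Phi> \<in> C" "?p \<in> U" using elim r by auto
      have "limitin G (diff_quot (D j (w t)) ?p (u t)) ?\<Phi> (at 0)"
        using elim p by (intro limit') auto
      from limitin_compose_filterlim[OF this filterlim_mult_const_at_0[OF \<open>t \<noteq> 0\<close>]]
      have "limitin G (\<lambda>h. diff_quot (D j (w t)) ?p (u t) (h * t)) ?\<Phi> (at 0)" .
      moreover have "diff_quot (D j (w t)) ?p (u t) (h * t) = (1 / h) *\<^sub>R (?\<gamma> (r + h) - ?\<gamma> r)" for h
      proof -
        have "?p + (h * t) *\<^sub>R u t = z t + ((r + h) * t) *\<^sub>R u t" by (simp add: algebra_simps)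
        then show ?thesis by (simp only: diff_quot_def scaleR_scaleR flip: scaleR_diff_right) simp
      qed
      ultimately show "\<exists>l\<in>C. limitin G (\<lambda>h. (1 / h) *\<^sub>R (?\<gamma> (r + h) - ?\<gamma> r)) l (at 0)"
        using p by auto
    qed simp
    then show ?case using C(4) by (auto simp: scaleR_diff_right)
  qed
qed

text \<open>The step \<open>t (a + b)\<close> is taken as \<open>t a\<close> followed by
  \<open>t b\<close>. The second quotient starts at the moving point \<open>x + t a\<close>, where
  \<open>strict\<close> applies.\<close>

lemma add_last:
  assumes x: "x \<in> U" and v: "\<And>i. i < j \<Longrightarrow> v i \<in> topspace E" and ab: "a \<in> topspace E" "b \<in> topspace E"
  shows "D (Suc j) (v(j := a + b)) x = D (Suc j) (v(j := a)) x + D (Suc j) (v(j := b)) x"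
proof (rule limitin_unique[OF G])
  show "limitin G (diff_quot (D j v) x (a + b)) (D (Suc j) (v(j := a + b)) x) (at 0)"
    using assms lcs_topspace[OF E] by (intro limit') auto
  have "limitin G (\<lambda>t. (1 / t) *\<^sub>R (D j v (x + t *\<^sub>R a + t *\<^sub>R b) - D j v (x + t *\<^sub>R a)))
    (D (Suc j) (v(j := b)) x) (at 0)"
    using assms U_top by (intro strict line_limit[OF E]) auto
  then have "limitin G (\<lambda>t. diff_quot (D j v) x a t + (1 / t) *\<^sub>R (D j v (x + t *\<^sub>R a + t *\<^sub>R b) - D j v (x + t *\<^sub>R a)))
    (D (Suc j) (v(j := a)) x + D (Suc j) (v(j := b)) x) (at 0)"
    using assms by (intro limitin_add[OF G] limit') auto
  moreover have "diff_quot (D j v) x a t + (1 / t) *\<^sub>R (D j v (x + t *\<^sub>R a + t *\<^sub>R b) - D j v (x + t *\<^sub>R a))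
    = diff_quot (D j v) x (a + b) t" for t
    by (simp add: diff_quot_def add.assoc flip: scaleR_add_right)
  ultimately show "limitin G (diff_quot (D j v) x (a + b)) (D (Suc j) (v(j := a)) x + D (Suc j) (v(j := b)) x) (at 0)"
    by (simp flip: fun_eq_iff)
qed simp

lemma scale_last:
  assumes x: "x \<in> U" and v: "\<And>i. i < j \<Longrightarrow> v i \<in> topspace E" and a: "a \<in> topspace E"
  shows "D (Suc j) (v(j := r *\<^sub>R a)) x = r *\<^sub>R D (Suc j) (v(j := a)) x"
proof (rule limitin_unique[OF G])
  show 1: "limitin G (diff_quot (D j v) x (r *\<^sub>R a)) (D (Suc j) (v(j := r *\<^sub>R a)) x) (at 0)"
    using assms lcs_topspace[OF E] by (intro limit') auto
  show "limitin G (diff_quot (D j v) x (r *\<^sub>R a)) (r *\<^sub>R D (Suc j) (v(j := a)) x) (at 0)"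
  proof (cases "r = 0")
    case True
    then have "diff_quot (D j v) x (r *\<^sub>R a) = (\<lambda>t. 0)" by (simp add: diff_quot_def fun_eq_iff)
    then show ?thesis using True lcs_topspace[OF G] by simp
  next
    case False
    have "limitin G (\<lambda>t. r *\<^sub>R diff_quot (D j v) x a (t * r)) (r *\<^sub>R D (Suc j) (v(j := a)) x) (at 0)"
      using assms by (intro limitin_scaleR[OF G] limitin_compose_filterlim[OF limit' filterlim_mult_const_at_0[OF False]]) auto
    moreover have "r *\<^sub>R diff_quot (D j v) x a (t * r) = diff_quot (D j v) x (r *\<^sub>R a) t" for t
      using False by (simp add: diff_quot_def)
    ultimately show ?thesis by (simp flip: fun_eq_iff)
  qed
qed simp

text \<open>In the last slot this is \<open>add_last\<close> and \<open>scale_last\<close>. In an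
  earlier slot the identity holds, by induction, for the derivative of one order less at every point
  of \<open>U\<close>, and survives differentiation in the direction \<open>v j\<close>.\<close>

lemma linear:
  assumes "x \<in> U" "\<And>i. i < j \<Longrightarrow> v i \<in> topspace E" "a \<in> topspace E" "b \<in> topspace E" "i < j"
  shows "D j (v(i := r *\<^sub>R a + b)) x = r *\<^sub>R D j (v(i := a)) x + D j (v(i := b)) x"
  using assms(1,2,5)
proof (induction j arbitrary: x)
  case (Suc j)
  have c: "r *\<^sub>R a + b \<in> topspace E" using assms lcs_topspace[OF E] by simp
  show ?case
  proof (cases "i = j")
    case True
    have v: "\<And>i. i < j \<Longrightarrow> v i \<in> topspace E" using Suc.prems by simp
    show ?thesis unfolding True
      using add_last[where v = v and j = j, OF Suc.prems(1) v lcs_topspace(4)[OF E assms(3)] assms(4)]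
        scale_last[where v = v and j = j, OF Suc.prems(1) v assms(3)] by (simp only:)
  next
    case False
    then have ij: "i < j" using Suc.prems by simp
    have vj: "v j \<in> topspace E" using Suc.prems by auto
    have lim: "limitin G (diff_quot (D j (v(i := c))) x (v j)) (D (Suc j) (v(i := c)) x) (at 0)"
      if "c \<in> topspace E" for c
      using limit[of x j "v(i := c)"] that Suc.prems False by auto
    have eq: "D j (v(i := r *\<^sub>R a + b)) y = r *\<^sub>R D j (v(i := a)) y + D j (v(i := b)) y" if "y \<in> U" for y
      by (rule Suc.IH[OF that]) (use Suc.prems ij in auto)
    have "\<forall>\<^sub>F t in at 0. r *\<^sub>R diff_quot (D j (v(i := a))) x (v j) t + diff_quot (D j (v(i := b))) x (v j) t
        = diff_quot (D j (v(i := r *\<^sub>R a + b))) x (v j) t"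
      using line_in_open[OF E bs_openin[OF bs] Suc.prems(1) vj]
      by eventually_elim (simp only: diff_quot_def eq Suc.prems(1), simp add: algebra_simps)
    from limitin_cong_ev[OF limitin_add[OF G limitin_scaleR[OF G tendsto_const lim[OF assms(3)]] lim[OF assms(4)]] this]
    show ?thesis by (rule limitin_unique[OF G lim[OF c]]) simp
  qed
qed simp

text \<open>The form of linearity that pulls a difference quotient of directions out of a
  derivative.\<close>

lemma scale_diff:
  assumes "x \<in> U" "\<And>i. i < j \<Longrightarrow> v i \<in> topspace E" "a \<in> topspace E" "b \<in> topspace E" "i < j"
  shows "D j (v(i := r *\<^sub>R (a - b))) x = r *\<^sub>R (D j (v(i := a)) x - D j (v(i := b)) x)"
proof -
  have z: "0 \<in> topspace E" "a - b \<in> topspace E" using assms lcs_topspace[OF E] by auto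
  have "D j (v(i := 0)) x = 0" using linear[where v = v and r = 1, OF assms(1,2) z(1) z(1) assms(5)] by simp
  moreover have "D j (v(i := r *\<^sub>R (a - b))) x = r *\<^sub>R D j (v(i := a - b)) x + D j (v(i := 0)) x"
    using linear[where v = v and r = r, OF assms(1,2) z(2) z(1) assms(5)] by simp
  moreover have "D j (v(i := a)) x = D j (v(i := a - b)) x + D j (v(i := b)) x"
    using linear[where v = v and r = 1, OF assms(1,2) z(2) assms(4,5)] by simp
  ultimately show ?thesis by simp
qed

text \<open>The product rule for moving base point and moving directions. The base point moves
  first, with directions \<open>w t\<close>, and is handled by \<open>strict\<close>; then the
  directions are exchanged one after another, and multilinearity turns each exchange into a
  derivative in the direction of a difference quotient.\<close>

lemma curve:
  fixes y :: "real \<Rightarrow> 'e"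
  assumes x: "x \<in> U" and y: "limitin E (\<lambda>t. (1 / t) *\<^sub>R (y t - x)) y' (at 0)"
    and w: "\<And>i. i < j \<Longrightarrow> limitin E (\<lambda>t. (1 / t) *\<^sub>R (w t i - v i)) (w' i) (at 0)"
    and v: "\<And>i. i < j \<Longrightarrow> v i \<in> topspace E"
  shows "limitin G (\<lambda>t. (1 / t) *\<^sub>R (D j (w t) (y t) - D j v x))
    (D (Suc j) (v(j := y')) x + (\<Sum>i<j. D j (v(i := w' i)) x)) (at 0)"
proof -
  have w0: "limitin E (\<lambda>t. w t i) (v i) (at 0)" if "i < j" for i
    using limitin_zero_quotient[OF E w[OF that] v[OF that]] .
  \<comment> \<open>For \<open>t \<noteq> 0\<close> the point \<open>y t\<close> is \<open>x\<close>
    moved by \<open>t\<close> times its own difference quotient; that quotient is the convergent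
    direction \<open>u\<close> in \<open>strict\<close>.\<close>
  have "limitin G (\<lambda>t. (1 / t) *\<^sub>R (D j (w t) (x + t *\<^sub>R ((1 / t) *\<^sub>R (y t - x))) - D j (w t) x))
    (D (Suc j) (v(j := y')) x) (at 0)"
    by (rule strict[OF x _ y w0]) (use x U_top in auto)
  moreover have "\<forall>\<^sub>F t in at (0::real). (1 / t) *\<^sub>R (D j (w t) (x + t *\<^sub>R ((1 / t) *\<^sub>R (y t - x))) - D j (w t) x)
      = (1 / t) *\<^sub>R (D j (w t) (y t) - D j (w t) x)"
    using ev_nz by eventually_elim simp
  ultimately have 1: "limitin G (\<lambda>t. (1 / t) *\<^sub>R (D j (w t) (y t) - D j (w t) x)) (D (Suc j) (v(j := y')) x) (at 0)"
    by (rule limitin_cong_ev)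
  \<comment> \<open>The hybrid uses the new directions below \<open>n\<close> and the old ones from
    \<open>n\<close> on, so consecutive hybrids differ in slot \<open>n\<close> only and the
    differences telescope.\<close>
  define hyb where "hyb n t = (\<lambda>i. if i < n then w t i else v i)" for n t
  have evw: "\<forall>\<^sub>F t in at 0. \<forall>i\<in>{..<j}. w t i \<in> topspace E"
    using limitin_ev_topspace[OF w0] by (intro eventually_ball_finite) auto
  have step: "limitin G (\<lambda>t. (1 / t) *\<^sub>R (D j (hyb (Suc n) t) x - D j (hyb n t) x)) (D j (v(n := w' n)) x) (at 0)"
    if n: "n < j" for n
  proof -
    have "limitin G (\<lambda>t. D j ((hyb n t)(n := (1 / t) *\<^sub>R (w t n - v n))) x) (D j (v(n := w' n)) x) (at 0)"
    proof (rule cont[OF x])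
      show "limitin E (\<lambda>t. x) x (at (0::real))" using x U_top by simp
      show "limitin E (\<lambda>t. ((hyb n t)(n := (1 / t) *\<^sub>R (w t n - v n))) i) ((v(n := w' n)) i) (at 0)" if "i < j" for i
        using w0[OF that] w[OF that] v[OF that] by (cases "i = n"; cases "i < n") (auto simp: hyb_def)
    qed
    moreover have "\<forall>\<^sub>F t in at 0. D j ((hyb n t)(n := (1 / t) *\<^sub>R (w t n - v n))) x
        = (1 / t) *\<^sub>R (D j (hyb (Suc n) t) x - D j (hyb n t) x)"
      using evw
    proof eventually_elim
      case (elim t)
      have h: "hyb n t i \<in> topspace E" if "i < j" for i using elim v that by (auto simp: hyb_def)
      have wt: "w t n \<in> topspace E" "v n \<in> topspace E" using elim v n by auto
      have "hyb (Suc n) t = (hyb n t)(n := w t n)" "hyb n t = (hyb n t)(n := v n)"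
        by (auto simp: hyb_def fun_eq_iff less_Suc_eq)
      then show ?case using scale_diff[where v = "hyb n t" and r = "1 / t", OF x h wt n] by simp
    qed
    ultimately show ?thesis by (rule limitin_cong_ev)
  qed
  have 2: "limitin G (\<lambda>t. \<Sum>n<j. (1 / t) *\<^sub>R (D j (hyb (Suc n) t) x - D j (hyb n t) x)) (\<Sum>n<j. D j (v(n := w' n)) x) (at 0)"
    by (rule limitin_sum[OF G]) (use step in auto)
  have "(1 / t) *\<^sub>R (D j (w t) (y t) - D j (w t) x) + (\<Sum>n<j. (1 / t) *\<^sub>R (D j (hyb (Suc n) t) x - D j (hyb n t) x))
     = (1 / t) *\<^sub>R (D j (w t) (y t) - D j v x)" for t
  proof -
    have "(\<Sum>n<j. D j (hyb (Suc n) t) x - D j (hyb n t) x) = D j (hyb j t) x - D j (hyb 0 t) x"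
      by (rule sum_lessThan_telescope)
    moreover have "D j (hyb j t) x = D j (w t) x" by (rule iter_cong_dirs) (simp add: hyb_def)
    moreover have "hyb 0 t = v" by (simp add: hyb_def)
    ultimately show ?thesis by (simp only: flip: scaleR_sum_right scaleR_add_right) simp
  qed
  with limitin_add[OF G 1 2] show ?thesis by simp
qed

end

subsection \<open>Compositions\<close>

text \<open>Faa di Bruno's formula.  A list \<open>m\<close> of index lists stands for the summand
  $d^{(|m|)}g(f(x); d^{(|I|)}f(x; v_I))_{I \in m}$.\<close>

definition fdb_ext :: "nat \<Rightarrow> nat list list \<Rightarrow> nat list list list"
  where "fdb_ext n m = (m @ [[n]]) # map (\<lambda>i. m[i := m ! i @ [n]]) [0..<length m]"

text \<open>The partitions of \<open>{0..<n}\<close> into blocks. Differentiating in direction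
  \<open>n\<close> either hits the outer map, which opens the block \<open>[n]\<close>, or one of
  the inner derivatives, which appends \<open>n\<close> to its block.\<close>

primrec fdb :: "nat \<Rightarrow> nat list list list"
  where
    "fdb 0 = [[]]"
  | "fdb (Suc n) = concat (map (fdb_ext n) (fdb n))"

definition fdb_term ::
    "'f::real_vector topology \<Rightarrow> ('e::real_vector \<Rightarrow> 'f) \<Rightarrow> 'g::real_vector topology \<Rightarrow> ('f \<Rightarrow> 'g)
      \<Rightarrow> nat list list \<Rightarrow> (nat \<Rightarrow> 'e) \<Rightarrow> 'e \<Rightarrow> 'g"
  where "fdb_term F f G g m v x =
    iter_dirderiv G g (length m) (\<lambda>i. iter_dirderiv F f (length (m ! i)) (\<lambda>l. v (m ! i ! l)) x) (f x)"

text \<open>Only the directions below the order of the derivative are known to lie in the space or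
  to converge; the formula must not read any other.\<close>

lemma fdb_indices: "m \<in> set (fdb n) \<Longrightarrow> I \<in> set m \<Longrightarrow> l \<in> set I \<Longrightarrow> l < n"
proof (induction n arbitrary: m I l)
  case (Suc n)
  then obtain m' where m': "m' \<in> set (fdb n)" "m \<in> set (fdb_ext n m')" by auto
  then consider "m = m' @ [[n]]" | i where "i < length m'" "m = m'[i := m' ! i @ [n]]"
    by (auto simp: fdb_ext_def)
  then show ?case
  proof cases
    case 1
    then show ?thesis using Suc.IH[OF m'(1), of I l] Suc.prems by auto
  next
    case 2
    then have "I \<in> insert (m' ! i @ [n]) (set m')"
      using Suc.prems set_update_subset_insert by fast
    then show ?thesis using Suc.IH[OF m'(1), of _ l] Suc.prems nth_mem[OF 2(1)] by fastforce
  qed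
qed simp

lemma sum_list_quot:
  fixes a b :: "'i \<Rightarrow> 'f::real_vector"
  shows "c *\<^sub>R ((\<Sum>m\<leftarrow>ms. a m) - (\<Sum>m\<leftarrow>ms. b m)) = (\<Sum>m\<leftarrow>ms. c *\<^sub>R (a m - b m))"
  by (induction ms) (simp_all add: algebra_simps)

lemma sum_list_concat_map:
  fixes a :: "'i \<Rightarrow> 'f::comm_monoid_add"
  shows "(\<Sum>m\<leftarrow>concat (map f ms). a m) = (\<Sum>m\<leftarrow>ms. \<Sum>m'\<leftarrow>f m. a m')"
  by (induction ms) simp_all

text \<open>An instance of \<open>curve\<close>: the base point is \<open>f\<close> along the line
  in direction \<open>v n\<close>, and the directions are the inner derivatives along it. The
  derivative of the base point yields the summand with the new block \<open>[n]\<close>, that of the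
  \<open>i\<close>-th direction the summand in which block \<open>i\<close> is enlarged by
  \<open>n\<close>.\<close>

lemma (in bastiani_map) fdb_term_limit:
  fixes f :: "'d::real_vector \<Rightarrow> 'e"
  assumes f: "bastiani_map K W E f" and fW: "\<And>x. x \<in> W \<Longrightarrow> f x \<in> U" and x: "x \<in> W"
    and m: "\<And>I l. I \<in> set m \<Longrightarrow> l \<in> set I \<Longrightarrow> v l \<in> topspace K" and n: "v n \<in> topspace K"
  shows "limitin G (diff_quot (fdb_term E f G g m v) x (v n)) (\<Sum>m'\<leftarrow>fdb_ext n m. fdb_term E f G g m' v x) (at 0)"
proof -
  interpret f: bastiani_map K W E f by (rule f)
  let ?j = "length m"
  let ?w = "\<lambda>t i. iter_dirderiv E f (length (m ! i)) (\<lambda>l. v (m ! i ! l)) (x + t *\<^sub>R v n)"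
  let ?v = "\<lambda>i. iter_dirderiv E f (length (m ! i)) (\<lambda>l. v (m ! i ! l)) x"
  let ?w' = "\<lambda>i. iter_dirderiv E f (Suc (length (m ! i))) (\<lambda>l. v ((m ! i @ [n]) ! l)) x"
  let ?y' = "iter_dirderiv E f (Suc 0) (\<lambda>_. v n) x"
  have mi: "v (m ! i ! l) \<in> topspace K" if "i < ?j" "l < length (m ! i)" for i l
    using m[OF nth_mem[OF that(1)] nth_mem[OF that(2)]] .
  have "limitin E (diff_quot (iter_dirderiv E f 0 (\<lambda>_. v n)) x (v n)) ?y' (at 0)"
    using f.limit[OF x, of 0 "\<lambda>_. v n"] n by simp
  then have y: "limitin E (\<lambda>t. (1 / t) *\<^sub>R (f (x + t *\<^sub>R v n) - f x)) ?y' (at 0)"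
    by (simp add: diff_quot_def)
  have w: "limitin E (\<lambda>t. (1 / t) *\<^sub>R (?w t i - ?v i)) (?w' i) (at 0)" if i: "i < ?j" for i
  proof -
    let ?u = "\<lambda>l. v ((m ! i @ [n]) ! l)"
    have eq: "iter_dirderiv E f (length (m ! i)) ?u y = iter_dirderiv E f (length (m ! i)) (\<lambda>l. v (m ! i ! l)) y" for y
      by (rule iter_cong_dirs) (simp add: nth_append)
    have "limitin E (diff_quot (iter_dirderiv E f (length (m ! i)) ?u) x (?u (length (m ! i)))) (?w' i) (at 0)"
      by (rule f.limit[OF x]) (use mi[OF i] n in \<open>auto simp: nth_append\<close>)
    then show ?thesis by (simp add: diff_quot_def eq)
  qed
  have "limitin G (\<lambda>t. (1 / t) *\<^sub>R (D ?j (?w t) (f (x + t *\<^sub>R v n)) - D ?j ?v (f x)))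
    (D (Suc ?j) (?v(?j := ?y')) (f x) + (\<Sum>i<?j. D ?j (?v(i := ?w' i)) (f x))) (at 0)"
    by (rule curve[OF fW[OF x] y w]) (use f.top[OF x] mi in auto)
  moreover have "D (Suc ?j) (?v(?j := ?y')) (f x) = fdb_term E f G g (m @ [[n]]) v x"
    unfolding fdb_term_def length_append length_Cons list.size(3) add_0_right add_Suc_right
  proof (rule iter_cong_dirs)
    fix i assume "i < Suc ?j"
    \<comment> \<open>A first derivative reads index 0 only, so the constant sequence
      \<open>v n\<close> and the sequence of the block \<open>[n]\<close> give the same
      value.\<close>
    have "?y' = iter_dirderiv E f (Suc 0) (\<lambda>l. v ([n] ! l)) x" by (rule iter_cong_dirs) simp
    then show "(?v(?j := ?y')) i = iter_dirderiv E f (length ((m @ [[n]]) ! i)) (\<lambda>l. v ((m @ [[n]]) ! i ! l)) x"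
      using \<open>i < Suc ?j\<close> by (auto simp del: iter_dirderiv.simps simp: nth_append less_Suc_eq)
  qed
  moreover have "D ?j (?v(i := ?w' i)) (f x) = fdb_term E f G g (m[i := m ! i @ [n]]) v x" if "i < ?j" for i
    unfolding fdb_term_def length_list_update
    by (rule iter_cong_dirs) (use that in \<open>auto simp del: iter_dirderiv.simps simp: nth_list_update\<close>)
  ultimately show ?thesis
    by (simp add: fdb_ext_def diff_quot_def fdb_term_def[of E f G g m] o_def interv_sum_list_conv_sum_set_nat
        lessThan_atLeast0 del: iter_dirderiv.simps)
qed

text \<open>The sums over \<open>fdb n\<close> are the candidates for
  \<open>bastiani_by_derivatives\<close>; their continuity is that of the outer and inner
  derivatives.\<close>

lemma bastiani_compose:
  assumes K: "lcs K" and E: "lcs E" and G: "lcs G" and f: "bastiani_smooth K W E f" and g: "bastiani_smooth E U G g"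
    and fW: "\<And>x. x \<in> W \<Longrightarrow> f x \<in> U"
  shows "bastiani_smooth K W G (g \<circ> f)"
proof (rule bastiani_by_derivatives[OF K G bs_openin[OF f]])
  interpret f: bastiani_map K W E f using K E f by (intro bastiani_map.intro)
  interpret g: bastiani_map E U G g using E G g by (intro bastiani_map.intro)
  let ?\<Phi> = "\<lambda>n v x. \<Sum>m\<leftarrow>fdb n. fdb_term E f G g m v x"
  show "?\<Phi> 0 v x = (g \<circ> f) x" for v x by (simp add: fdb_term_def)
  show "limitin G (diff_quot (?\<Phi> n v) x (v n)) (?\<Phi> (Suc n) v x) (at 0)"
    if x: "x \<in> W" and v: "\<And>i. i \<le> n \<Longrightarrow> v i \<in> topspace K" for n v x
  proof -
    have "limitin G (\<lambda>t. \<Sum>m\<leftarrow>fdb n. diff_quot (fdb_term E f G g m v) x (v n) t)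
      (\<Sum>m\<leftarrow>fdb n. \<Sum>m'\<leftarrow>fdb_ext n m. fdb_term E f G g m' v x) (at 0)"
      by (intro limitin_sum_list[OF G] g.fdb_term_limit[OF f.bastiani_map_axioms fW x] v) (use fdb_indices in force)+
    then show ?thesis by (simp add: sum_list_concat_map diff_quot_def sum_list_quot)
  qed
  fix j :: nat and x v w y and L :: "('a \<times> (nat \<Rightarrow> 'a)) filter"
  assume x: "x \<in> W" and y: "limitin K y x L" and w: "\<And>i. i < j \<Longrightarrow> limitin K (\<lambda>t. w t i) (v i) L"
  show "limitin G (\<lambda>t. ?\<Phi> j (w t) (y t)) (?\<Phi> j v x) L"
  proof (rule limitin_sum_list[OF G])
    fix m assume m: "m \<in> set (fdb j)"
    show "limitin G (\<lambda>t. fdb_term E f G g m (w t) (y t)) (fdb_term E f G g m v x) L"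
      unfolding fdb_term_def
    proof (rule g.cont[OF fW[OF x]])
      show "limitin E (\<lambda>t. f (y t)) (f x) L" using f.cont[OF x y, of 0 w v] by simp
      fix i assume i: "i < length m"
      show "limitin E (\<lambda>t. iter_dirderiv E f (length (m ! i)) (\<lambda>l. w t (m ! i ! l)) (y t))
          (iter_dirderiv E f (length (m ! i)) (\<lambda>l. v (m ! i ! l)) x) L"
        by (rule f.cont[OF x y], rule w, rule fdb_indices[OF m nth_mem[OF i] nth_mem])
    qed
  qed
qed

text \<open>The case \<open>j = 0\<close> of \<open>curve\<close>, with no directions besides that
  of the base point.\<close>

lemma bastiani_chain:
  assumes "lcs K" "lcs E" "lcs G" "bastiani_smooth K W E f" "bastiani_smooth E U G g" "f x \<in> U" "x \<in> W"
    "v \<in> topspace K"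
  shows "dirderiv G (g \<circ> f) x v = dirderiv G g (f x) (dirderiv E f x v)"
proof -
  interpret f: bastiani_map K W E f using assms by (intro bastiani_map.intro)
  interpret g: bastiani_map E U G g using assms by (intro bastiani_map.intro)
  have "limitin E (diff_quot f x v) (dirderiv E f x v) (at 0)"
    using f.limit'[of x 0 "\<lambda>_. v" v] assms by (simp add: iter_dirderiv_0)
  then have "limitin G (\<lambda>t. (1 / t) *\<^sub>R (g.D 0 (\<lambda>_. 0) (f (x + t *\<^sub>R v)) - g.D 0 (\<lambda>_. 0) (f x)))
    (g.D (Suc 0) ((\<lambda>_. 0)(0 := dirderiv E f x v)) (f x) + (\<Sum>i<0. 0)) (at 0)"
    using g.curve[of "f x" "\<lambda>t. f (x + t *\<^sub>R v)" "dirderiv E f x v" 0 "\<lambda>_ _. 0" "\<lambda>_. 0"] assms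
    by (simp add: diff_quot_def)
  then show ?thesis by (intro dirderivI[OF g.G]) (simp add: diff_quot_def iter_dirderiv_0)
qed

subsection \<open>Locality\<close>

lemma bastiani_cong:
  assumes E: "lcs E" and f: "bastiani_smooth E U F f" and fg: "\<And>x. x \<in> U \<Longrightarrow> f x = g x"
  shows "bastiani_smooth E U F g"
proof -
  have U: "openin E U" using f by (rule bs_openin)
  have eq: "iter_dirderiv F g j v x = iter_dirderiv F f j v x" if "x \<in> U" "\<And>i. i < j \<Longrightarrow> v i \<in> topspace E" for j v x
    using iter_cong[OF E U fg that] by simp
  show ?thesis
    unfolding bastiani_smooth_def
  proof (intro conjI allI ballI impI U)
    show "g \<in> U \<rightarrow> topspace F" using bs_maps[OF f] fg by force
    fix j
    show "continuous_map (prod_topology (subtopology E U) (power_lcs E j)) F (\<lambda>(x, v). iter_dirderiv F g j v x)"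
    proof (rule continuous_map_eq)
      show "continuous_map (prod_topology (subtopology E U) (power_lcs E j)) F (\<lambda>(x, v). iter_dirderiv F f j v x)"
        using f by (simp add: bastiani_smooth_def)
    qed (auto simp: topspace_power_lcs eq)
    fix x and v :: "nat \<Rightarrow> 'a" assume x: "x \<in> U" and v: "\<forall>i\<le>j. v i \<in> topspace E"
    obtain l where l: "limitin F (diff_quot (iter_dirderiv F f j v) x (v j)) l (at 0)"
      using f x v unfolding bastiani_smooth_def by blast
    have ev: "\<forall>\<^sub>F t in at 0. iter_dirderiv F g j v (x + t *\<^sub>R v j) = iter_dirderiv F f j v (x + t *\<^sub>R v j)"
      using line_in_open[OF E U x v[rule_format, OF order_refl]] by eventually_elim (simp add: eq v)
    have "limitin F (diff_quot (iter_dirderiv F g j v) x (v j)) l (at 0)"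
      using l unfolding diff_quot_cong[of "iter_dirderiv F g j v" x "v j" "iter_dirderiv F f j v", OF ev eq[OF x]]
      by (simp add: diff_quot_cong[of "iter_dirderiv F g j v" x "v j" "iter_dirderiv F f j v", OF ev eq[OF x]] v)
    then show "\<exists>l. limitin F (diff_quot (iter_dirderiv F g j v) x (v j)) l (at 0)" ..
  qed
qed

text \<open>\<open>iter_dirderiv\<close> does not mention the domain, so the derivatives belonging
  to the local pieces are the same functions, and both conditions on them can be checked at one
  point at a time.\<close>

lemma bastiani_local:
  assumes E: "lcs E" and F: "lcs F"
    and loc: "\<And>x. x \<in> U \<Longrightarrow> \<exists>W. x \<in> W \<and> bastiani_smooth E W F f" and U: "openin E U"
  shows "bastiani_smooth E U F f"
proof (rule bastiani_by_derivatives[OF E F U])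
  have W: "\<exists>W. x \<in> W \<and> bastiani_map E W F f" if "x \<in> U" for x
    using loc[OF that] E F by (auto intro: bastiani_map.intro)
  show "limitin F (diff_quot (iter_dirderiv F f j v) x (v j)) (iter_dirderiv F f (Suc j) v x) (at 0)"
    if "x \<in> U" "\<And>i. i \<le> j \<Longrightarrow> v i \<in> topspace E" for j v x
    using W[OF that(1)] bastiani_map.limit that(2) by blast
  fix j :: nat and x v w y and L :: "('a \<times> (nat \<Rightarrow> 'a)) filter"
  assume x: "x \<in> U" and l: "limitin E y x L" "\<And>i. i < j \<Longrightarrow> limitin E (\<lambda>t. w t i) (v i) L"
  obtain W where "x \<in> W" "bastiani_map E W F f" using W[OF x] by blast
  then show "limitin F (\<lambda>t. iter_dirderiv F f j (w t) (y t)) (iter_dirderiv F f j v x) L"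
    using l by (intro bastiani_map.cont)
qed simp

lemma bastiani_subset:
  assumes "lcs E" "lcs F" "bastiani_smooth E U F f" "openin E W" "W \<subseteq> U"
  shows "bastiani_smooth E W F f"
  using assms by (intro bastiani_local) auto

subsection \<open>Elementary smooth maps\<close>

lemma bastiani_linear:
  assumes E: "lcs E" and F: "lcs F" and c: "continuous_map E F L"
    and add: "\<And>x y. x \<in> topspace E \<Longrightarrow> y \<in> topspace E \<Longrightarrow> L (x + y) = L x + L y"
    and scale: "\<And>r x. x \<in> topspace E \<Longrightarrow> L (r *\<^sub>R x) = r *\<^sub>R L x"
    and U: "openin E U"
  shows "bastiani_smooth E U F L"
proof (rule bastiani_by_derivatives[OF E F U, where \<Phi> = "\<lambda>j v x. if j = 0 then L x else if j = 1 then L (v 0) else 0"])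
  let ?\<Phi> = "\<lambda>j (v :: nat \<Rightarrow> 'a) x. if j = 0 then L x else if j = 1 then L (v 0) else 0"
  have Ltop: "L x \<in> topspace F" if "x \<in> topspace E" for x using c that by (auto simp: continuous_map_def)
  show "?\<Phi> 0 v x = L x" for v x by simp
  show "limitin F (diff_quot (?\<Phi> j v) x (v j)) (?\<Phi> (Suc j) v x) (at 0)"
    if x: "x \<in> U" and v: "\<And>i. i \<le> j \<Longrightarrow> v i \<in> topspace E" for j v x
  proof (rule limitin_eventually)
    have x: "x \<in> topspace E" using x openin_subset[OF U] by auto
    show "?\<Phi> (Suc j) v x \<in> topspace F" using Ltop v lcs_topspace[OF F] by auto
    have "L (x + t *\<^sub>R v j) = L x + t *\<^sub>R L (v j)" for t
      using x v[OF order_refl] by (simp add: add scale lcs_topspace[OF E])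
    then have "diff_quot (?\<Phi> j v) x (v j) t = ?\<Phi> (Suc j) v x" if "t \<noteq> 0" for t
      using that by (cases "j = 0") (simp_all add: diff_quot_def)
    then show "\<forall>\<^sub>F t in at 0. diff_quot (?\<Phi> j v) x (v j) t = ?\<Phi> (Suc j) v x"
      by (rule eventually_mono[OF ev_nz])
  qed
  show "limitin F (\<lambda>t. ?\<Phi> j (w t) (y t)) (?\<Phi> j v x) M"
    if "limitin E y x M" "\<And>i. i < j \<Longrightarrow> limitin E (\<lambda>t. w t i) (v i) M" for j x v w y and M :: "('a \<times> (nat \<Rightarrow> 'a)) filter"
    using limitin_map[OF c that(1)] limitin_map[OF c that(2)[of 0]] lcs_topspace[OF F] by auto
qed

lemma bastiani_const:
  assumes E: "lcs E" and F: "lcs F" and U: "openin E U" and c: "c \<in> topspace F"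
  shows "bastiani_smooth E U F (\<lambda>_. c)"
  by (rule bastiani_by_derivatives[OF E F U, where \<Phi> = "\<lambda>j v x. if j = 0 then c else 0"])
     (use c lcs_topspace(1)[OF F] in \<open>auto simp: diff_quot_def\<close>)

lemma bastiani_Pair:
  assumes f: "bastiani_map E U F f" and g: "bastiani_map E U G g"
  shows "bastiani_smooth E U (prod_topology F G) (\<lambda>x. (f x, g x))"
proof -
  interpret f: bastiani_map E U F f by (rule f)
  interpret g: bastiani_map E U G g by (rule g)
  let ?\<Phi> = "\<lambda>j v x. (iter_dirderiv F f j v x, iter_dirderiv G g j v x)"
  show ?thesis
  proof (rule bastiani_by_derivatives[OF f.E lcs_prod[OF f.G g.G] bs_openin[OF f.bs]])
    show "?\<Phi> 0 v x = (f x, g x)" for v x by simp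
    have "diff_quot (?\<Phi> j v) x u = (\<lambda>t. (diff_quot (iter_dirderiv F f j v) x u t, diff_quot (iter_dirderiv G g j v) x u t))"
      for j v x u by (simp add: diff_quot_def scaleR_prod_def)
    then show "limitin (prod_topology F G) (diff_quot (?\<Phi> j v) x (v j)) (?\<Phi> (Suc j) v x) (at 0)"
      if "x \<in> U" "\<And>i. i \<le> j \<Longrightarrow> v i \<in> topspace E" for j v x
      using limitin_Pair[OF f.limit[OF that] g.limit[OF that]] by simp
    show "limitin (prod_topology F G) (\<lambda>t. ?\<Phi> j (w t) (y t)) (?\<Phi> j v x) M"
      if "x \<in> U" "limitin E y x M" "\<And>i. i < j \<Longrightarrow> limitin E (\<lambda>t. w t i) (v i) M"
      for j x v w y and M :: "('a \<times> (nat \<Rightarrow> 'a)) filter"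
      using limitin_Pair[OF f.cont[OF that] g.cont[OF that]] .
  qed
qed

lemma bastiani_power:
  assumes E: "lcs E" and F: "lcs F" and U: "openin E U"
    and f: "\<And>i. i < k \<Longrightarrow> bastiani_smooth E U F (\<lambda>x. f x i)" and z: "\<And>x i. i \<ge> k \<Longrightarrow> f x i = 0"
  shows "bastiani_smooth E U (power_lcs F k) f"
proof (rule bastiani_by_derivatives[OF E lcs_power[OF F] U])
  have f': "bastiani_map E U F (\<lambda>x. f x i)" if "i < k" for i
    using f[OF that] E F by (intro bastiani_map.intro)
  let ?\<Phi> = "\<lambda>j v x i. if i < k then iter_dirderiv F (\<lambda>x. f x i) j v x else 0"
  show "?\<Phi> 0 v x = f x" for v x using z by (auto simp: fun_eq_iff)
  have "diff_quot (?\<Phi> j v) x u t = (\<lambda>i. if i < k then diff_quot (iter_dirderiv F (\<lambda>x. f x i) j v) x u t else 0)" for j v x u t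
    by (auto simp: diff_quot_def scaleR_fun_def fun_eq_iff)
  then show "limitin (power_lcs F k) (diff_quot (?\<Phi> j v) x (v j)) (?\<Phi> (Suc j) v x) (at 0)"
    if "x \<in> U" "\<And>i. i \<le> j \<Longrightarrow> v i \<in> topspace E" for j v x
    using bastiani_map.limit[OF f' that] by (intro limitin_power_lcs) (auto simp del: iter_dirderiv.simps)
  show "limitin (power_lcs F k) (\<lambda>t. ?\<Phi> j (w t) (y t)) (?\<Phi> j v x) M"
    if "x \<in> U" "limitin E y x M" "\<And>i. i < j \<Longrightarrow> limitin E (\<lambda>t. w t i) (v i) M"
    for j x v w y and M :: "('a \<times> (nat \<Rightarrow> 'a)) filter"
    using bastiani_map.cont[OF f' that] by (intro limitin_power_lcs) auto
qed

section \<open>Smooth maps between manifolds\<close>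

text \<open>A manifold without the compatibility of its charts, which compositions do not need.\<close>

definition charted :: "('m, 'e::real_vector) mfd \<Rightarrow> bool"
  where "charted M \<longleftrightarrow>
    pts M = (\<Union>\<kappa>\<in>atlas M. cdom \<kappa>) \<and>
    (\<forall>\<kappa>\<in>atlas M. lcs (cmodel \<kappa>) \<and> openin (mtop M) (cdom \<kappa>) \<and> inj_on (cmap \<kappa>) (cdom \<kappa>) \<and>
       continuous_map (subtopology (mtop M) (cdom \<kappa>)) (cmodel \<kappa>) (cmap \<kappa>) \<and>
       (\<forall>W. openin (mtop M) W \<and> W \<subseteq> cdom \<kappa> \<longrightarrow> openin (cmodel \<kappa>) (cmap \<kappa> ` W)))"

lemma manifold_charted:
  assumes M: "manifold M"
  shows "charted M"
  unfolding charted_def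
proof (intro conjI ballI allI impI)
  show "pts M = (\<Union>\<kappa>\<in>atlas M. cdom \<kappa>)" using M unfolding manifold_def by (elim conjE)
  fix \<kappa> assume \<kappa>: "\<kappa> \<in> atlas M"
  have h: "lcs (cmodel \<kappa>)" "openin (mtop M) (cdom \<kappa>)" "openin (cmodel \<kappa>) (cmap \<kappa> ` cdom \<kappa>)"
    "homeomorphic_map (subtopology (mtop M) (cdom \<kappa>)) (subtopology (cmodel \<kappa>) (cmap \<kappa> ` cdom \<kappa>)) (cmap \<kappa>)"
    using M \<kappa> unfolding manifold_def by (elim conjE; simp)+
  have top: "topspace (subtopology (mtop M) (cdom \<kappa>)) = cdom \<kappa>" using openin_subset[OF h(2)] by auto
  show "lcs (cmodel \<kappa>)" "openin (mtop M) (cdom \<kappa>)" by fact+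
  show "inj_on (cmap \<kappa>) (cdom \<kappa>)" using homeomorphic_imp_injective_map[OF h(4)] top by simp
  show "continuous_map (subtopology (mtop M) (cdom \<kappa>)) (cmodel \<kappa>) (cmap \<kappa>)"
    using homeomorphic_imp_continuous_map[OF h(4)] continuous_map_into_fulltopology by blast
  fix W assume W: "openin (mtop M) W \<and> W \<subseteq> cdom \<kappa>"
  then have "openin (subtopology (mtop M) (cdom \<kappa>)) W" by (simp add: openin_open_subtopology h(2))
  then have "openin (subtopology (cmodel \<kappa>) (cmap \<kappa> ` cdom \<kappa>)) (cmap \<kappa> ` W)"
    using homeomorphic_map_openness[OF h(4), of W] W top by auto
  then show "openin (cmodel \<kappa>) (cmap \<kappa> ` W)" using openin_open_subtopology[OF h(3)] by blast
qed

lemma charted_covers: "charted M \<Longrightarrow> x \<in> pts M \<Longrightarrow> \<exists>\<kappa>\<in>atlas M. x \<in> cdom \<kappa>"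
  by (auto simp: charted_def)

locale chart_of =
  fixes M :: "('m, 'e::real_vector) mfd" and \<kappa>
  assumes charted: "charted M" and in_atlas: "\<kappa> \<in> atlas M"
begin

lemma lcs: "lcs (cmodel \<kappa>)"
  and openin_cdom: "openin (mtop M) (cdom \<kappa>)"
  and inj: "inj_on (cmap \<kappa>) (cdom \<kappa>)"
  and cont: "continuous_map (subtopology (mtop M) (cdom \<kappa>)) (cmodel \<kappa>) (cmap \<kappa>)"
  using charted in_atlas by (auto simp: charted_def)

lemma open_image: "openin (mtop M) W \<Longrightarrow> W \<subseteq> cdom \<kappa> \<Longrightarrow> openin (cmodel \<kappa>) (cmap \<kappa> ` W)"
  using charted in_atlas unfolding charted_def by blast

lemma cinv_cmap [simp]: "x \<in> cdom \<kappa> \<Longrightarrow> cinv \<kappa> (cmap \<kappa> x) = x"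
  using inj by simp

lemma cmap_topspace: "x \<in> cdom \<kappa> \<Longrightarrow> cmap \<kappa> x \<in> topspace (cmodel \<kappa>)"
  using open_image[OF openin_cdom] openin_subset by blast

text \<open>For small \<open>t\<close> the chart line stays in the image of \<open>W\<close>, where
  \<open>cinv\<close> really inverts the chart; derivatives in the chart therefore see only an
  arbitrarily small neighbourhood of \<open>x\<close>.\<close>

lemma line:
  assumes "openin (mtop M) W" "x \<in> W" "x \<in> cdom \<kappa>" "v \<in> topspace (cmodel \<kappa>)"
  shows "\<forall>\<^sub>F t in at (0::real). cinv \<kappa> (cmap \<kappa> x + t *\<^sub>R v) \<in> W \<and> cinv \<kappa> (cmap \<kappa> x + t *\<^sub>R v) \<in> cdom \<kappa> \<and>
    cmap \<kappa> (cinv \<kappa> (cmap \<kappa> x + t *\<^sub>R v)) = cmap \<kappa> x + t *\<^sub>R v"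
proof -
  have "openin (cmodel \<kappa>) (cmap \<kappa> ` (W \<inter> cdom \<kappa>))"
    using assms openin_cdom by (intro open_image) auto
  then have "\<forall>\<^sub>F t in at (0::real). cmap \<kappa> x + t *\<^sub>R v \<in> cmap \<kappa> ` (W \<inter> cdom \<kappa>)"
    using assms by (intro line_in_open[OF lcs]) auto
  then show ?thesis by eventually_elim auto
qed

end

lemma chart_ofI: "manifold M \<Longrightarrow> \<kappa> \<in> atlas M \<Longrightarrow> chart_of M \<kappa>"
  by (simp add: chart_of_def manifold_charted)

lemma charted_lcs: "lcs E \<Longrightarrow> charted (lcs_mfd E)"
  by (auto simp: charted_def lcs_mfd_def lcs_chart_def openin_subset)

lemma prod_chartE:
  assumes "\<kappa> \<in> atlas (prod_mfd N P)"
  obtains a b where "a \<in> atlas N" "b \<in> atlas P"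
    "\<kappa> = \<lparr>cdom = cdom a \<times> cdom b, cmodel = prod_topology (cmodel a) (cmodel b), cmap = map_prod (cmap a) (cmap b)\<rparr>"
  using assms unfolding prod_mfd_def by auto

lemma charted_prod:
  assumes M: "charted M" and N: "charted N"
  shows "charted (prod_mfd M N)"
  unfolding charted_def
proof (intro conjI ballI allI impI)
  show "pts (prod_mfd M N) = (\<Union>\<kappa>\<in>atlas (prod_mfd M N). cdom \<kappa>)"
    using M N unfolding charted_def by (fastforce simp: prod_mfd_def)
  fix \<kappa> assume "\<kappa> \<in> atlas (prod_mfd M N)"
  then obtain a b where ab: "a \<in> atlas M" "b \<in> atlas N"
    and \<kappa>: "\<kappa> = \<lparr>cdom = cdom a \<times> cdom b, cmodel = prod_topology (cmodel a) (cmodel b), cmap = map_prod (cmap a) (cmap b)\<rparr>"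
    by (rule prod_chartE)
  interpret a: chart_of M a using M ab by (simp add: chart_of_def)
  interpret b: chart_of N b using N ab by (simp add: chart_of_def)
  show "lcs (cmodel \<kappa>)" using a.lcs b.lcs by (simp add: \<kappa> lcs_prod)
  show "openin (mtop (prod_mfd M N)) (cdom \<kappa>)"
    using a.openin_cdom b.openin_cdom by (simp add: \<kappa> prod_mfd_def openin_prod_Times_iff)
  show "inj_on (cmap \<kappa>) (cdom \<kappa>)" using a.inj b.inj by (simp add: \<kappa> map_prod_inj_on)
  show "continuous_map (subtopology (mtop (prod_mfd M N)) (cdom \<kappa>)) (cmodel \<kappa>) (cmap \<kappa>)"
    using a.cont b.cont by (simp add: \<kappa> prod_mfd_def subtopology_Times map_prod_def continuous_map_prod_top)
  fix W assume W: "openin (mtop (prod_mfd M N)) W \<and> W \<subseteq> cdom \<kappa>"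
  show "openin (cmodel \<kappa>) (cmap \<kappa> ` W)"
    unfolding \<kappa> openin_prod_topology_alt simp_thms chart.select_convs
  proof (intro allI impI)
    fix x y assume "(x, y) \<in> map_prod (cmap a) (cmap b) ` W"
    then obtain p q where pq: "(p, q) \<in> W" "x = cmap a p" "y = cmap b q" by auto
    then obtain P Q where PQ: "openin (mtop M) P" "openin (mtop N) Q" "p \<in> P" "q \<in> Q" "P \<times> Q \<subseteq> W"
      using W unfolding prod_mfd_def openin_prod_topology_alt mfd.select_convs by meson
    then have "P \<subseteq> cdom a" "Q \<subseteq> cdom b" using W pq by (auto simp: \<kappa>)
    have "cmap a ` P \<times> cmap b ` Q = map_prod (cmap a) (cmap b) ` (P \<times> Q)"
      by (simp add: map_prod_def image_paired_Times)
    then have "cmap a ` P \<times> cmap b ` Q \<subseteq> map_prod (cmap a) (cmap b) ` W" using PQ(5) by blast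
    with \<open>P \<subseteq> cdom a\<close> \<open>Q \<subseteq> cdom b\<close> show "\<exists>U V. openin (cmodel a) U \<and> openin (cmodel b) V \<and> x \<in> U \<and> y \<in> V \<and> U \<times> V \<subseteq> map_prod (cmap a) (cmap b) ` W"
      using a.open_image[OF PQ(1)] b.open_image[OF PQ(2)] PQ pq
      by (intro exI[of _ "cmap a ` P"] exI[of _ "cmap b ` Q"]) auto
  qed
qed

lemma smooth_openin: "smooth_map_on M U N f \<Longrightarrow> openin (mtop M) U"
  and smooth_cont: "smooth_map_on M U N f \<Longrightarrow> continuous_map (subtopology (mtop M) U) (mtop N) f"
  and smooth_bastiani: "smooth_map_on M U N f \<Longrightarrow> \<kappa> \<in> atlas M \<Longrightarrow> \<kappa>' \<in> atlas N \<Longrightarrow>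
    bastiani_smooth (cmodel \<kappa>) (cmap \<kappa> ` {x \<in> cdom \<kappa> \<inter> U. f x \<in> cdom \<kappa>'}) (cmodel \<kappa>') (cmap \<kappa>' \<circ> f \<circ> cinv \<kappa>)"
  by (auto simp: smooth_map_on_def)

lemma smooth_subset_pts: "smooth_map_on M U N f \<Longrightarrow> x \<in> U \<Longrightarrow> x \<in> pts M"
  using smooth_openin openin_subset by blast

lemma smooth_maps: "smooth_map_on M U N f \<Longrightarrow> x \<in> U \<Longrightarrow> f x \<in> pts N"
  using smooth_cont[of M U N f] smooth_subset_pts[of M U N f x] by (auto simp: continuous_map_def)

lemma smooth_preimage:
  assumes "smooth_map_on M U N f" "openin (mtop N) V"
  shows "openin (mtop M) {x \<in> U. f x \<in> V}"
proof -
  have "openin (subtopology (mtop M) U) {x \<in> topspace (subtopology (mtop M) U). f x \<in> V}"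
    using openin_continuous_map_preimage[OF smooth_cont[OF assms(1)] assms(2)] .
  moreover have "{x \<in> topspace (subtopology (mtop M) U). f x \<in> V} = {x \<in> U. f x \<in> V}"
    using smooth_subset_pts[OF assms(1)] by auto
  ultimately show ?thesis using openin_open_subtopology[OF smooth_openin[OF assms(1)]] by simp
qed

lemma smooth_dom_open:
  assumes "smooth_map_on M U N f" "charted M" "charted N" "\<kappa> \<in> atlas M" "\<kappa>' \<in> atlas N"
  shows "openin (mtop M) {x \<in> cdom \<kappa> \<inter> U. f x \<in> cdom \<kappa>'}"
proof -
  interpret a: chart_of M \<kappa> using assms by (simp add: chart_of_def)
  interpret b: chart_of N \<kappa>' using assms by (simp add: chart_of_def)
  have "{x \<in> cdom \<kappa> \<inter> U. f x \<in> cdom \<kappa>'} = cdom \<kappa> \<inter> {x \<in> U. f x \<in> cdom \<kappa>'}" by auto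
  then show ?thesis using smooth_preimage[OF assms(1) b.openin_cdom] a.openin_cdom by auto
qed

text \<open>The intermediate chart of \<open>N\<close> varies with the point, so
  \<open>bastiani_compose\<close> gives smoothness near each point only, and
  \<open>bastiani_local\<close> glues.\<close>

lemma smooth_compose:
  assumes M: "charted M" and N: "charted N" and P: "charted P"
    and f: "smooth_map_on M U N f" and g: "smooth_map_on N V P g" and fV: "\<And>x. x \<in> U \<Longrightarrow> f x \<in> V"
  shows "smooth_map_on M U P (\<lambda>x. g (f x))"
  unfolding smooth_map_on_def
proof (intro conjI ballI)
  show "openin (mtop M) U" using f by (rule smooth_openin)
  have "continuous_map (subtopology (mtop M) U) (subtopology (mtop N) V) f"
    using smooth_cont[OF f] fV by (auto simp: continuous_map_in_subtopology)
  then have "continuous_map (subtopology (mtop M) U) (mtop P) (g \<circ> f)"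
    using smooth_cont[OF g] by (rule continuous_map_compose)
  then show cont: "continuous_map (subtopology (mtop M) U) (mtop P) (\<lambda>x. g (f x))" by (simp add: o_def)
  fix \<kappa> \<kappa>'' assume \<kappa>: "\<kappa> \<in> atlas M" and \<kappa>'': "\<kappa>'' \<in> atlas P"
  interpret a: chart_of M \<kappa> using M \<kappa> by (simp add: chart_of_def)
  interpret c: chart_of P \<kappa>'' using P \<kappa>'' by (simp add: chart_of_def)
  let ?W = "{x \<in> cdom \<kappa> \<inter> U. g (f x) \<in> cdom \<kappa>''}"
  have W: "openin (mtop M) ?W"
  proof -
    have "openin (mtop N) {y \<in> V. g y \<in> cdom \<kappa>''}" using smooth_preimage[OF g c.openin_cdom] .
    from smooth_preimage[OF f this] a.openin_cdom
    have "openin (mtop M) (cdom \<kappa> \<inter> {x \<in> U. f x \<in> {y \<in> V. g y \<in> cdom \<kappa>''}})" by blast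
    moreover have "cdom \<kappa> \<inter> {x \<in> U. f x \<in> {y \<in> V. g y \<in> cdom \<kappa>''}} = ?W" using fV by auto
    ultimately show ?thesis by simp
  qed
  show "bastiani_smooth (cmodel \<kappa>) (cmap \<kappa> ` ?W) (cmodel \<kappa>'') (cmap \<kappa>'' \<circ> (\<lambda>x. g (f x)) \<circ> cinv \<kappa>)"
  proof (rule bastiani_local[OF a.lcs c.lcs])
    show "openin (cmodel \<kappa>) (cmap \<kappa> ` ?W)" using W by (intro a.open_image) auto
    fix z assume "z \<in> cmap \<kappa> ` ?W"
    then obtain x where x: "x \<in> ?W" "z = cmap \<kappa> x" by blast
    then have "f x \<in> pts N" using smooth_maps[OF f] by simp
    then obtain \<kappa>' where \<kappa>': "\<kappa>' \<in> atlas N" "f x \<in> cdom \<kappa>'" using charted_covers[OF N] by blast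
    interpret b: chart_of N \<kappa>' using N \<kappa>' by (simp add: chart_of_def)
    let ?W' = "?W \<inter> {x \<in> U. f x \<in> cdom \<kappa>'}"
    have W': "openin (cmodel \<kappa>) (cmap \<kappa> ` ?W')"
      using W smooth_preimage[OF f b.openin_cdom] by (intro a.open_image) auto
    have "bastiani_smooth (cmodel \<kappa>) (cmap \<kappa> ` ?W') (cmodel \<kappa>') (cmap \<kappa>' \<circ> f \<circ> cinv \<kappa>)"
      by (rule bastiani_subset[OF a.lcs b.lcs smooth_bastiani[OF f \<kappa> \<kappa>'(1)] W']) auto
    then have "bastiani_smooth (cmodel \<kappa>) (cmap \<kappa> ` ?W') (cmodel \<kappa>'') ((cmap \<kappa>'' \<circ> g \<circ> cinv \<kappa>') \<circ> (cmap \<kappa>' \<circ> f \<circ> cinv \<kappa>))"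
      using smooth_bastiani[OF g \<kappa>'(1) \<kappa>''] by (rule bastiani_compose[OF a.lcs b.lcs c.lcs]) (use fV in auto)
    then have "bastiani_smooth (cmodel \<kappa>) (cmap \<kappa> ` ?W') (cmodel \<kappa>'') (cmap \<kappa>'' \<circ> (\<lambda>x. g (f x)) \<circ> cinv \<kappa>)"
      by (rule bastiani_cong[OF a.lcs]) auto
    then show "\<exists>W. z \<in> W \<and> bastiani_smooth (cmodel \<kappa>) W (cmodel \<kappa>'') (cmap \<kappa>'' \<circ> (\<lambda>x. g (f x)) \<circ> cinv \<kappa>)"
      using x \<kappa>'(2) by (intro exI[of _ "cmap \<kappa> ` ?W'"]) auto
  qed
qed

lemma smooth_cong:
  assumes M: "charted M" and f: "smooth_map_on M U N f" and fg: "\<And>x. x \<in> U \<Longrightarrow> f x = g x"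
  shows "smooth_map_on M U N g"
  unfolding smooth_map_on_def
proof (intro conjI ballI)
  show "openin (mtop M) U" using f by (rule smooth_openin)
  show "continuous_map (subtopology (mtop M) U) (mtop N) g"
    by (rule continuous_map_eq[OF smooth_cont[OF f]]) (simp add: fg)
  fix \<kappa> \<kappa>' assume \<kappa>: "\<kappa> \<in> atlas M" "\<kappa>' \<in> atlas N"
  interpret a: chart_of M \<kappa> using M \<kappa> by (simp add: chart_of_def)
  have eq: "{x \<in> cdom \<kappa> \<inter> U. g x \<in> cdom \<kappa>'} = {x \<in> cdom \<kappa> \<inter> U. f x \<in> cdom \<kappa>'}" using fg by auto
  show "bastiani_smooth (cmodel \<kappa>) (cmap \<kappa> ` {x \<in> cdom \<kappa> \<inter> U. g x \<in> cdom \<kappa>'}) (cmodel \<kappa>') (cmap \<kappa>' \<circ> g \<circ> cinv \<kappa>)"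
    unfolding eq by (rule bastiani_cong[OF a.lcs smooth_bastiani[OF f \<kappa>]]) (auto simp: fg)
qed

lemma smooth_subset:
  assumes M: "charted M" and N: "charted N" and f: "smooth_map_on M U N f" and W: "openin (mtop M) W" "W \<subseteq> U"
  shows "smooth_map_on M W N f"
  unfolding smooth_map_on_def
proof (intro conjI ballI)
  show "openin (mtop M) W" by fact
  show "continuous_map (subtopology (mtop M) W) (mtop N) f"
    using smooth_cont[OF f] W(2) by (rule continuous_map_from_subtopology_mono)
  fix \<kappa> \<kappa>' assume \<kappa>: "\<kappa> \<in> atlas M" "\<kappa>' \<in> atlas N"
  interpret a: chart_of M \<kappa> using M \<kappa> by (simp add: chart_of_def)
  interpret b: chart_of N \<kappa>' using N \<kappa> by (simp add: chart_of_def)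
  have "{x \<in> cdom \<kappa> \<inter> W. f x \<in> cdom \<kappa>'} = {x \<in> cdom \<kappa> \<inter> U. f x \<in> cdom \<kappa>'} \<inter> W" using W by auto
  then have "openin (mtop M) {x \<in> cdom \<kappa> \<inter> W. f x \<in> cdom \<kappa>'}"
    using smooth_dom_open[OF f M N \<kappa>] W(1) by auto
  then have "openin (cmodel \<kappa>) (cmap \<kappa> ` {x \<in> cdom \<kappa> \<inter> W. f x \<in> cdom \<kappa>'})" by (intro a.open_image) auto
  then show "bastiani_smooth (cmodel \<kappa>) (cmap \<kappa> ` {x \<in> cdom \<kappa> \<inter> W. f x \<in> cdom \<kappa>'}) (cmodel \<kappa>') (cmap \<kappa>' \<circ> f \<circ> cinv \<kappa>)"
    by (rule bastiani_subset[OF a.lcs b.lcs smooth_bastiani[OF f \<kappa>]]) (use W in auto)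
qed

text \<open>In charts the identity is a change of charts, so this is the compatibility condition of
  \<open>manifold\<close>.\<close>

lemma smooth_id:
  assumes M: "manifold M" and U: "openin (mtop M) U"
  shows "smooth_map_on M U M (\<lambda>x. x)"
  unfolding smooth_map_on_def
proof (intro conjI ballI U)
  show "continuous_map (subtopology (mtop M) U) (mtop M) (\<lambda>x. x)"
    by (simp add: continuous_map_from_subtopology)
  fix \<kappa> \<kappa>' assume \<kappa>: "\<kappa> \<in> atlas M" "\<kappa>' \<in> atlas M"
  interpret a: chart_of M \<kappa> using chart_ofI[OF M \<kappa>(1)] .
  interpret b: chart_of M \<kappa>' using chart_ofI[OF M \<kappa>(2)] .
  have o: "openin (cmodel \<kappa>) (cmap \<kappa> ` {x \<in> cdom \<kappa> \<inter> U. x \<in> cdom \<kappa>'})"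
  proof (rule a.open_image)
    have "{x \<in> cdom \<kappa> \<inter> U. x \<in> cdom \<kappa>'} = cdom \<kappa> \<inter> U \<inter> cdom \<kappa>'" by auto
    then show "openin (mtop M) {x \<in> cdom \<kappa> \<inter> U. x \<in> cdom \<kappa>'}" using U a.openin_cdom b.openin_cdom by auto
  qed auto
  have "bastiani_smooth (cmodel \<kappa>) (cmap \<kappa> ` (cdom \<kappa> \<inter> cdom \<kappa>')) (cmodel \<kappa>') (cmap \<kappa>' \<circ> cinv \<kappa>)"
    using M \<kappa> unfolding manifold_def by (elim conjE) simp
  then show "bastiani_smooth (cmodel \<kappa>) (cmap \<kappa> ` {x \<in> cdom \<kappa> \<inter> U. x \<in> cdom \<kappa>'}) (cmodel \<kappa>') (cmap \<kappa>' \<circ> (\<lambda>x. x) \<circ> cinv \<kappa>)"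
    unfolding comp_def[of _ "\<lambda>x. x"] eta_contract_eq
    by (rule bastiani_subset[OF a.lcs b.lcs _ o]) auto
qed

lemma smooth_Pair:
  assumes M: "charted M" and N: "charted N" and P: "charted P"
    and f: "smooth_map_on M U N f" and g: "smooth_map_on M U P g"
  shows "smooth_map_on M U (prod_mfd N P) (\<lambda>x. (f x, g x))"
  unfolding smooth_map_on_def
proof (intro conjI ballI)
  show "openin (mtop M) U" using f by (rule smooth_openin)
  show "continuous_map (subtopology (mtop M) U) (mtop (prod_mfd N P)) (\<lambda>x. (f x, g x))"
    using smooth_cont[OF f] smooth_cont[OF g] by (simp add: prod_mfd_def continuous_map_paired)
  fix \<kappa> \<kappa>' assume \<kappa>: "\<kappa> \<in> atlas M" and "\<kappa>' \<in> atlas (prod_mfd N P)"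
  then obtain a b where ab: "a \<in> atlas N" "b \<in> atlas P"
    and \<kappa>': "\<kappa>' = \<lparr>cdom = cdom a \<times> cdom b, cmodel = prod_topology (cmodel a) (cmodel b), cmap = map_prod (cmap a) (cmap b)\<rparr>"
    unfolding prod_mfd_def by auto
  interpret k: chart_of M \<kappa> using M \<kappa> by (simp add: chart_of_def)
  interpret a: chart_of N a using N ab by (simp add: chart_of_def)
  interpret b: chart_of P b using P ab by (simp add: chart_of_def)
  let ?W = "{x \<in> cdom \<kappa> \<inter> U. (f x, g x) \<in> cdom \<kappa>'}"
  have "?W = {x \<in> cdom \<kappa> \<inter> U. f x \<in> cdom a} \<inter> {x \<in> cdom \<kappa> \<inter> U. g x \<in> cdom b}" by (auto simp: \<kappa>')
  then have "openin (mtop M) ?W"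
    using openin_Int[OF smooth_dom_open[OF f M N \<kappa> ab(1)] smooth_dom_open[OF g M P \<kappa> ab(2)]] by simp
  then have W: "openin (cmodel \<kappa>) (cmap \<kappa> ` ?W)" by (intro k.open_image) auto
  have 1: "bastiani_smooth (cmodel \<kappa>) (cmap \<kappa> ` ?W) (cmodel a) (cmap a \<circ> f \<circ> cinv \<kappa>)"
    by (rule bastiani_subset[OF k.lcs a.lcs smooth_bastiani[OF f \<kappa> ab(1)] W]) (auto simp: \<kappa>')
  have 2: "bastiani_smooth (cmodel \<kappa>) (cmap \<kappa> ` ?W) (cmodel b) (cmap b \<circ> g \<circ> cinv \<kappa>)"
    by (rule bastiani_subset[OF k.lcs b.lcs smooth_bastiani[OF g \<kappa> ab(2)] W]) (auto simp: \<kappa>')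
  have "bastiani_smooth (cmodel \<kappa>) (cmap \<kappa> ` ?W) (prod_topology (cmodel a) (cmodel b))
    (\<lambda>z. ((cmap a \<circ> f \<circ> cinv \<kappa>) z, (cmap b \<circ> g \<circ> cinv \<kappa>) z))"
    using 1 2 k.lcs a.lcs b.lcs by (intro bastiani_Pair bastiani_map.intro)
  then show "bastiani_smooth (cmodel \<kappa>) (cmap \<kappa> ` ?W) (cmodel \<kappa>') (cmap \<kappa>' \<circ> (\<lambda>x. (f x, g x)) \<circ> cinv \<kappa>)"
    by (simp add: \<kappa>' o_def)
qed

lemma smooth_lcs_iff:
  assumes "charted M"
  shows "smooth_map_on M U (lcs_mfd F) h \<longleftrightarrow> openin (mtop M) U \<and> continuous_map (subtopology (mtop M) U) F h \<and>
    (\<forall>\<kappa>\<in>atlas M. bastiani_smooth (cmodel \<kappa>) (cmap \<kappa> ` (cdom \<kappa> \<inter> U)) F (h \<circ> cinv \<kappa>))"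
    (is "?L \<longleftrightarrow> ?R")
proof -
  have eq: "{x \<in> cdom \<kappa> \<inter> U. h x \<in> topspace F} = cdom \<kappa> \<inter> U"
    if "openin (mtop M) U" "continuous_map (subtopology (mtop M) U) F h" for \<kappa> :: "('a, 'b) chart"
  proof -
    have "h x \<in> topspace F" if "x \<in> U" for x
      using \<open>continuous_map _ F h\<close> openin_subset[OF \<open>openin _ U\<close>] that by (auto simp: continuous_map_def)
    then show ?thesis by auto
  qed
  show ?thesis
  proof
    assume L: ?L
    show ?R
      using L eq by (simp add: smooth_map_on_def lcs_mfd_def lcs_chart_def)
  next
    assume R: ?R
    then show ?L
      using eq by (simp add: smooth_map_on_def lcs_mfd_def lcs_chart_def)
  qed
qed

lemma smooth_chart:
  assumes M: "manifold M" and \<kappa>: "\<kappa> \<in> atlas M"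
  shows "smooth_map_on M (cdom \<kappa>) (lcs_mfd (cmodel \<kappa>)) (cmap \<kappa>)"
  unfolding smooth_lcs_iff[OF manifold_charted[OF M]]
proof (intro conjI ballI)
  interpret chart_of M \<kappa> using chart_ofI[OF M \<kappa>] .
  show "openin (mtop M) (cdom \<kappa>)" by (rule openin_cdom)
  show "continuous_map (subtopology (mtop M) (cdom \<kappa>)) (cmodel \<kappa>) (cmap \<kappa>)" by (rule cont)
  show "bastiani_smooth (cmodel \<kappa>') (cmap \<kappa>' ` (cdom \<kappa>' \<inter> cdom \<kappa>)) (cmodel \<kappa>) (cmap \<kappa> \<circ> cinv \<kappa>')"
    if "\<kappa>' \<in> atlas M" for \<kappa>'
    using M \<kappa> that unfolding manifold_def by (elim conjE) simp
qed

lemma smooth_const: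
  assumes "charted M" "lcs F" "openin (mtop M) U" "c \<in> topspace F"
  shows "smooth_map_on M U (lcs_mfd F) (\<lambda>_. c)"
  unfolding smooth_lcs_iff[OF assms(1)]
proof (intro conjI ballI assms)
  show "continuous_map (subtopology (mtop M) U) F (\<lambda>_. c)" using assms by simp
  fix \<kappa> assume "\<kappa> \<in> atlas M"
  then interpret chart_of M \<kappa> using assms by (simp add: chart_of_def)
  show "bastiani_smooth (cmodel \<kappa>) (cmap \<kappa> ` (cdom \<kappa> \<inter> U)) F ((\<lambda>_. c) \<circ> cinv \<kappa>)"
    unfolding o_def using assms openin_cdom by (intro bastiani_const lcs open_image) auto
qed

lemma smooth_linear:
  assumes E: "lcs E" and F: "lcs F" and c: "continuous_map E F L"
    and add: "\<And>x y. x \<in> topspace E \<Longrightarrow> y \<in> topspace E \<Longrightarrow> L (x + y) = L x + L y"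
    and scale: "\<And>r x. x \<in> topspace E \<Longrightarrow> L (r *\<^sub>R x) = r *\<^sub>R L x"
  shows "smooth_map_on (lcs_mfd E) (topspace E) (lcs_mfd F) L"
  unfolding smooth_lcs_iff[OF charted_lcs[OF E]]
proof (intro conjI ballI)
  fix \<kappa> assume "\<kappa> \<in> atlas (lcs_mfd E)"
  then have \<kappa>: "\<kappa> = lcs_chart E" by (simp add: lcs_mfd_def)
  have "bastiani_smooth E (topspace E) F L" using assms by (intro bastiani_linear) auto
  then have "bastiani_smooth E (topspace E) F (L \<circ> inv_into (topspace E) id)"
    by (rule bastiani_cong[OF E]) (metis comp_apply id_apply inj_on_id inv_into_f_f)
  then show "bastiani_smooth (cmodel \<kappa>) (cmap \<kappa> ` (cdom \<kappa> \<inter> topspace E)) F (L \<circ> cinv \<kappa>)"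
    by (simp add: \<kappa> lcs_chart_def)
qed (use c in \<open>simp_all add: lcs_mfd_def\<close>)

lemma smooth_power:
  assumes M: "charted M" and F: "lcs F" and U: "openin (mtop M) U"
    and f: "\<And>i. i < k \<Longrightarrow> smooth_map_on M U (lcs_mfd F) (\<lambda>x. f x i)" and z: "\<And>x i. i \<ge> k \<Longrightarrow> f x i = 0"
  shows "smooth_map_on M U (lcs_mfd (power_lcs F k)) f"
  unfolding smooth_lcs_iff[OF M]
proof (intro conjI ballI U)
  show "continuous_map (subtopology (mtop M) U) (power_lcs F k) f"
    using f z unfolding smooth_lcs_iff[OF M] by (intro continuous_map_into_power) auto
  fix \<kappa> assume \<kappa>: "\<kappa> \<in> atlas M"
  then interpret chart_of M \<kappa> using M by (simp add: chart_of_def)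
  show "bastiani_smooth (cmodel \<kappa>) (cmap \<kappa> ` (cdom \<kappa> \<inter> U)) (power_lcs F k) (f \<circ> cinv \<kappa>)"
  proof (rule bastiani_power[OF lcs F])
    show "openin (cmodel \<kappa>) (cmap \<kappa> ` (cdom \<kappa> \<inter> U))" using U openin_cdom by (intro open_image) auto
    show "bastiani_smooth (cmodel \<kappa>) (cmap \<kappa> ` (cdom \<kappa> \<inter> U)) F (\<lambda>x. (f \<circ> cinv \<kappa>) x i)" if "i < k" for i
      using f[OF that] \<kappa> unfolding smooth_lcs_iff[OF M] by (simp add: o_def)
  qed (use z in auto)
qed

text \<open>Made for projections. Every chart of \<open>M\<close> is matched with one single chart
  of \<open>P\<close> in which \<open>\<pi>\<close> becomes a map \<open>L\<close> of the model
  spaces, so no chart change of \<open>P\<close> occurs; \<open>charted\<close> does not say that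
  these are smooth.\<close>

lemma smooth_chartwise_compose:
  assumes M: "charted M" and P: "charted P" and Q: "charted Q" and f: "smooth_map_on P V Q f"
    and U: "openin (mtop M) U" and \<pi>: "continuous_map (mtop M) (mtop P) \<pi>" "\<And>x. x \<in> U \<Longrightarrow> \<pi> x \<in> V"
    and charts: "\<And>a. a \<in> atlas M \<Longrightarrow> \<exists>b\<in>atlas P. \<exists>L. bastiani_smooth (cmodel a) (topspace (cmodel a)) (cmodel b) L \<and>
      (\<forall>x\<in>cdom a. \<pi> x \<in> cdom b \<and> cmap b (\<pi> x) = L (cmap a x))"
  shows "smooth_map_on M U Q (\<lambda>x. f (\<pi> x))"
  unfolding smooth_map_on_def
proof (intro conjI ballI U)
  have "continuous_map (subtopology (mtop M) U) (subtopology (mtop P) V) \<pi>"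
    using \<pi> by (auto simp: continuous_map_in_subtopology continuous_map_from_subtopology)
  from continuous_map_compose[OF this smooth_cont[OF f]]
  show "continuous_map (subtopology (mtop M) U) (mtop Q) (\<lambda>x. f (\<pi> x))" by (simp add: o_def)
  fix a c assume a: "a \<in> atlas M" and c: "c \<in> atlas Q"
  obtain b L where b: "b \<in> atlas P" and L: "bastiani_smooth (cmodel a) (topspace (cmodel a)) (cmodel b) L"
    "\<And>x. x \<in> cdom a \<Longrightarrow> \<pi> x \<in> cdom b" "\<And>x. x \<in> cdom a \<Longrightarrow> cmap b (\<pi> x) = L (cmap a x)"
    using charts[OF a] by blast
  interpret a: chart_of M a using M a by (rule chart_of.intro)
  interpret b: chart_of P b using P b by (rule chart_of.intro)
  interpret c: chart_of Q c using Q c by (rule chart_of.intro)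
  let ?W = "{x \<in> cdom a \<inter> U. f (\<pi> x) \<in> cdom c}"
  have "openin (mtop M) (cdom a \<inter> U \<inter> {x \<in> pts M. \<pi> x \<in> {y \<in> V. f y \<in> cdom c}})"
    by (intro openin_Int a.openin_cdom U openin_continuous_map_preimage[OF \<pi>(1)] smooth_preimage[OF f c.openin_cdom])
  moreover have "cdom a \<inter> U \<inter> {x \<in> pts M. \<pi> x \<in> {y \<in> V. f y \<in> cdom c}} = ?W"
    using \<pi>(2) openin_subset[OF U] by auto
  ultimately have W: "openin (cmodel a) (cmap a ` ?W)" by (intro a.open_image) auto
  have "bastiani_smooth (cmodel a) (cmap a ` ?W) (cmodel b) L"
    by (rule bastiani_subset[OF a.lcs b.lcs L(1) W]) (auto simp: a.cmap_topspace)
  then have "bastiani_smooth (cmodel a) (cmap a ` ?W) (cmodel c) ((cmap c \<circ> f \<circ> cinv b) \<circ> L)"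
    using smooth_bastiani[OF f b c] by (rule bastiani_compose[OF a.lcs b.lcs c.lcs]) (use L \<pi>(2) in \<open>force simp flip: L(3)\<close>)
  then show "bastiani_smooth (cmodel a) (cmap a ` ?W) (cmodel c) (cmap c \<circ> (\<lambda>x. f (\<pi> x)) \<circ> cinv a)"
    by (rule bastiani_cong[OF a.lcs]) (auto simp: L(2) simp flip: L(3))
qed

lemma smooth_fst:
  assumes N: "manifold N" and P: "charted P" and U: "openin (mtop N) U" and V: "openin (mtop P) V"
  shows "smooth_map_on (prod_mfd N P) (U \<times> V) N fst"
proof -
  note cN = manifold_charted[OF N]
  have "smooth_map_on (prod_mfd N P) (U \<times> V) N (\<lambda>z. (\<lambda>x. x) (fst z))"
  proof (rule smooth_chartwise_compose[OF charted_prod[OF cN P] cN cN smooth_id[OF N U]])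
    fix \<kappa> assume "\<kappa> \<in> atlas (prod_mfd N P)"
    then obtain a b where ab: "a \<in> atlas N" "b \<in> atlas P"
      and \<kappa>: "\<kappa> = \<lparr>cdom = cdom a \<times> cdom b, cmodel = prod_topology (cmodel a) (cmodel b), cmap = map_prod (cmap a) (cmap b)\<rparr>"
      by (rule prod_chartE)
    have "lcs (cmodel a)" "lcs (cmodel b)" using cN P ab by (auto simp: charted_def)
    then have "bastiani_smooth (cmodel \<kappa>) (topspace (cmodel \<kappa>)) (cmodel a) fst"
      unfolding \<kappa> chart.select_convs by (intro bastiani_linear lcs_prod continuous_map_fst) (auto simp: openin_prod_Times_iff)
    then show "\<exists>a\<in>atlas N. \<exists>L. bastiani_smooth (cmodel \<kappa>) (topspace (cmodel \<kappa>)) (cmodel a) L \<and>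
      (\<forall>x\<in>cdom \<kappa>. fst x \<in> cdom a \<and> cmap a (fst x) = L (cmap \<kappa> x))"
      using ab(1) by (intro bexI[of _ a] exI[of _ fst]) (auto simp: \<kappa>)
  qed (use U V in \<open>auto simp: prod_mfd_def openin_prod_Times_iff continuous_map_fst\<close>)
  then show ?thesis by simp
qed

lemma smooth_snd:
  assumes N: "charted N" and P: "charted P" and U: "openin (mtop N) U" and f: "smooth_map_on P V (lcs_mfd F) f" and F: "lcs F"
  shows "smooth_map_on (prod_mfd N P) (U \<times> V) (lcs_mfd F) (\<lambda>z. f (snd z))"
proof (rule smooth_chartwise_compose[OF charted_prod[OF N P] P charted_lcs[OF F] f])
  fix \<kappa> assume "\<kappa> \<in> atlas (prod_mfd N P)"
  then obtain a b where ab: "a \<in> atlas N" "b \<in> atlas P"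
    and \<kappa>: "\<kappa> = \<lparr>cdom = cdom a \<times> cdom b, cmodel = prod_topology (cmodel a) (cmodel b), cmap = map_prod (cmap a) (cmap b)\<rparr>"
    by (rule prod_chartE)
  have "lcs (cmodel a)" "lcs (cmodel b)" using N P ab by (auto simp: charted_def)
  then have "bastiani_smooth (cmodel \<kappa>) (topspace (cmodel \<kappa>)) (cmodel b) snd"
    unfolding \<kappa> chart.select_convs by (intro bastiani_linear lcs_prod continuous_map_snd) (auto simp: openin_prod_Times_iff)
  then show "\<exists>b\<in>atlas P. \<exists>L. bastiani_smooth (cmodel \<kappa>) (topspace (cmodel \<kappa>)) (cmodel b) L \<and>
    (\<forall>x\<in>cdom \<kappa>. snd x \<in> cdom b \<and> cmap b (snd x) = L (cmap \<kappa> x))"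
    using ab(2) by (intro bexI[of _ b] exI[of _ snd]) (auto simp: \<kappa>)
qed (use U smooth_openin[OF f] in \<open>auto simp: prod_mfd_def openin_prod_Times_iff continuous_map_snd\<close>)

section \<open>Derivatives along tangent vectors\<close>

text \<open>The same choice as in \<open>tangent_map\<close>, so that derivatives along a tangent
  vector unfold to this chart.\<close>

definition chart_at :: "('m, 'e) mfd \<Rightarrow> 'm \<Rightarrow> ('m, 'e) chart"
  where "chart_at M x = (SOME \<kappa>. \<kappa> \<in> charts_at M x)"

text \<open>A curve with velocity \<open>X\<close>: a straight line in the chosen chart. Only small
  \<open>t\<close> carry meaning; once the line has left the image of the chart the value is
  arbitrary.\<close>

definition curve :: "('m, 'e::real_vector) mfd \<Rightarrow> ('m, 'e) tvec \<Rightarrow> real \<Rightarrow> 'm"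
  where "curve M X t = cinv (chart_at M (fst X)) (cmap (chart_at M (fst X)) (fst X) + t *\<^sub>R snd X (chart_at M (fst X)))"

lemma chart_at: "charted M \<Longrightarrow> x \<in> pts M \<Longrightarrow> chart_at M x \<in> charts_at M x"
proof -
  assume "charted M" "x \<in> pts M"
  then obtain \<kappa> where "\<kappa> \<in> charts_at M x" using charted_covers[of M x] by (auto simp: charts_at_def)
  then show ?thesis unfolding chart_at_def by (rule someI)
qed

lemma tangent_vectors_iff:
  "X \<in> tangent_vectors M \<longleftrightarrow> fst X \<in> pts M \<and>
     (\<forall>\<kappa>. \<kappa> \<notin> charts_at M (fst X) \<longrightarrow> snd X \<kappa> = 0) \<and>
     (\<forall>\<kappa>\<in>charts_at M (fst X). snd X \<kappa> \<in> topspace (cmodel \<kappa>)) \<and>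
     (\<forall>\<kappa>\<in>charts_at M (fst X). \<forall>\<kappa>'\<in>charts_at M (fst X).
        snd X \<kappa>' = dirderiv (cmodel \<kappa>') (cmap \<kappa>' \<circ> cinv \<kappa>) (cmap \<kappa> (fst X)) (snd X \<kappa>))"
  by (simp only: tangent_vectors_def mem_Collect_eq case_prod_unfold)

lemmas tangent_vector_base = tangent_vectors_iff[THEN iffD1, THEN conjunct1]
  and tangent_vector_off = tangent_vectors_iff[THEN iffD1, THEN conjunct2, THEN conjunct1, rule_format]
  and tangent_vector_topspace = tangent_vectors_iff[THEN iffD1, THEN conjunct2, THEN conjunct2, THEN conjunct1, rule_format]
  and tangent_vector_change = tangent_vectors_iff[THEN iffD1, THEN conjunct2, THEN conjunct2, THEN conjunct2, rule_format]

text \<open>The space of a generated topology is the union of its generators; taking the whole model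
  for \<open>W\<close> shows that every tangent vector is covered.\<close>

lemma topspace_tangent_mfd:
  assumes "manifold M"
  shows "pts (tangent_mfd M) = tangent_vectors M"
proof
  show "pts (tangent_mfd M) \<subseteq> tangent_vectors M"
    by (auto simp: tangent_mfd_def topology_generated_by_topspace)
  show "tangent_vectors M \<subseteq> pts (tangent_mfd M)"
  proof
    fix X assume X: "X \<in> tangent_vectors M"
    obtain x v where xv: "X = (x, v)" by force
    then have "x \<in> pts M" using tangent_vector_base[OF X] by simp
    from chart_at[OF manifold_charted[OF assms] this] have c: "chart_at M x \<in> charts_at M x" .
    let ?\<kappa> = "chart_at M x"
    have \<kappa>: "?\<kappa> \<in> atlas M" "x \<in> cdom ?\<kappa>" using c by (auto simp: charts_at_def)
    interpret chart_of M ?\<kappa> using chart_ofI[OF assms \<kappa>(1)] .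
    let ?W = "topspace (prod_topology (cmodel ?\<kappa>) (cmodel ?\<kappa>))"
    let ?S = "{(x, v) \<in> tangent_vectors M. x \<in> cdom ?\<kappa> \<and> (cmap ?\<kappa> x, v ?\<kappa>) \<in> ?W}"
    have "v ?\<kappa> \<in> topspace (cmodel ?\<kappa>)" using tangent_vector_topspace[OF X] c by (simp add: xv)
    then have "X \<in> ?S" using X \<kappa>(2) cmap_topspace[OF \<kappa>(2)] by (simp add: xv)
    moreover have "?S \<in> {{(x, v) \<in> tangent_vectors M. x \<in> cdom \<kappa> \<and> (cmap \<kappa> x, v \<kappa>) \<in> W} |\<kappa> W.
          \<kappa> \<in> atlas M \<and> openin (prod_topology (cmodel \<kappa>) (cmodel \<kappa>)) W}"
      using \<kappa>(1) openin_topspace by blast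
    ultimately show "X \<in> pts (tangent_mfd M)"
      unfolding tangent_mfd_def mfd.select_convs topology_generated_by_topspace by blast
  qed
qed

locale tangent_at =
  fixes M :: "('m, 'e::real_vector) mfd" and X :: "('m, 'e) tvec"
  assumes mfd: "manifold M" and tvec: "X \<in> tangent_vectors M"
begin

abbreviation "x \<equiv> fst X"
abbreviation "\<kappa> \<equiv> chart_at M x"
abbreviation "v \<equiv> snd X \<kappa>"

lemma x: "x \<in> pts M"
  using tangent_vector_base[OF tvec] .

lemma chart: "\<kappa> \<in> charts_at M x"
  using chart_at[OF manifold_charted[OF mfd] x] .

lemma x_cdom: "x \<in> cdom \<kappa>"
  using chart by (simp add: charts_at_def)

sublocale chart_of M \<kappa>
  using chart_ofI[OF mfd] chart by (simp add: charts_at_def)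

lemma v: "v \<in> topspace (cmodel \<kappa>)"
  using tangent_vector_topspace[OF tvec chart] .

lemma curve_eventually: "openin (mtop M) W \<Longrightarrow> x \<in> W \<Longrightarrow> \<forall>\<^sub>F t in at 0. curve M X t \<in> W"
  using line[OF _ _ x_cdom v, of W] unfolding curve_def by (auto elim: eventually_mono)

lemma curve_limit: "limitin (mtop M) (curve M X) x (at 0)"
  unfolding limitin_def using curve_eventually x by auto

lemma lie_deriv_eq:
  assumes "Y x = X" "h x \<in> topspace F"
  shows "lie_deriv M F Y h x = dirderiv F (h \<circ> cinv \<kappa>) (cmap \<kappa> x) v"
proof -
  \<comment> \<open>At a point outside the global chart of \<open>F\<close> the tangent map has the
    default component 0; hence the assumption on \<open>h x\<close>.\<close>
  have "lcs_chart F \<in> charts_at (lcs_mfd F) (h x)" using assms by (simp add: charts_at_def lcs_mfd_def lcs_chart_def)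
  then show ?thesis
    using assms(1) by (simp add: lie_deriv_def tangent_map_def case_prod_unfold chart_at_def lcs_chart_def o_assoc Let_def)
qed

text \<open>Chart-free form of the difference quotient: later arguments differentiate along
  \<open>curve M X\<close> and do not return to the chart.\<close>

lemma diff_quot_curve:
  "diff_quot (h \<circ> cinv \<kappa>) (cmap \<kappa> x) v = (\<lambda>t. (1 / t) *\<^sub>R (h (curve M X t) - h x))"
  using x_cdom by (simp add: diff_quot_def curve_def)

lemma lie_derivI:
  assumes "lcs F" "Y x = X" "h x \<in> topspace F" "limitin F (\<lambda>t. (1 / t) *\<^sub>R (h (curve M X t) - h x)) l (at 0)"
  shows "lie_deriv M F Y h x = l"
  unfolding lie_deriv_eq[of Y h F, OF assms(2,3)] using assms by (intro dirderivI) (simp_all add: diff_quot_curve)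

lemma lie_deriv_limit:
  assumes h: "smooth_map_on M U (lcs_mfd F) h" and F: "lcs F" and xU: "x \<in> U" and Y: "Y x = X"
  shows "limitin F (\<lambda>t. (1 / t) *\<^sub>R (h (curve M X t) - h x)) (lie_deriv M F Y h x) (at 0)"
proof -
  have "bastiani_smooth (cmodel \<kappa>) (cmap \<kappa> ` (cdom \<kappa> \<inter> U)) F (h \<circ> cinv \<kappa>)"
    using h chart unfolding smooth_lcs_iff[OF manifold_charted[OF mfd]] by (auto simp: charts_at_def)
  then interpret b: bastiani_map "cmodel \<kappa>" "cmap \<kappa> ` (cdom \<kappa> \<inter> U)" F "h \<circ> cinv \<kappa>"
    using lcs F by (intro bastiani_map.intro)
  have "limitin F (diff_quot (h \<circ> cinv \<kappa>) (cmap \<kappa> x) v) (dirderiv F (h \<circ> cinv \<kappa>) (cmap \<kappa> x) v) (at 0)"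
    using b.limit'[of "cmap \<kappa> x" 0 "\<lambda>_. v" v] xU x_cdom v by (simp add: iter_dirderiv_0)
  moreover have "h x \<in> topspace F" using smooth_maps[OF h xU] by (simp add: lcs_mfd_def)
  ultimately show ?thesis using lie_deriv_eq[of Y h F] Y by (simp add: diff_quot_curve)
qed

lemma lie_deriv_cong:
  assumes "openin (mtop M) W" "x \<in> W" "\<And>y. y \<in> W \<Longrightarrow> h y = g y" "Y x = X" "Z x = X" "h x \<in> topspace F"
  shows "lie_deriv M F Y h x = lie_deriv M F Z g x"
proof -
  have "\<forall>\<^sub>F t in at 0. (h \<circ> cinv \<kappa>) (cmap \<kappa> x + t *\<^sub>R v) = (g \<circ> cinv \<kappa>) (cmap \<kappa> x + t *\<^sub>R v)"
    using line[OF assms(1,2) x_cdom v] by eventually_elim (simp add: assms(3))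
  then have "dirderiv F (h \<circ> cinv \<kappa>) (cmap \<kappa> x) v = dirderiv F (g \<circ> cinv \<kappa>) (cmap \<kappa> x) v"
    by (rule dirderiv_cong) (simp add: assms x_cdom)
  moreover have "g x \<in> topspace F" using assms by metis
  ultimately show ?thesis using lie_deriv_eq[of Y h F] lie_deriv_eq[of Z g F] assms(4-6) by simp
qed

text \<open>The chain rule in the charts chosen at \<open>x\<close> and \<open>f x\<close>. The
  component of the tangent map of \<open>f\<close> in the chart at \<open>f x\<close> is the
  derivative of the local expression of \<open>f\<close>, and this is the component along which
  \<open>lie_deriv\<close> on \<open>N\<close> differentiates.\<close>

lemma lie_deriv_compose:
  assumes N: "manifold N" and f: "smooth_map_on M U N f" and h: "smooth_map_on N V (lcs_mfd F) h" and F: "lcs F"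
    and xU: "x \<in> U" and fV: "f x \<in> V" and Y: "Y x = X" and Z: "Z (f x) = tangent_map M N f X"
  shows "lie_deriv M F Y (\<lambda>y. h (f y)) x = lie_deriv N F Z h (f x)"
proof -
  have cN: "charted N" using manifold_charted[OF N] .
  let ?\<kappa>' = "chart_at N (f x)"
  have \<kappa>': "?\<kappa>' \<in> charts_at N (f x)" using chart_at[OF cN] smooth_maps[OF f xU] .
  then interpret b: chart_of N ?\<kappa>' using cN by (simp add: chart_of_def charts_at_def)
  have at: "\<kappa> \<in> atlas M" "?\<kappa>' \<in> atlas N" "f x \<in> cdom ?\<kappa>'" using chart \<kappa>' by (auto simp: charts_at_def)
  have hf: "h (f x) \<in> topspace F" using smooth_maps[OF h fV] by (simp add: lcs_mfd_def)
  have lch: "lcs_chart F \<in> charts_at (lcs_mfd F) (h (f x))" using hf by (simp add: charts_at_def lcs_mfd_def lcs_chart_def)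
  let ?f = "cmap ?\<kappa>' \<circ> f \<circ> cinv \<kappa>" and ?h = "h \<circ> cinv ?\<kappa>'"
  have 1: "bastiani_smooth (cmodel \<kappa>) (cmap \<kappa> ` {x \<in> cdom \<kappa> \<inter> U. f x \<in> cdom ?\<kappa>'}) (cmodel ?\<kappa>') ?f"
    using smooth_bastiani[OF f at(1,2)] .
  have 2: "bastiani_smooth (cmodel ?\<kappa>') (cmap ?\<kappa>' ` (cdom ?\<kappa>' \<inter> V)) F ?h"
    using h at unfolding smooth_lcs_iff[OF cN] by blast
  have "dirderiv F (?h \<circ> ?f) (cmap \<kappa> x) v = dirderiv F ?h (?f (cmap \<kappa> x)) (dirderiv (cmodel ?\<kappa>') ?f (cmap \<kappa> x) v)"
    by (rule bastiani_chain[OF lcs b.lcs F 1 2]) (use xU fV at x_cdom v in auto)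
  moreover have "dirderiv F ((\<lambda>y. h (f y)) \<circ> cinv \<kappa>) (cmap \<kappa> x) v = dirderiv F (?h \<circ> ?f) (cmap \<kappa> x) v"
  proof (rule dirderiv_cong)
    have o: "openin (mtop M) {x \<in> U. f x \<in> cdom ?\<kappa>'}" using smooth_preimage[OF f b.openin_cdom] .
    have "\<forall>\<^sub>F t in at 0. cinv \<kappa> (cmap \<kappa> x + t *\<^sub>R v) \<in> {x \<in> U. f x \<in> cdom ?\<kappa>'}"
      using line[OF o _ x_cdom v] xU at by (auto elim: eventually_mono)
    then show "\<forall>\<^sub>F t in at 0. ((\<lambda>y. h (f y)) \<circ> cinv \<kappa>) (cmap \<kappa> x + t *\<^sub>R v) = (?h \<circ> ?f) (cmap \<kappa> x + t *\<^sub>R v)"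
      by eventually_elim simp
  qed (simp add: at x_cdom)
  moreover have "lie_deriv M F Y (\<lambda>y. h (f y)) x = dirderiv F ((\<lambda>y. h (f y)) \<circ> cinv \<kappa>) (cmap \<kappa> x) v"
    by (rule lie_deriv_eq) (simp_all add: Y hf)
  moreover have "lie_deriv N F Z h (f x) = dirderiv F ?h (cmap ?\<kappa>' (f x)) (dirderiv (cmodel ?\<kappa>') ?f (cmap \<kappa> x) v)"
    using Z lch \<kappa>' by (simp add: lie_deriv_def tangent_map_def case_prod_unfold lcs_chart_def o_assoc Let_def flip: chart_at_def)
  ultimately show ?thesis by (simp add: x_cdom)
qed

end

section \<open>Separation by continuous functionals\<close>

definition cont_functional :: "'e::real_vector topology \<Rightarrow> ('e \<Rightarrow> real) \<Rightarrow> bool"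
  where "cont_functional E l \<longleftrightarrow> continuous_map E euclideanreal l \<and>
    (\<forall>x\<in>topspace E. \<forall>y\<in>topspace E. l (x + y) = l x + l y) \<and> (\<forall>x\<in>topspace E. \<forall>r. l (r *\<^sub>R x) = r * l x)"

text \<open>Hahn--Banach by Zorn's lemma on graphs of partial functionals: linear subspaces \<open>G\<close> of
  $E \times \mathbb R$ with $r \le 1$ whenever $(x, r) \in G$ and $x \in C$.  Such a subspace is a
  graph since $0 \in C$.\<close>

lemma separating_functional:
  assumes E: "lcs E" and v: "v \<in> topspace E" "v \<noteq> 0"
  obtains l where "cont_functional E l" "l v \<noteq> 0"
proof -
  obtain W0 V0 where "openin E W0" "openin E V0" "0 \<in> W0" "v \<in> V0" "disjnt W0 V0"
    using lcs_Hausdorff[OF E] v lcs_topspace(1)[OF E] unfolding Hausdorff_space_def by metis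
  moreover from this obtain C where C: "openin E C" "convex C" "0 \<in> C" "C \<subseteq> W0"
    using lcs_convex_nhd[OF E] by metis
  ultimately have vC: "v \<notin> C" by (auto simp: disjnt_iff)
  \<comment> \<open>Every vector is absorbed by \<open>C\<close>, since \<open>t x\<close> tends to
    0 for \<open>t\<close> tending to 0 from the right.\<close>
  have absorb: "\<exists>t>0. t *\<^sub>R x \<in> C" if "x \<in> topspace E" for x
  proof -
    have "limitin E (\<lambda>t. t *\<^sub>R x) (0 *\<^sub>R x) (at_right (0::real))"
      using that E by (intro limitin_scaleR) auto
    from limitinD[OF this C(1)] C(3) have "\<forall>\<^sub>F t in at_right (0::real). t *\<^sub>R x \<in> C" by simp
    moreover have "\<forall>\<^sub>F t in at_right (0::real). t > 0" by (simp add: eventually_at_filter)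
    ultimately have "\<forall>\<^sub>F t in at_right (0::real). t > 0 \<and> t *\<^sub>R x \<in> C" by eventually_elim simp
    from eventually_happens'[OF trivial_limit_at_right_real this] show ?thesis .
  qed
  define \<G> where "\<G> = {G :: ('a \<times> real) set. subspace G \<and> (v, 1) \<in> G \<and>
    (\<forall>(x, r)\<in>G. x \<in> topspace E \<and> (x \<in> C \<longrightarrow> r \<le> 1))}"
  have "span {(v, 1)} \<in> \<G>"
  proof -
    have "x \<in> topspace E \<and> (x \<in> C \<longrightarrow> r \<le> 1)" if xr: "(x, r) \<in> span {(v, 1::real)}" for x r
    proof -
      have x: "x = r *\<^sub>R v" using xr by (auto simp: span_singleton)
      have False if "x \<in> C" "r > 1"
      proof -
        \<comment> \<open>Otherwise \<open>v\<close>, which is \<open>x / r\<close>, would be a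
          convex combination of 0 and \<open>x\<close> and lie in \<open>C\<close>.\<close>
        have "(1 - 1 / r) *\<^sub>R 0 + (1 / r) *\<^sub>R x \<in> C" using that C by (intro convexD) auto
        then show False using vC that x by simp
      qed
      then show ?thesis using v(1) x lcs_topspace(4)[OF E] by force
    qed
    then show ?thesis by (auto simp: \<G>_def span_base)
  qed
  then have ne: "\<G> \<noteq> {}" by blast
  have "\<Union>\<C> \<in> \<G>" if ch: "\<C> \<noteq> {}" "subset.chain \<G> \<C>" for \<C>
  proof -
    have sub: "\<C> \<subseteq> \<G>" and cmp: "\<And>X Y. X \<in> \<C> \<Longrightarrow> Y \<in> \<C> \<Longrightarrow> X \<subseteq> Y \<or> Y \<subseteq> X"
      using ch(2) by (auto simp: subset_chain_def)
    have "subspace (\<Union>\<C>)"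
    proof (rule subspaceI)
      show "0 \<in> \<Union>\<C>" using ch(1) sub subspace_0 unfolding \<G>_def by blast
      show "c *\<^sub>R x \<in> \<Union>\<C>" if "x \<in> \<Union>\<C>" for c x using that sub subspace_scale unfolding \<G>_def by blast
      fix x y assume "x \<in> \<Union>\<C>" "y \<in> \<Union>\<C>"
      then obtain X where "X \<in> \<C>" "x \<in> X" "y \<in> X" using cmp by blast
      moreover from this have "subspace X" using sub by (auto simp: \<G>_def)
      ultimately show "x + y \<in> \<Union>\<C>" using subspace_add by blast
    qed
    then show ?thesis using ch(1) sub unfolding \<G>_def by blast
  qed
  with subset_Zorn_nonempty[OF ne] obtain G where G: "G \<in> \<G>" and max: "\<And>X. X \<in> \<G> \<Longrightarrow> G \<subseteq> X \<Longrightarrow> X = G"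
    by metis
  have sG: "subspace G" and vG: "(v, 1) \<in> G" and Gtop: "\<And>x r. (x, r) \<in> G \<Longrightarrow> x \<in> topspace E"
    and G1: "\<And>x r. (x, r) \<in> G \<Longrightarrow> x \<in> C \<Longrightarrow> r \<le> 1"
    using G by (auto simp: \<G>_def)
  have Gadd: "(x + y, r + s) \<in> G" if "(x, r) \<in> G" "(y, s) \<in> G" for x y r s
    using subspace_add[OF sG that] by simp
  have Gscale: "(c *\<^sub>R x, c * r) \<in> G" if "(x, r) \<in> G" for c x r
    using subspace_scale[OF sG that, of c] by simp
  have G0: "(0, 0) \<in> G" using subspace_0[OF sG] by (simp add: zero_prod_def)
  have dom: "\<exists>r. (x, r) \<in> G" if x: "x \<in> topspace E" for x
  proof (rule ccontr)
    assume no: "\<nexists>r. (x, r) \<in> G"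
    \<comment> \<open>A value \<open>c\<close> at \<open>x\<close> is admissible if
      \<open>s - t c \<le> 1\<close> whenever \<open>y - t x \<in> C\<close> and
      \<open>s + t c \<le> 1\<close> whenever \<open>y + t x \<in> C\<close>. The first kind of
      constraint bounds \<open>c\<close> from below by the elements of \<open>S\<close>, the second
      from above by \<open>(1 - s) / t\<close>.\<close>
    define S where "S = {(s - 1) / t |y s t. (y, s) \<in> G \<and> t > 0 \<and> y - t *\<^sub>R x \<in> C}"
    have le: "q \<le> (1 - s) / t" if q: "q \<in> S" and h: "(y, s) \<in> G" "t > 0" "y + t *\<^sub>R x \<in> C" for q y s t
    proof -
      obtain y' s' t' where h': "(y', s') \<in> G" "t' > 0" "y' - t' *\<^sub>R x \<in> C" "q = (s' - 1) / t'"
        using q by (auto simp: S_def)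
      \<comment> \<open>The weights are chosen so that \<open>x\<close> cancels; what remains lies
        in the domain already treated, where the bound 1 is known.\<close>
      have "(t' / (t + t')) *\<^sub>R (y + t *\<^sub>R x) + (t / (t + t')) *\<^sub>R (y' - t' *\<^sub>R x) \<in> C"
      proof (rule convexD[OF C(2) h(3) h'(3)])
        show "t' / (t + t') + t / (t + t') = 1" using h(2) h'(2) by (simp flip: add_divide_distrib)
      qed (use h(2) h'(2) in auto)
      moreover have "(t' / (t + t')) *\<^sub>R (y + t *\<^sub>R x) + (t / (t + t')) *\<^sub>R (y' - t' *\<^sub>R x)
        = (t' / (t + t')) *\<^sub>R y + (t / (t + t')) *\<^sub>R y'"
        by (simp add: algebra_simps)
      ultimately have "(t' / (t + t')) * s + (t / (t + t')) * s' \<le> 1"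
        using G1[OF Gadd[OF Gscale[OF h(1)] Gscale[OF h'(1)]]] by metis
      then have "(t' * s + t * s') / (t + t') \<le> 1" by (simp add: add_divide_distrib)
      then have "t' * s + t * s' \<le> t + t'" using h h' by (simp add: divide_le_eq)
      then have "(s' - 1) * t \<le> (1 - s) * t'" by (simp add: algebra_simps)
      then show ?thesis using h(2) h'(2) by (simp add: h'(4) pos_divide_le_eq pos_le_divide_eq)
    qed
    \<comment> \<open>Absorption of \<open>x\<close> and \<open>- x\<close>, together with
      \<open>(0, 0) \<in> G\<close>, supplies one upper bound for \<open>S\<close> and one element
      of \<open>S\<close>, so that its supremum can serve as value at \<open>x\<close>.\<close>
    obtain t1 where t1: "t1 > 0" "t1 *\<^sub>R x \<in> C" using absorb[OF x] by blast
    have bdd: "bdd_above S" using le[OF _ G0 t1(1)] t1(2) by (intro bdd_aboveI) auto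
    obtain t2 where t2: "t2 > 0" "t2 *\<^sub>R (- x) \<in> C"
      using absorb[of "- x"] lcs_topspace(4)[OF E x, of "-1"] by auto
    have "(0 - 1) / t2 \<in> S" unfolding S_def
      using t2 G0 by (intro CollectI exI[of _ 0] exI[of _ t2]) simp
    then have neS: "S \<noteq> {}" by blast
    define c where "c = Sup S"
    define G' where "G' = {(y + t *\<^sub>R x, s + t * c) |y s t. (y, s) \<in> G}"
    have "G' \<in> \<G>"
      unfolding \<G>_def
    proof (intro CollectI conjI)
      show "subspace G'"
      proof (rule subspaceI)
        show "0 \<in> G'" using G0 unfolding G'_def zero_prod_def by (intro CollectI exI[of _ 0]) auto
        fix p q assume "p \<in> G'" "q \<in> G'"
        then obtain y s t y' s' t' where "p = (y + t *\<^sub>R x, s + t * c)" "(y, s) \<in> G"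
          "q = (y' + t' *\<^sub>R x, s' + t' * c)" "(y', s') \<in> G" unfolding G'_def by blast
        then show "p + q \<in> G'" unfolding G'_def
          by (intro CollectI exI[of _ "y + y'"] exI[of _ "s + s'"] exI[of _ "t + t'"]) (auto simp: Gadd algebra_simps)
      next
        fix r p assume "p \<in> G'"
        then obtain y s t where "p = (y + t *\<^sub>R x, s + t * c)" "(y, s) \<in> G" unfolding G'_def by blast
        then show "r *\<^sub>R p \<in> G'" unfolding G'_def
          by (intro CollectI exI[of _ "r *\<^sub>R y"] exI[of _ "r * s"] exI[of _ "r * t"]) (auto simp: Gscale algebra_simps)
      qed
      show "(v, 1) \<in> G'" using vG unfolding G'_def by (intro CollectI exI[of _ v] exI[of _ 1] exI[of _ 0]) auto
      have "s + t * c \<le> 1" if h: "(y, s) \<in> G" "y + t *\<^sub>R x \<in> C" for y s t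
      proof -
        consider "t = 0" | "t > 0" | "t < 0" by linarith
        then show ?thesis
        proof cases
          case 1
          then show ?thesis using G1 h by simp
        next
          case 2
          have "c \<le> (1 - s) / t" unfolding c_def using le[OF _ h(1) 2 h(2)] neS by (intro cSup_least)
          then show ?thesis using 2 by (simp add: field_simps)
        next
          case 3
          have "(s - 1) / (- t) \<in> S" unfolding S_def using h 3 by (intro CollectI exI[of _ y] exI[of _ s] exI[of _ "- t"]) simp
          then have "(s - 1) / (- t) \<le> c" unfolding c_def using bdd by (rule cSup_upper)
          then show ?thesis using 3 by (simp add: field_simps)
        qed
      qed
      then show "\<forall>(z, r)\<in>G'. z \<in> topspace E \<and> (z \<in> C \<longrightarrow> r \<le> 1)"
        using Gtop lcs_topspace[OF E] x unfolding G'_def by blast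
    qed
    moreover have "G \<subseteq> G'" unfolding G'_def
    proof
      fix p assume "p \<in> G"
      then show "p \<in> {(y + t *\<^sub>R x, s + t * c) |y s t. (y, s) \<in> G}"
        by (intro CollectI exI[of _ "fst p"] exI[of _ "snd p"] exI[of _ 0]) auto
    qed
    ultimately have "G' = G" using max by blast
    moreover have "(x, c) \<in> G'" using G0 unfolding G'_def by (intro CollectI exI[of _ 0] exI[of _ 1]) auto
    ultimately show False using no by blast
  qed
  have zero: "r = 0" if r: "(0, r) \<in> G" for r
  proof -
    \<comment> \<open>All multiples of \<open>a\<close> are values at 0, which lies in
      \<open>C\<close>, and hence are at most 1.\<close>
    have "a \<le> 0" if "(0, a) \<in> G" for a
    proof (rule ccontr)
      assume "\<not> a \<le> 0"
      then obtain n :: nat where "1 < n * a" using reals_Archimedean3[of a] by auto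
      moreover have "n * a \<le> 1" using G1[OF Gscale[OF that, of n]] C(3) by simp
      ultimately show False by simp
    qed
    from this[OF r] this[of "- r"] Gscale[OF r, of "-1"] show ?thesis by simp
  qed
  have uniq: "r = s" if "(x, r) \<in> G" "(x, s) \<in> G" for x r s
    using zero[of "r - s"] Gadd[OF that(1) Gscale[OF that(2), of "-1"]] by simp
  define l where "l x = (SOME r. (x, r) \<in> G)" for x
  have lG: "(x, l x) \<in> G" if "x \<in> topspace E" for x using someI_ex[OF dom[OF that]] by (simp add: l_def)
  have add: "l (x + y) = l x + l y" if "x \<in> topspace E" "y \<in> topspace E" for x y
    using uniq[OF lG Gadd[OF lG lG]] that lcs_topspace[OF E] by simp
  have scale: "l (r *\<^sub>R x) = r * l x" if "x \<in> topspace E" for r x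
    using uniq[OF lG Gscale[OF lG]] that lcs_topspace[OF E] by simp
  have bound: "l x \<le> 1" if "x \<in> C" for x using G1[OF lG that] openin_subset[OF C(1)] that by auto
  have cont: "continuous_map E euclideanreal l"
  proof (rule continuous_mapI_limitin)
    fix x assume x: "x \<in> topspace E" and lim: "limitin E (\<lambda>y. y) x (atin E x)"
    have "\<forall>\<^sub>F y in atin E x. dist (l y) (l x) < e" if e: "e > 0" for e
    proof -
      \<comment> \<open>\<open>C\<close> need not be symmetric, so both signs of the difference are
        considered. With the factor \<open>2 / e\<close> the bound \<open>l \<le> 1\<close> on
        \<open>C\<close> becomes a deviation of at most \<open>e / 2\<close>.\<close>
      have "limitin E (\<lambda>y. (2 / e) *\<^sub>R (y - x)) ((2 / e) *\<^sub>R (x - x)) (atin E x)"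
        by (rule limitin_scaleR[OF E tendsto_const limitin_diff[OF E lim]]) (use x in simp)
      from limitinD[OF this C(1)] have 1: "\<forall>\<^sub>F y in atin E x. (2 / e) *\<^sub>R (y - x) \<in> C" using C by simp
      have "limitin E (\<lambda>y. (2 / e) *\<^sub>R (x - y)) ((2 / e) *\<^sub>R (x - x)) (atin E x)"
        by (rule limitin_scaleR[OF E tendsto_const limitin_diff[OF E _ lim]]) (use x in simp)
      from limitinD[OF this C(1)] have 2: "\<forall>\<^sub>F y in atin E x. (2 / e) *\<^sub>R (x - y) \<in> C" using C by simp
      from 1 2 limitin_ev_topspace[OF lim] show ?thesis
      proof eventually_elim
        case (elim y)
        have d: "l (a - b) = l a - l b" if "a \<in> topspace E" "b \<in> topspace E" for a b
          using add[of "a - b" b] that lcs_topspace[OF E] by simp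
        have "(2 / e) * (l y - l x) \<le> 1" "(2 / e) * (l x - l y) \<le> 1"
          using bound[OF elim(1)] bound[OF elim(2)] elim(3) x lcs_topspace[OF E] by (simp_all add: scale d)
        then have "l y - l x \<le> e / 2" "l x - l y \<le> e / 2" using e by (simp_all add: field_simps)
        then show ?case using e by (simp add: dist_real_def abs_less_iff)
      qed
    qed
    then show "limitin euclideanreal l (l x) (atin E x)" by (simp add: tendsto_iff)
  qed
  have "l v = 1" using uniq[OF lG vG] v by simp
  then show thesis using that[of l] add scale cont by (auto simp: cont_functional_def)
qed

lemma functionals_separate:
  assumes E: "lcs E" and uv: "u \<in> topspace E" "v \<in> topspace E"
    and eq: "\<And>l. cont_functional E l \<Longrightarrow> l u = l v"
  shows "u = v"
proof (rule ccontr)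
  assume "u \<noteq> v"
  then obtain l where l: "cont_functional E l" "l (u - v) \<noteq> 0"
    using separating_functional[OF E lcs_topspace(3)[OF E uv]] by auto
  have "l u = l (u - v) + l v"
    using l(1) uv lcs_topspace(3)[OF E uv] unfolding cont_functional_def by (metis diff_add_cancel)
  then show False using eq[OF l(1)] l(2) by simp
qed

lemma functional_smooth:
  assumes "lcs E" "cont_functional E l"
  shows "smooth_map_on (lcs_mfd E) (topspace E) (lcs_mfd euclideanreal) l"
  using assms lcs_real by (intro smooth_linear) (auto simp: cont_functional_def)

section \<open>Sections and trivializations\<close>

lemma over_iff: "a \<in> over A U \<longleftrightarrow> a \<in> pts (total A) \<and> proj A a \<in> U"
  by (simp add: over_def)

lemma fiber_iff: "a \<in> fiber A x \<longleftrightarrow> a \<in> pts (total A) \<and> proj A a = x"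
  by (simp add: over_def)

locale vec_bundle =
  fixes A :: "('a, 'ae::real_vector, 'm, 'e::real_vector, 'f::real_vector, 'z) vbundle_scheme"
  assumes vb: "vector_bundle A"
begin

lemma total_mfd: "manifold (total A)"
  and base_mfd: "manifold (base A)"
  and smooth_proj: "smooth_map (total A) (base A) (proj A)"
  and vadd_fiber: "x \<in> pts (base A) \<Longrightarrow> a \<in> fiber A x \<Longrightarrow> b \<in> fiber A x \<Longrightarrow> vadd A a b \<in> fiber A x"
  and vscale_fiber: "x \<in> pts (base A) \<Longrightarrow> a \<in> fiber A x \<Longrightarrow> vscale A r a \<in> fiber A x"
  using vb unfolding vector_bundle_def by blast+

lemma charted_total: "charted (total A)" and charted_base: "charted (base A)"
  using manifold_charted total_mfd base_mfd by auto

lemma ex_trivialization: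
  assumes "x \<in> pts (base A)"
  obtains \<phi> where "local_trivialization A \<phi>" "x \<in> tdom \<phi>"
  using vb assms unfolding vector_bundle_def by blast

lemma proj_pts: "a \<in> pts (total A) \<Longrightarrow> proj A a \<in> pts (base A)"
  using smooth_maps[OF smooth_proj] .

lemma over_open: "openin (mtop (base A)) U \<Longrightarrow> openin (mtop (total A)) (over A U)"
  using smooth_preimage[OF smooth_proj] by (simp add: over_def)

lemma sectionD:
  assumes "\<xi> \<in> sections A V"
  shows "smooth_map_on (base A) V (total A) \<xi>" "x \<in> V \<Longrightarrow> \<xi> x \<in> fiber A x" "openin (mtop (base A)) V"
    "x \<in> V \<Longrightarrow> x \<in> pts (base A)"
proof -
  show s: "smooth_map_on (base A) V (total A) \<xi>" using assms by (simp add: sections_def)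
  show "\<xi> x \<in> fiber A x" if "x \<in> V" using smooth_maps[OF s that] assms that by (simp add: fiber_iff sections_def)
  show "openin (mtop (base A)) V" using smooth_openin[OF s] .
  show "x \<in> pts (base A)" if "x \<in> V" using smooth_subset_pts[OF s that] .
qed

lemma section_restrict:
  assumes "\<xi> \<in> sections A V" "openin (mtop (base A)) W" "W \<subseteq> V"
  shows "restrict \<xi> W \<in> sections A W"
  unfolding sections_def
proof (intro CollectI conjI ballI)
  show "smooth_map_on (base A) W (total A) (restrict \<xi> W)"
    by (rule smooth_cong[OF charted_base smooth_subset[OF charted_base charted_total sectionD(1)[OF assms(1)] assms(2,3)]]) simp
  show "proj A (restrict \<xi> W x) = x" if "x \<in> W" for x using sectionD(2)[OF assms(1)] assms(3) that by (auto simp: fiber_iff)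
qed simp

text \<open>Needed because \<open>first_order\<close> compares sections over exactly
  \<open>tdom \<phi>\<close>, whereas sections with prescribed values are given on smaller
  sets.\<close>

lemma local_trivialization_restrict:
  assumes \<phi>: "local_trivialization A \<phi>" and W: "openin (mtop (base A)) W" "W \<subseteq> tdom \<phi>"
  shows "local_trivialization A (\<phi>\<lparr>tdom := W\<rparr>)"
proof -
  have cP: "charted (prod_mfd (base A) (lcs_mfd (tfib \<phi>)))"
    using \<phi> charted_base by (intro charted_prod charted_lcs) (auto simp: local_trivialization_def)
  have sub: "over A W \<subseteq> over A (tdom \<phi>)" using W by (auto simp: over_iff)
  have b: "bij_betw (triv \<phi>) (over A (tdom \<phi>)) (tdom \<phi> \<times> topspace (tfib \<phi>))"
    and s: "smooth_map_on (total A) (over A (tdom \<phi>)) (prod_mfd (base A) (lcs_mfd (tfib \<phi>))) (triv \<phi>)"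
    and i: "smooth_map_on (prod_mfd (base A) (lcs_mfd (tfib \<phi>))) (tdom \<phi> \<times> topspace (tfib \<phi>)) (total A) (inv_into (over A (tdom \<phi>)) (triv \<phi>))"
    and f: "\<And>a. a \<in> over A (tdom \<phi>) \<Longrightarrow> fst (triv \<phi> a) = proj A a"
    using \<phi> by (auto simp: local_trivialization_def diffeo_on_def)
  have inj: "inj_on (triv \<phi>) (over A W)" using b sub by (meson bij_betw_imp_inj_on inj_on_subset)
  have im: "triv \<phi> ` over A W = W \<times> topspace (tfib \<phi>)"
  proof (intro equalityI subsetI)
    fix p assume "p \<in> triv \<phi> ` over A W"
    then obtain a where a: "a \<in> over A W" "p = triv \<phi> a" by blast
    then have "p \<in> tdom \<phi> \<times> topspace (tfib \<phi>)" using b sub by (auto dest: bij_betwE)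
    then show "p \<in> W \<times> topspace (tfib \<phi>)" using f[of a] a sub by (auto simp: over_iff)
  next
    fix p assume p: "p \<in> W \<times> topspace (tfib \<phi>)"
    then have "p \<in> triv \<phi> ` over A (tdom \<phi>)" using b W by (auto simp: bij_betw_def)
    then obtain a where a: "a \<in> over A (tdom \<phi>)" "p = triv \<phi> a" by blast
    then have "proj A a \<in> W" using f[of a] p by auto
    then show "p \<in> triv \<phi> ` over A W" using a by (auto simp: over_iff)
  qed
  \<comment> \<open>\<open>inv_into\<close> depends on the set on which it inverts; injectivity on
    the larger set makes both inverses agree over \<open>W\<close>.\<close>
  have "inv_into (over A W) (triv \<phi>) p = inv_into (over A (tdom \<phi>)) (triv \<phi>) p" if "p \<in> W \<times> topspace (tfib \<phi>)" for p
  proof -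
    have "p \<in> triv \<phi> ` over A W" using that im by simp
    then obtain a where a: "a \<in> over A W" "p = triv \<phi> a" by blast
    then show ?thesis using inj b sub by (auto simp: bij_betw_def)
  qed
  moreover have "openin (mtop (prod_mfd (base A) (lcs_mfd (tfib \<phi>)))) (W \<times> topspace (tfib \<phi>))"
    using W by (simp add: prod_mfd_def lcs_mfd_def openin_prod_Times_iff)
  ultimately have "smooth_map_on (prod_mfd (base A) (lcs_mfd (tfib \<phi>))) (W \<times> topspace (tfib \<phi>)) (total A) (inv_into (over A W) (triv \<phi>))"
    using W by (intro smooth_cong[OF cP smooth_subset[OF cP charted_total i]]) auto
  moreover have "smooth_map_on (total A) (over A W) (prod_mfd (base A) (lcs_mfd (tfib \<phi>))) (triv \<phi>)"
    by (rule smooth_subset[OF charted_total cP s over_open[OF W(1)] sub])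
  ultimately show ?thesis
    using \<phi> W inj im sub by (auto simp: local_trivialization_def diffeo_on_def bij_betw_def)
qed

end

section \<open>Fibre coordinates in one trivialization\<close>

locale trivialized = vec_bundle +
  fixes \<phi>
  assumes lt: "local_trivialization A \<phi>"
begin

abbreviation rep where "rep a \<equiv> snd (triv \<phi> a)"
abbreviation vec where "vec x u \<equiv> inv_into (over A (tdom \<phi>)) (triv \<phi>) (x, u)"

lemma dom_open: "openin (mtop (base A)) (tdom \<phi>)"
  and lcs_fib: "lcs (tfib \<phi>)"
  and bij: "bij_betw (triv \<phi>) (over A (tdom \<phi>)) (tdom \<phi> \<times> topspace (tfib \<phi>))"
  and smooth_triv: "smooth_map_on (total A) (over A (tdom \<phi>)) (prod_mfd (base A) (lcs_mfd (tfib \<phi>))) (triv \<phi>)"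
  and smooth_vec: "smooth_map_on (prod_mfd (base A) (lcs_mfd (tfib \<phi>))) (tdom \<phi> \<times> topspace (tfib \<phi>)) (total A) (inv_into (over A (tdom \<phi>)) (triv \<phi>))"
  and fst_triv: "a \<in> over A (tdom \<phi>) \<Longrightarrow> fst (triv \<phi> a) = proj A a"
  and rep_vadd: "x \<in> tdom \<phi> \<Longrightarrow> a \<in> fiber A x \<Longrightarrow> b \<in> fiber A x \<Longrightarrow> rep (vadd A a b) = rep a + rep b"
  and rep_vscale: "x \<in> tdom \<phi> \<Longrightarrow> a \<in> fiber A x \<Longrightarrow> rep (vscale A r a) = r *\<^sub>R rep a"
  using lt unfolding local_trivialization_def diffeo_on_def by blast+

lemma dom_pts: "x \<in> tdom \<phi> \<Longrightarrow> x \<in> pts (base A)"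
  using openin_subset[OF dom_open] by auto

lemma charted_prod_fib: "charted (prod_mfd (base A) (lcs_mfd (tfib \<phi>)))"
  by (intro charted_prod charted_lcs charted_base lcs_fib)

lemma fiber_over: "x \<in> tdom \<phi> \<Longrightarrow> a \<in> fiber A x \<Longrightarrow> a \<in> over A (tdom \<phi>)"
  by (simp add: over_iff)

lemma triv_eq: "x \<in> tdom \<phi> \<Longrightarrow> a \<in> fiber A x \<Longrightarrow> triv \<phi> a = (x, rep a)"
  using fst_triv[OF fiber_over] by (metis fiber_iff prod.collapse)

lemma rep_topspace: "x \<in> tdom \<phi> \<Longrightarrow> a \<in> fiber A x \<Longrightarrow> rep a \<in> topspace (tfib \<phi>)"
  using bij_betwE[OF bij] fiber_over by fastforce

lemma triv_vec: "x \<in> tdom \<phi> \<Longrightarrow> u \<in> topspace (tfib \<phi>) \<Longrightarrow> triv \<phi> (vec x u) = (x, u)"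
  using bij by (intro f_inv_into_f) (auto simp: bij_betw_def)

lemma vec_fiber:
  assumes "x \<in> tdom \<phi>" "u \<in> topspace (tfib \<phi>)"
  shows "vec x u \<in> fiber A x"
proof -
  have "vec x u \<in> over A (tdom \<phi>)" using bij assms by (intro inv_into_into) (auto simp: bij_betw_def)
  then show ?thesis using fst_triv[of "vec x u"] triv_vec[OF assms] by (simp add: over_iff)
qed

lemma vec_rep: "x \<in> tdom \<phi> \<Longrightarrow> a \<in> fiber A x \<Longrightarrow> vec x (rep a) = a"
  using bij fiber_over triv_eq by (metis bij_betw_def inv_into_f_f)

lemma rep_inj: "x \<in> tdom \<phi> \<Longrightarrow> a \<in> fiber A x \<Longrightarrow> b \<in> fiber A x \<Longrightarrow> rep a = rep b \<Longrightarrow> a = b"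
  using vec_rep by metis

lemma vec_add:
  assumes x: "x \<in> tdom \<phi>" and u: "u \<in> topspace (tfib \<phi>)" "w \<in> topspace (tfib \<phi>)"
  shows "vec x (u + w) = vadd A (vec x u) (vec x w)"
  using u lcs_topspace[OF lcs_fib] rep_vadd[OF x vec_fiber[OF x u(1)] vec_fiber[OF x u(2)]]
  by (intro rep_inj[OF x] vec_fiber[OF x] vadd_fiber[OF dom_pts[OF x]]) (simp_all add: triv_vec x)

lemma vec_scale:
  assumes x: "x \<in> tdom \<phi>" and u: "u \<in> topspace (tfib \<phi>)"
  shows "vec x (r *\<^sub>R u) = vscale A r (vec x u)"
  using u lcs_topspace[OF lcs_fib] rep_vscale[OF x vec_fiber[OF x u]]
  by (intro rep_inj[OF x] vec_fiber[OF x] vscale_fiber[OF dom_pts[OF x]]) (simp_all add: triv_vec x)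

lemma smooth_rep: "smooth_map_on (total A) (over A (tdom \<phi>)) (lcs_mfd (tfib \<phi>)) (\<lambda>a. rep a)"
proof -
  have "smooth_map_on (lcs_mfd (tfib \<phi>)) (topspace (tfib \<phi>)) (lcs_mfd (tfib \<phi>)) (\<lambda>u. u)"
    by (rule smooth_linear[OF lcs_fib lcs_fib]) auto
  from smooth_snd[OF charted_base charted_lcs[OF lcs_fib] dom_open this lcs_fib]
  show ?thesis
    by (rule smooth_compose[OF charted_total charted_prod_fib charted_lcs[OF lcs_fib] smooth_triv])
       (use bij_betwE[OF bij] in blast)
qed

lemma section_rep_smooth:
  assumes "\<xi> \<in> sections A V" "V \<subseteq> tdom \<phi>"
  shows "smooth_map_on (base A) V (lcs_mfd (tfib \<phi>)) (\<lambda>x. rep (\<xi> x))"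
  by (rule smooth_compose[OF charted_base charted_total charted_lcs[OF lcs_fib] sectionD(1)[OF assms(1)] smooth_rep])
     (use assms sectionD(2)[OF assms(1)] in \<open>auto simp: over_iff\<close>)

text \<open>Constant sections in a trivialization extend every single vector to a local section, see
  \<open>ex_section\<close>.\<close>

lemma const_section:
  assumes V: "openin (mtop (base A)) V" "V \<subseteq> tdom \<phi>" and u: "u \<in> topspace (tfib \<phi>)"
  shows "restrict (\<lambda>x. vec x u) V \<in> sections A V"
  unfolding sections_def
proof (intro CollectI conjI ballI)
  have "smooth_map_on (base A) V (prod_mfd (base A) (lcs_mfd (tfib \<phi>))) (\<lambda>x. (x, u))"
    by (rule smooth_Pair[OF charted_base charted_base charted_lcs[OF lcs_fib] smooth_id[OF base_mfd V(1)]
          smooth_const[OF charted_base lcs_fib V(1) u]])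
  then have "smooth_map_on (base A) V (total A) (\<lambda>x. vec x u)"
    by (rule smooth_compose[OF charted_base charted_prod_fib charted_total _ smooth_vec]) (use V u in auto)
  then show "smooth_map_on (base A) V (total A) (restrict (\<lambda>x. vec x u) V)"
    by (rule smooth_cong[OF charted_base]) simp
  show "proj A (restrict (\<lambda>x. vec x u) V x) = x" if "x \<in> V" for x
    using vec_fiber[of x u] that V u by (auto simp: fiber_iff)
qed simp

end

context vec_bundle
begin

lemma ex_section:
  assumes a: "a \<in> fiber A x" and V: "openin (mtop (base A)) V" "x \<in> V" "local_trivialization A \<phi>" "V \<subseteq> tdom \<phi>"
  shows "\<exists>\<xi>\<in>sections A V. \<xi> x = a"
proof -
  interpret trivialized A \<phi> using V by unfold_locales
  have x: "x \<in> tdom \<phi>" using V by auto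
  show ?thesis using const_section[OF V(1,4) rep_topspace[OF x a]] vec_rep[OF x a] V(2)
    by (intro bexI[of _ "restrict (\<lambda>x. vec x (rep a)) V"]) auto
qed

text \<open>All vectors are extended over one common set, as \<open>koszul\<close> evaluates all its
  sections over the same \<open>V\<close>.\<close>

lemma ex_sections:
  assumes x: "x \<in> W" and W: "openin (mtop (base A)) W" and vs: "set vs \<subseteq> fiber A x"
  obtains V \<xi> where "openin (mtop (base A)) V" "x \<in> V" "V \<subseteq> W"
    "\<And>i. i < length vs \<Longrightarrow> \<xi> i \<in> sections A V" "\<And>i. i < length vs \<Longrightarrow> \<xi> i x = vs ! i"
proof -
  have "x \<in> pts (base A)" using x openin_subset[OF W] by auto
  then obtain \<phi> where \<phi>: "local_trivialization A \<phi>" "x \<in> tdom \<phi>" by (rule ex_trivialization)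
  then have o: "openin (mtop (base A)) (W \<inter> tdom \<phi>)" using W by (auto simp: local_trivialization_def)
  have "\<exists>\<xi>\<in>sections A (W \<inter> tdom \<phi>). \<xi> x = vs ! i" if "i < length vs" for i
    by (rule ex_section[OF _ o _ \<phi>(1)]) (use vs that nth_mem x \<phi> in auto)
  then obtain \<xi> where "\<And>i. i < length vs \<Longrightarrow> \<xi> i \<in> sections A (W \<inter> tdom \<phi>) \<and> \<xi> i x = vs ! i" by metis
  then show thesis using that[OF o] x \<phi> by blast
qed

section \<open>Forms\<close>

context
  fixes k x w
  assumes w: "fiber_form A k x w" and x: "x \<in> pts (base A)"
begin

text \<open>\<open>fiber_form\<close> speaks of list updates; splitting the argument list at the
  slot fits the index lists of the Koszul formula.\<close>

lemma form_vadd: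
  assumes "set P \<subseteq> fiber A x" "set Q \<subseteq> fiber A x" "a \<in> fiber A x" "b \<in> fiber A x" "length P + Suc (length Q) = k"
  shows "w (P @ vadd A a b # Q) = w (P @ a # Q) + w (P @ b # Q)"
proof -
  have "P @ a # Q \<in> args A k x" "length P < k" using assms by (auto simp: args_def)
  with w assms have "w ((P @ a # Q)[length P := vadd A a b]) = w ((P @ a # Q)[length P := a]) + w ((P @ a # Q)[length P := b])"
    unfolding fiber_form_def by blast
  then show ?thesis by simp
qed

lemma form_vscale:
  assumes "set P \<subseteq> fiber A x" "set Q \<subseteq> fiber A x" "a \<in> fiber A x" "length P + Suc (length Q) = k"
  shows "w (P @ vscale A r a # Q) = r * w (P @ a # Q)"
proof -
  have "P @ a # Q \<in> args A k x" "length P < k" using assms by (auto simp: args_def)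
  with w assms have "w ((P @ a # Q)[length P := vscale A r a]) = r * w ((P @ a # Q)[length P := a])"
    unfolding fiber_form_def by blast
  then show ?thesis by simp
qed

lemma form_repeat:
  assumes "set P \<subseteq> fiber A x" "set Q \<subseteq> fiber A x" "a \<in> fiber A x" "length P + Suc (Suc (length Q)) = k"
  shows "w (P @ a # a # Q) = 0"
proof -
  have vs: "P @ a # a # Q \<in> args A k x" and l: "length P < k" "Suc (length P) < k" using assms by (auto simp: args_def)
  have "(P @ a # a # Q) ! length P = (P @ a # a # Q) ! Suc (length P)" by (simp add: nth_append)
  moreover have "\<forall>vs\<in>args A k x. \<forall>i<k. \<forall>j<k. i \<noteq> j \<and> vs ! i = vs ! j \<longrightarrow> w vs = 0"
    using w unfolding fiber_form_def by blast
  ultimately show ?thesis using vs l n_not_Suc_n by blast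
qed

text \<open>Polarization: expand the value with the sum of \<open>a\<close> and \<open>b\<close> in
  both slots, which vanishes.\<close>

lemma form_swap:
  assumes "set P \<subseteq> fiber A x" "set Q \<subseteq> fiber A x" "a \<in> fiber A x" "b \<in> fiber A x" "length P + Suc (Suc (length Q)) = k"
  shows "w (P @ a # b # Q) = - w (P @ b # a # Q)"
proof -
  let ?c = "vadd A a b"
  have c: "?c \<in> fiber A x" using vadd_fiber x assms by blast
  have "w (P @ ?c # ?c # Q) = w (P @ a # ?c # Q) + w (P @ b # ?c # Q)"
    using assms c by (intro form_vadd) auto
  moreover have "w ((P @ [d]) @ ?c # Q) = w ((P @ [d]) @ a # Q) + w ((P @ [d]) @ b # Q)" if "d \<in> fiber A x" for d
    using assms that by (intro form_vadd) auto
  ultimately show ?thesis using form_repeat[OF assms(1,2)] c assms by simp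
qed

text \<open>Each transposition with the left neighbour changes the sign, and \<open>length P\<close>
  of them are needed.\<close>

lemma form_move:
  assumes "set P \<subseteq> fiber A x" "set Q \<subseteq> fiber A x" "a \<in> fiber A x" "length P + Suc (length Q) = k"
  shows "w (P @ a # Q) = (-1) ^ length P * w (a # P @ Q)"
  using assms
proof (induction P arbitrary: Q rule: rev_induct)
  case (snoc b P)
  have "w ((P @ [b]) @ a # Q) = - w (P @ a # b # Q)"
    using form_swap[of P Q b a] snoc.prems by simp
  also have "\<dots> = - ((-1) ^ length P * w (a # P @ b # Q))"
    using snoc.IH[of "b # Q"] snoc.prems by simp
  finally show ?case by simp
qed simp

end

lemma forms_fiber: "\<omega> \<in> forms A k U \<Longrightarrow> k > 0 \<Longrightarrow> x \<in> U \<Longrightarrow> fiber_form A k x (\<omega> x)"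
  and forms_smooth: "\<omega> \<in> forms A k U \<Longrightarrow> k > 0 \<Longrightarrow> form_smooth A k U \<omega>"
  and forms_function: "\<omega> \<in> forms A 0 U \<Longrightarrow> smooth_map_on (base A) U (lcs_mfd euclideanreal) (\<lambda>x. \<omega> x [])"
  by (auto simp: forms_def)

end

context trivialized
begin

lemma form_rep_smooth:
  assumes "\<omega> \<in> forms A k U" "k > 0"
  shows "smooth_map_on (prod_mfd (base A) (lcs_mfd (power_lcs (tfib \<phi>) k)))
         ((U \<inter> tdom \<phi>) \<times> topspace (power_lcs (tfib \<phi>) k)) (lcs_mfd euclideanreal)
         (\<lambda>(x, v). \<omega> x (map (\<lambda>i. vec x (v i)) [0..<k]))"
  using forms_smooth[OF assms] lt unfolding form_smooth_def by blast

lemma map_index: "length ls = k \<Longrightarrow> map (\<lambda>i. g (if i < k then f (ls ! i) else z)) [0..<k] = map (\<lambda>l. g (f l)) ls"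
  by (auto intro!: nth_equalityI)

text \<open>In the trivialization this is the smooth local expression of the form composed with the
  representatives of the sections. Degree 0 is separate because there \<open>forms\<close> asks for
  smoothness of a function instead.\<close>

lemma form_eval_smooth:
  assumes \<omega>: "\<omega> \<in> forms A k U" and V: "openin (mtop (base A)) V" "V \<subseteq> U" "V \<subseteq> tdom \<phi>"
    and \<xi>: "\<And>l. l \<in> set ls \<Longrightarrow> \<xi> l \<in> sections A V" and ls: "length ls = k"
  shows "smooth_map_on (base A) V (lcs_mfd euclideanreal) (\<lambda>y. \<omega> y (map (\<lambda>l. \<xi> l y) ls))"
proof (cases "k = 0")
  case True
  then show ?thesis
    using smooth_subset[OF charted_base charted_lcs[OF lcs_real] forms_function V(1,2)] \<omega> ls by simp
next
  case False
  let ?P = "power_lcs (tfib \<phi>) k"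
  let ?s = "\<lambda>y i. if i < k then rep (\<xi> (ls ! i) y) else 0"
  have lP: "lcs ?P" by (rule lcs_power[OF lcs_fib])
  have s: "smooth_map_on (base A) V (lcs_mfd ?P) ?s"
  proof (rule smooth_power[OF charted_base lcs_fib V(1)])
    fix i assume i: "i < k"
    then have "\<xi> (ls ! i) \<in> sections A V" using \<xi> ls by simp
    from section_rep_smooth[OF this V(3)] show "smooth_map_on (base A) V (lcs_mfd (tfib \<phi>)) (\<lambda>y. ?s y i)" using i by simp
  qed simp
  have "smooth_map_on (base A) V (prod_mfd (base A) (lcs_mfd ?P)) (\<lambda>y. (y, ?s y))"
    by (rule smooth_Pair[OF charted_base charted_base charted_lcs[OF lP] smooth_id[OF base_mfd V(1)] s])
  from smooth_compose[OF charted_base charted_prod[OF charted_base charted_lcs[OF lP]] charted_lcs[OF lcs_real] this form_rep_smooth[OF \<omega>]]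
  have "smooth_map_on (base A) V (lcs_mfd euclideanreal) (\<lambda>y. \<omega> y (map (\<lambda>i. vec y (?s y i)) [0..<k]))"
    using False V smooth_maps[OF s] by (auto simp: lcs_mfd_def)
  then show ?thesis
  proof (rule smooth_cong[OF charted_base])
    fix y assume y: "y \<in> V"
    have "map (\<lambda>i. vec y (?s y i)) [0..<k] = map (\<lambda>l. vec y (rep (\<xi> l y))) ls"
      using ls by (rule map_index)
    also have "\<dots> = map (\<lambda>l. \<xi> l y) ls"
      using vec_rep[of y] sectionD(2)[OF \<xi>] y V by (intro map_cong) auto
    finally show "\<omega> y (map (\<lambda>i. vec y (?s y i)) [0..<k]) = \<omega> y (map (\<lambda>l. \<xi> l y) ls)" by simp
  qed
qed

text \<open>Joint continuity in base point and vectors. It is applied to the slot that carries a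
  difference quotient of representatives, which converges in the typical fibre.\<close>

lemma form_limit:
  assumes \<omega>: "\<omega> \<in> forms A k U" "k > 0" and x: "x \<in> U" "x \<in> tdom \<phi>" and U: "openin (mtop (base A)) U"
    and y: "limitin (mtop (base A)) y x L"
    and u: "\<And>l. l \<in> set ls \<Longrightarrow> limitin (tfib \<phi>) (u l) (u0 l) L" and ls: "length ls = k"
  shows "((\<lambda>t. \<omega> (y t) (map (\<lambda>l. vec (y t) (u l t)) ls)) \<longlongrightarrow> \<omega> x (map (\<lambda>l. vec x (u0 l)) ls)) L"
proof -
  let ?P = "power_lcs (tfib \<phi>) k"
  let ?T = "prod_topology (mtop (base A)) ?P"
  have c: "continuous_map (subtopology ?T ((U \<inter> tdom \<phi>) \<times> topspace ?P)) euclideanreal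
      (\<lambda>(x, v). \<omega> x (map (\<lambda>i. vec x (v i)) [0..<k]))"
    using smooth_cont[OF form_rep_smooth[OF \<omega>]] by (simp add: prod_mfd_def lcs_mfd_def)
  have "limitin ?P (\<lambda>t i. if i < k then u (ls ! i) t else 0) (\<lambda>i. if i < k then u0 (ls ! i) else 0) L"
    using u ls by (intro limitin_power_lcs) auto
  from limitin_Pair[OF y this]
  have l: "limitin ?T (\<lambda>t. (y t, \<lambda>i. if i < k then u (ls ! i) t else 0)) (x, \<lambda>i. if i < k then u0 (ls ! i) else 0) L" .
  have o: "openin ?T ((U \<inter> tdom \<phi>) \<times> topspace ?P)" using U dom_open by (simp add: openin_prod_Times_iff openin_Int)
  have m: "(x, \<lambda>i. if i < k then u0 (ls ! i) else 0) \<in> (U \<inter> tdom \<phi>) \<times> topspace ?P"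
    using limitin_topspace[OF l] x by auto
  have "limitin (subtopology ?T ((U \<inter> tdom \<phi>) \<times> topspace ?P)) (\<lambda>t. (y t, \<lambda>i. if i < k then u (ls ! i) t else 0))
      (x, \<lambda>i. if i < k then u0 (ls ! i) else 0) L"
    using l m limitinD[OF l o m] by (simp add: limitin_subtopology)
  from limitin_map[OF c this] show ?thesis
    using map_index[OF ls, of "vec x" u0 0] map_index[OF ls, of "vec (y t)" "\<lambda>l. u l t" 0 for t] by simp
qed

text \<open>Used with \<open>c = 1 / t\<close> for difference quotients and with
  \<open>c = 1\<close> for differences of brackets.\<close>

lemma form_rep_diff:
  assumes \<omega>: "fiber_form A k x w" and x: "x \<in> tdom \<phi>" and ab: "a \<in> topspace (tfib \<phi>)" "b \<in> topspace (tfib \<phi>)"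
    and PQ: "set P \<subseteq> fiber A x" "set Q \<subseteq> fiber A x" "length P + Suc (length Q) = k"
  shows "w (P @ vec x (c *\<^sub>R (a - b)) # Q) = c * (w (P @ vec x a # Q) - w (P @ vec x b # Q))"
proof -
  have d: "a - b \<in> topspace (tfib \<phi>)" using ab lcs_topspace[OF lcs_fib] by simp
  have "w (P @ vec x (c *\<^sub>R (a - b)) # Q) = c * w (P @ vec x (a - b) # Q)"
    unfolding vec_scale[OF x d] by (rule form_vscale[OF \<omega> dom_pts[OF x] PQ(1,2) vec_fiber[OF x d] PQ(3)])
  moreover have "w (P @ vec x ((a - b) + b) # Q) = w (P @ vec x (a - b) # Q) + w (P @ vec x b # Q)"
    unfolding vec_add[OF x d ab(2)]
    by (rule form_vadd[OF \<omega> dom_pts[OF x] PQ(1,2) vec_fiber[OF x d] vec_fiber[OF x ab(2)] PQ(3)])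
  ultimately show ?thesis by simp
qed

end

context vec_bundle
begin

text \<open>The source of test forms in degree 1: composing a functional with the fibre coordinate
  gives such an \<open>l\<close> on the target bundle, and composing further with a bundle morphism
  gives one on the source.\<close>

lemma linear_form:
  assumes l: "smooth_map_on (total A) (over A U) (lcs_mfd euclideanreal) l" and U: "openin (mtop (base A)) U"
    and add: "\<And>x a b. x \<in> U \<Longrightarrow> a \<in> fiber A x \<Longrightarrow> b \<in> fiber A x \<Longrightarrow> l (vadd A a b) = l a + l b"
    and scale: "\<And>x a r. x \<in> U \<Longrightarrow> a \<in> fiber A x \<Longrightarrow> l (vscale A r a) = r * l a"
  shows "(\<lambda>x vs. if x \<in> U \<and> vs \<in> args A 1 x then l (hd vs) else 0) \<in> forms A 1 U" (is "?\<omega> \<in> _")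
proof -
  have "fiber_form A 1 x (?\<omega> x)" if x: "x \<in> U" for x
    unfolding fiber_form_def
  proof (intro conjI ballI allI impI)
    have pts: "x \<in> pts (base A)" using x openin_subset[OF U] by auto
    let ?P = "product_topology (\<lambda>_. subtopology (mtop (total A)) (fiber A x)) {..<1::nat}"
    have "continuous_map ?P (subtopology (mtop (total A)) (fiber A x)) (\<lambda>v. v 0)"
      by (rule continuous_map_product_projection) simp
    moreover have "continuous_map (subtopology (mtop (total A)) (fiber A x)) euclideanreal l"
      using continuous_map_from_subtopology_mono[OF smooth_cont[OF l], of "fiber A x"] x
      by (auto simp: lcs_mfd_def over_def)
    ultimately have "continuous_map ?P euclideanreal (l \<circ> (\<lambda>v. v 0))" by (rule continuous_map_compose)
    then show "continuous_map ?P euclideanreal (\<lambda>v. ?\<omega> x (map v [0..<1]))"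
      by (rule continuous_map_eq) (use x in \<open>auto simp: args_def PiE_iff\<close>)
    fix vs i assume "vs \<in> args A 1 x" "i < (1::nat)"
    then obtain c where c: "vs = [c]" "c \<in> fiber A x" "i = 0" by (auto simp: args_def length_Suc_conv)
    show "?\<omega> x (vs[i := vadd A a b]) = ?\<omega> x (vs[i := a]) + ?\<omega> x (vs[i := b])" if "a \<in> fiber A x" "b \<in> fiber A x" for a b
      using vadd_fiber[OF pts that] that x c add[OF x that] by (simp add: args_def)
    show "?\<omega> x (vs[i := vscale A r a]) = r * ?\<omega> x (vs[i := a])" if "a \<in> fiber A x" for a r
      using vscale_fiber[OF pts that] that x c scale[OF x that] by (simp add: args_def)
    show "?\<omega> x vs = 0" if "j < 1" "i \<noteq> j \<and> vs ! i = vs ! j" for j using that c by simp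
  qed
  moreover have "form_smooth A 1 U ?\<omega>"
    unfolding form_smooth_def
  proof (intro allI impI)
    fix \<phi> assume "local_trivialization A \<phi>"
    then interpret trivialized A \<phi> by unfold_locales
    let ?P = "power_lcs (tfib \<phi>) 1"
    let ?D = "(U \<inter> tdom \<phi>) \<times> topspace ?P"
    have lP: "lcs ?P" by (rule lcs_power[OF lcs_fib])
    have cP: "charted (prod_mfd (base A) (lcs_mfd ?P))" by (intro charted_prod charted_base charted_lcs lP)
    have oU: "openin (mtop (base A)) (U \<inter> tdom \<phi>)" using U dom_open by blast
    have oP: "openin (mtop (lcs_mfd ?P)) (topspace ?P)" by (simp add: lcs_mfd_def)
    have "smooth_map_on (lcs_mfd ?P) (topspace ?P) (lcs_mfd (tfib \<phi>)) (\<lambda>v. v 0)"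
      by (rule smooth_linear[OF lP lcs_fib continuous_map_power_proj]) (simp_all add: scaleR_fun_def)
    from smooth_snd[OF charted_base charted_lcs[OF lP] oU this lcs_fib]
    have "smooth_map_on (prod_mfd (base A) (lcs_mfd ?P)) ?D (lcs_mfd (tfib \<phi>)) (\<lambda>z. snd z 0)" .
    from smooth_Pair[OF cP charted_base charted_lcs[OF lcs_fib] smooth_fst[OF base_mfd charted_lcs[OF lP] oU oP] this]
    have "smooth_map_on (prod_mfd (base A) (lcs_mfd ?P)) ?D (prod_mfd (base A) (lcs_mfd (tfib \<phi>))) (\<lambda>z. (fst z, snd z 0))" .
    then have "smooth_map_on (prod_mfd (base A) (lcs_mfd ?P)) ?D (total A) (\<lambda>z. vec (fst z) (snd z 0))"
      by (rule smooth_compose[OF cP charted_prod_fib charted_total _ smooth_vec]) (auto simp: topspace_power_lcs)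
    then have "smooth_map_on (prod_mfd (base A) (lcs_mfd ?P)) ?D (lcs_mfd euclideanreal) (\<lambda>z. l (vec (fst z) (snd z 0)))"
      using vec_fiber by (intro smooth_compose[OF cP charted_total charted_lcs[OF lcs_real] _ l]) (auto simp: over_iff topspace_power_lcs)
    then show "smooth_map_on (prod_mfd (base A) (lcs_mfd ?P)) ?D (lcs_mfd euclideanreal)
         (\<lambda>(x, v). ?\<omega> x (map (\<lambda>i. vec x (v i)) [0..<1]))"
    proof (rule smooth_cong[OF cP])
      fix z assume "z \<in> ?D"
      then obtain y v where z: "z = (y, v)" "y \<in> U" "y \<in> tdom \<phi>" "v 0 \<in> topspace (tfib \<phi>)"
        by (auto simp: topspace_power_lcs)
      then have "[vec y (v 0)] \<in> args A 1 y" using vec_fiber[OF z(3,4)] by (simp add: args_def)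
      then show "l (vec (fst z) (snd z 0)) = (case z of (x, v) \<Rightarrow> ?\<omega> x (map (\<lambda>i. vec x (v i)) [0..<1]))"
        using z(1,2) by simp
    qed
  qed
  ultimately show ?thesis by (simp add: forms_def)
qed

end

section \<open>The differential\<close>

lemma lie_deriv_pointwise: "X x = Y x \<Longrightarrow> lie_deriv M F X h x = lie_deriv M F Y h x"
  by (simp add: lie_deriv_def)

lemma sec_rep_eq: "sec_rep \<phi> \<xi> = (\<lambda>x. snd (triv \<phi> (\<xi> x)))"
  by (simp add: sec_rep_def o_def)

section \<open>Index bookkeeping for the Koszul formula\<close>

lemma filter_upt_split:
  assumes "i \<le> k" "i \<noteq> j"
  shows "[l\<leftarrow>[0..<Suc k]. l \<noteq> j] = [l\<leftarrow>[0..<i]. l \<noteq> j] @ i # [l\<leftarrow>[Suc i..<Suc k]. l \<noteq> j]"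
    and "[l\<leftarrow>[0..<Suc k]. l \<noteq> i \<and> l \<noteq> j] = [l\<leftarrow>[0..<i]. l \<noteq> j] @ [l\<leftarrow>[Suc i..<Suc k]. l \<noteq> j]"
proof -
  have "[0..<Suc k] = [0..<i] @ [i..<Suc k]" using assms by (metis le0 le_SucI upt_add_eq_append le_add_diff_inverse)
  also have "[i..<Suc k] = i # [Suc i..<Suc k]" using assms by (intro upt_conv_Cons) simp
  finally have s: "[0..<Suc k] = [0..<i] @ i # [Suc i..<Suc k]" .
  show "[l\<leftarrow>[0..<Suc k]. l \<noteq> j] = [l\<leftarrow>[0..<i]. l \<noteq> j] @ i # [l\<leftarrow>[Suc i..<Suc k]. l \<noteq> j]"
    unfolding s using assms by simp
  have "[l\<leftarrow>[0..<i]. l \<noteq> i \<and> l \<noteq> j] = [l\<leftarrow>[0..<i]. l \<noteq> j]"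
    "[l\<leftarrow>[Suc i..<Suc k]. l \<noteq> i \<and> l \<noteq> j] = [l\<leftarrow>[Suc i..<Suc k]. l \<noteq> j]"
    by (auto intro!: filter_cong)
  then show "[l\<leftarrow>[0..<Suc k]. l \<noteq> i \<and> l \<noteq> j] = [l\<leftarrow>[0..<i]. l \<noteq> j] @ [l\<leftarrow>[Suc i..<Suc k]. l \<noteq> j]"
    unfolding s by simp
qed

text \<open>For \<open>i = i0\<close> this is the position of \<open>i0\<close> in the argument list
  without \<open>j\<close>, hence the exponent of the sign when that argument is moved to the
  front.\<close>

lemma length_filter_upt: "length [l\<leftarrow>[0..<i]. l \<noteq> j] = (if j < i then i - 1 else i)"
proof -
  have "length [l\<leftarrow>[0..<i]. l \<noteq> j] = card (set [l\<leftarrow>[0..<i]. l \<noteq> j])"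
    by (rule distinct_card[symmetric]) simp
  also have "set [l\<leftarrow>[0..<i]. l \<noteq> j] = {..<i} - {j}" by auto
  finally show ?thesis by simp
qed

lemma length_filter_upt2:
  assumes "i \<le> k" "j \<le> k" "i \<noteq> j"
  shows "length [l\<leftarrow>[0..<Suc k]. l \<noteq> i \<and> l \<noteq> j] = k - 1"
  using length_filter_upt[where i = "Suc k" and j = j] arg_cong[OF filter_upt_split(1)[OF assms(1,3)], of length]
    arg_cong[OF filter_upt_split(2)[OF assms(1,3)], of length] assms by (simp del: upt_Suc)

text \<open>When only the section with index \<open>i0\<close> is exchanged, just the pairs
  containing \<open>i0\<close> can contribute to the change of the bracket terms.\<close>

lemma sum_pairs_through:
  fixes d :: "nat \<Rightarrow> nat \<Rightarrow> real"
  assumes "i0 \<le> k" and "\<And>i j. i \<noteq> i0 \<Longrightarrow> j \<noteq> i0 \<Longrightarrow> d i j = 0"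
  shows "(\<Sum>(i, j) | i < j \<and> j \<le> k. d i j) = (\<Sum>j<i0. d j i0) + (\<Sum>j\<in>{i0<..k}. d i0 j)"
proof -
  let ?S = "{(i, j). i < j \<and> j \<le> k}" and ?A = "(\<lambda>j. (j, i0)) ` {..<i0}" and ?B = "(\<lambda>j. (i0, j)) ` {i0<..k}"
  have "finite ?S" by (rule finite_subset[of _ "{..k} \<times> {..k}"]) auto
  then have "(\<Sum>(i, j)\<in>?S. d i j) = (\<Sum>(i, j)\<in>?A \<union> ?B. d i j)"
  proof (intro sum.mono_neutral_right ballI)
    show "?A \<union> ?B \<subseteq> ?S" using assms(1) by auto
    fix p assume p: "p \<in> ?S - (?A \<union> ?B)"
    then obtain a b where ab: "p = (a, b)" "a < b" "b \<le> k" by auto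
    then have "a \<noteq> i0" "b \<noteq> i0" using p by auto
    then show "(case p of (i, j) \<Rightarrow> d i j) = 0" using assms(2) ab by simp
  qed auto
  also have "\<dots> = (\<Sum>(i, j)\<in>?A. d i j) + (\<Sum>(i, j)\<in>?B. d i j)"
    by (rule sum.union_disjoint) auto
  also have "(\<Sum>(i, j)\<in>?A. d i j) = (\<Sum>j<i0. d j i0)" by (subst sum.reindex) (auto simp: inj_on_def)
  also have "(\<Sum>(i, j)\<in>?B. d i j) = (\<Sum>j\<in>{i0<..k}. d i0 j)" by (subst sum.reindex) (auto simp: inj_on_def)
  finally show ?thesis .
qed

lemma sum_atMost_split:
  fixes d :: "nat \<Rightarrow> real"
  assumes "i0 \<le> k"
  shows "(\<Sum>j\<le>k. d j) = d i0 + (\<Sum>j<i0. d j) + (\<Sum>j\<in>{i0<..k}. d j)"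
proof -
  have "{..k} = insert i0 ({..<i0} \<union> {i0<..k})" using assms by auto
  moreover have "sum d ({..<i0} \<union> {i0<..k}) = sum d {..<i0} + sum d {i0<..k}"
    by (rule sum.union_disjoint) auto
  ultimately show ?thesis by simp
qed

definition lie_term ::
    "('a, 'ae::real_vector, 'm, 'e::real_vector, 'f::real_vector) algebroid
      \<Rightarrow> nat \<Rightarrow> ('m, 'a) family \<Rightarrow> (nat \<Rightarrow> 'm \<Rightarrow> 'a) \<Rightarrow> 'm \<Rightarrow> nat \<Rightarrow> real"
  where "lie_term A k \<omega> \<xi> x j = lie_deriv (base A) euclideanreal (anchor A \<circ> \<xi> j)
    (\<lambda>y. \<omega> y (map (\<lambda>l. \<xi> l y) [l\<leftarrow>[0..<Suc k]. l \<noteq> j])) x"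

definition bracket_term ::
    "('a, 'ae::real_vector, 'm, 'e::real_vector, 'f::real_vector) algebroid
      \<Rightarrow> nat \<Rightarrow> 'm set \<Rightarrow> ('m, 'a) family \<Rightarrow> (nat \<Rightarrow> 'm \<Rightarrow> 'a) \<Rightarrow> 'm \<Rightarrow> nat \<Rightarrow> nat \<Rightarrow> real"
  where "bracket_term A k V \<omega> \<xi> x i j =
    \<omega> x (bracket A V (\<xi> i) (\<xi> j) x # map (\<lambda>l. \<xi> l x) [l\<leftarrow>[0..<Suc k]. l \<noteq> i \<and> l \<noteq> j])"

lemma koszul_terms:
  "koszul A k V \<omega> \<xi> x = (\<Sum>j\<le>k. (-1) ^ j * lie_term A k \<omega> \<xi> x j)
     + (\<Sum>(i, j) | i < j \<and> j \<le> k. (-1) ^ (i + j) * bracket_term A k V \<omega> \<xi> x i j)"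
  unfolding koszul_def lie_term_def bracket_term_def ..

lemma koszul_cong:
  assumes "\<And>j. j \<le> k \<Longrightarrow> lie_term A k \<omega> \<xi> x j = lie_term B k \<alpha> \<eta> y j"
    and "\<And>i j. i < j \<Longrightarrow> j \<le> k \<Longrightarrow> bracket_term A k V \<omega> \<xi> x i j = bracket_term B k W \<alpha> \<eta> y i j"
  shows "koszul A k V \<omega> \<xi> x = koszul B k W \<alpha> \<eta> y"
  unfolding koszul_terms using assms by (intro arg_cong2[where f = "(+)"] sum.cong) auto

section \<open>Locality of the Koszul formula and of the differential\<close>

locale algebroid_loc =
  fixes A :: "('a, 'ae::real_vector, 'm, 'e::real_vector, 'f::real_vector) algebroid"
  assumes la: "lie_algebroid A"
begin

sublocale vec_bundle A
  using la by unfold_locales (simp add: lie_algebroid_def)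

lemma anchor_tangent: "a \<in> pts (total A) \<Longrightarrow> anchor A a \<in> tangent_vectors (base A)"
  and fst_anchor: "a \<in> pts (total A) \<Longrightarrow> fst (anchor A a) = proj A a"
proof -
  have m: "vb_morphism A (tangent_bundle (base A)) (anchor A) id" using la by (simp add: lie_algebroid_def)
  then have "smooth_map (total A) (tangent_mfd (base A)) (anchor A)" by (simp add: vb_morphism_def tangent_bundle_def)
  from smooth_maps[OF this] show "anchor A a \<in> tangent_vectors (base A)" if "a \<in> pts (total A)"
    using that by (simp add: topspace_tangent_mfd[OF base_mfd])
  show "fst (anchor A a) = proj A a" if "a \<in> pts (total A)"
    using m that by (simp add: vb_morphism_def tangent_bundle_def)
qed

lemma anchor_fiber: "a \<in> fiber A x \<Longrightarrow> tangent_at (base A) (anchor A a)" "a \<in> fiber A x \<Longrightarrow> fst (anchor A a) = x"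
  using anchor_tangent fst_anchor base_mfd by (auto simp: fiber_iff tangent_at_def)

lemma sheaf: "sheaf_bilinear A" and first_order: "first_order A"
  using la by (simp_all add: lie_algebroid_def)

lemma bracket_section:
  assumes "\<xi> \<in> sections A V" "\<eta> \<in> sections A V"
  shows "bracket A V \<xi> \<eta> \<in> sections A V"
  using sheaf[unfolded sheaf_bilinear_def, rule_format, OF sectionD(3)[OF assms(1)], THEN conjunct1] assms by simp

lemma bracket_restrict:
  assumes "\<xi> \<in> sections A V" "\<eta> \<in> sections A V" "openin (mtop (base A)) W" "W \<subseteq> V"
  shows "bracket A W (restrict \<xi> W) (restrict \<eta> W) = restrict (bracket A V \<xi> \<eta>) W"
  using sheaf[unfolded sheaf_bilinear_def, rule_format, OF sectionD(3)[OF assms(1)], THEN conjunct2, THEN conjunct2, THEN conjunct2]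
    assms by simp

text \<open>Directional derivatives are local and brackets commute with restriction.
  \<open>\<omega>\<close> is an arbitrary family since representatives of germs, to which this is
  applied, need not be forms. The case \<open>W = V\<close> serves to exchange a family of sections
  beyond index \<open>k\<close>.\<close>

lemma koszul_restrict:
  assumes W: "openin (mtop (base A)) W" "x \<in> W" "W \<subseteq> V" and \<xi>: "\<And>i. i \<le> k \<Longrightarrow> \<xi> i \<in> sections A V"
    and \<xi>': "\<And>i. i \<le> k \<Longrightarrow> \<xi>' i = restrict (\<xi> i) W"
    and \<omega>: "\<And>y. y \<in> W \<Longrightarrow> \<omega> y = \<omega>' y"
  shows "koszul A k W \<omega>' \<xi>' x = koszul A k V \<omega> \<xi> x"
proof -
  have eq: "map (\<lambda>l. \<xi>' l y) [l\<leftarrow>[0..<Suc k]. P l] = map (\<lambda>l. \<xi> l y) [l\<leftarrow>[0..<Suc k]. P l]" if "y \<in> W" for y P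
    using \<xi>' that by (intro map_cong) (auto simp: less_Suc_eq_le simp del: upt_Suc)
  show ?thesis
  proof (rule koszul_cong)
    fix j assume j: "j \<le> k"
    have f: "\<xi> j x \<in> fiber A x" using sectionD(2)[OF \<xi>[OF j]] W by auto
    interpret T: tangent_at "base A" "anchor A (\<xi> j x)" using anchor_fiber[OF f] by simp
    note e = anchor_fiber(2)[OF f]
    show "lie_term A k \<omega>' \<xi>' x j = lie_term A k \<omega> \<xi> x j"
      unfolding lie_term_def
    proof (rule T.lie_deriv_cong[unfolded e, OF W(1,2)])
      show "\<omega>' y (map (\<lambda>l. \<xi>' l y) [l\<leftarrow>[0..<Suc k]. l \<noteq> j]) = \<omega> y (map (\<lambda>l. \<xi> l y) [l\<leftarrow>[0..<Suc k]. l \<noteq> j])"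
        if "y \<in> W" for y
        by (simp only: eq[OF that] \<omega>[OF that])
    qed (use \<xi>'[OF j] W in auto)
  next
    fix i j assume ij: "i < j" "j \<le> k"
    then have "bracket A W (\<xi>' i) (\<xi>' j) x = bracket A V (\<xi> i) (\<xi> j) x"
      using bracket_restrict[OF \<xi> \<xi> W(1,3), of i j] \<xi>' W(2) by simp
    then show "bracket_term A k W \<omega>' \<xi>' x i j = bracket_term A k V \<omega> \<xi> x i j"
      unfolding bracket_term_def by (simp only: eq[OF W(2)] \<omega>[OF W(2)])
  qed
qed

text \<open>The two descriptions under \<open>THE\<close> are shown to be the same predicate, so the
  values agree even where no number satisfies it. In one direction sections over a smaller set are
  used as they are, in the other they are restricted.\<close>

lemma differential_local:
  assumes U': "openin (mtop (base A)) U'" "x \<in> U'" "U' \<subseteq> U" and \<omega>: "\<And>y. y \<in> U' \<Longrightarrow> \<omega> y = \<omega>' y"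
  shows "differential A k U \<omega> x vs = differential A k U' \<omega>' x vs"
proof -
  let ?P = "\<lambda>U \<omega> r. \<forall>V \<xi>. openin (mtop (base A)) V \<and> x \<in> V \<and> V \<subseteq> U \<and>
           (\<forall>i\<le>k. \<xi> i \<in> sections A V \<and> \<xi> i x = vs ! i) \<longrightarrow> koszul A k V \<omega> \<xi> x = r"
  have "?P U \<omega> r \<longleftrightarrow> ?P U' \<omega>' r" for r
  proof (intro iffI allI impI)
    fix V \<xi> assume P: "?P U \<omega> r" and V: "openin (mtop (base A)) V \<and> x \<in> V \<and> V \<subseteq> U' \<and>
           (\<forall>i\<le>k. \<xi> i \<in> sections A V \<and> \<xi> i x = vs ! i)"
    have "koszul A k V \<omega> \<xi> x = r" using P V U' by blast
    moreover have "koszul A k V \<omega>' \<xi> x = koszul A k V \<omega> \<xi> x"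
    proof (rule koszul_restrict)
      \<comment> \<open>Sections are extensional, so restricting them to their own domain changes
        nothing.\<close>
      show "\<xi> i = restrict (\<xi> i) V" if "i \<le> k" for i
        using V that by (auto simp: sections_def extensional_restrict)
    qed (use V \<omega> in auto)
    ultimately show "koszul A k V \<omega>' \<xi> x = r" by simp
  next
    fix V \<xi> assume P: "?P U' \<omega>' r" and V: "openin (mtop (base A)) V \<and> x \<in> V \<and> V \<subseteq> U \<and>
           (\<forall>i\<le>k. \<xi> i \<in> sections A V \<and> \<xi> i x = vs ! i)"
    let ?V = "V \<inter> U'" let ?\<xi> = "\<lambda>i. restrict (\<xi> i) ?V"
    have V': "openin (mtop (base A)) ?V" using V U' by auto
    have "koszul A k ?V \<omega>' ?\<xi> x = koszul A k V \<omega> \<xi> x"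
      by (rule koszul_restrict[OF V']) (use V U' \<omega> in auto)
    moreover have "\<forall>i\<le>k. ?\<xi> i \<in> sections A ?V \<and> ?\<xi> i x = vs ! i"
      using V U' by (auto intro: section_restrict[OF _ V'])
    then have "koszul A k ?V \<omega>' ?\<xi> x = r"
      using P[rule_format, of ?V ?\<xi>] V' V U' by auto
    ultimately show "koszul A k V \<omega> \<xi> x = r" by simp
  qed
  then have "(THE r. ?P U \<omega> r) = (THE r. ?P U' \<omega>' r)" by presburger
  then show ?thesis using U' by (auto simp: differential_def)
qed

text \<open>Existence of some system of sections through \<open>vs\<close> makes the description
  unique: without one, every number would satisfy it.\<close>

lemma differential_eqI:
  assumes U: "openin (mtop (base A)) U" "x \<in> U" and vs: "vs \<in> args A (Suc k) x"
    and eq: "\<And>V \<xi>. openin (mtop (base A)) V \<Longrightarrow> x \<in> V \<Longrightarrow> V \<subseteq> U \<Longrightarrow> (\<And>i. i \<le> k \<Longrightarrow> \<xi> i \<in> sections A V) \<Longrightarrow>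
      (\<And>i. i \<le> k \<Longrightarrow> \<xi> i x = vs ! i) \<Longrightarrow> koszul A k V \<omega> \<xi> x = r"
  shows "differential A k U \<omega> x vs = r"
proof -
  have vs': "set vs \<subseteq> fiber A x" "length vs = Suc k" using vs by (auto simp: args_def)
  obtain V \<xi> where "openin (mtop (base A)) V" "x \<in> V" "V \<subseteq> U"
    "\<And>i. i < Suc k \<Longrightarrow> \<xi> i \<in> sections A V" "\<And>i. i < Suc k \<Longrightarrow> \<xi> i x = vs ! i"
    using ex_sections[OF U(2,1) vs'(1)] unfolding vs'(2) by blast
  then have V: "openin (mtop (base A)) V \<and> x \<in> V \<and> V \<subseteq> U \<and> (\<forall>i\<le>k. \<xi> i \<in> sections A V \<and> \<xi> i x = vs ! i)"
    by (auto simp: less_Suc_eq_le)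
  have "(THE r. \<forall>V \<xi>. openin (mtop (base A)) V \<and> x \<in> V \<and> V \<subseteq> U \<and>
           (\<forall>i\<le>k. \<xi> i \<in> sections A V \<and> \<xi> i x = vs ! i) \<longrightarrow> koszul A k V \<omega> \<xi> x = r) = r"
  proof (rule the_equality)
    show "\<forall>V \<xi>. openin (mtop (base A)) V \<and> x \<in> V \<and> V \<subseteq> U \<and>
           (\<forall>i\<le>k. \<xi> i \<in> sections A V \<and> \<xi> i x = vs ! i) \<longrightarrow> koszul A k V \<omega> \<xi> x = r"
      using eq by simp
  next
    fix s assume "\<forall>V \<xi>. openin (mtop (base A)) V \<and> x \<in> V \<and> V \<subseteq> U \<and>
           (\<forall>i\<le>k. \<xi> i \<in> sections A V \<and> \<xi> i x = vs ! i) \<longrightarrow> koszul A k V \<omega> \<xi> x = s"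
    then have "koszul A k V \<omega> \<xi> x = s" using V by blast
    moreover have "koszul A k V \<omega> \<xi> x = r" using eq V by simp
    ultimately show "s = r" by simp
  qed
  then show ?thesis using U vs by (simp add: differential_def)
qed

end

section \<open>Independence of the Koszul formula from the chosen sections\<close>

locale trivialized_algebroid = algebroid_loc + trivialized A \<phi> for \<phi>
begin

text \<open>Only the linearity and continuity of $\omega$ enter: at \<open>x\<close> the difference quotient of
  $\omega(\dots, \xi - \zeta, \dots)$ is $\omega(\dots, (\xi - \zeta)/t, \dots)$.\<close>

lemma lie_deriv_form_diff:
  assumes \<omega>: "\<omega> \<in> forms A k U" "k > 0" and U: "openin (mtop (base A)) U" "tdom \<phi> \<subseteq> U" and x: "x \<in> tdom \<phi>"
    and \<xi>: "\<And>i. i \<in> set ls \<Longrightarrow> \<xi> i \<in> sections A (tdom \<phi>)" and \<zeta>: "\<zeta> \<in> sections A (tdom \<phi>)" "\<zeta> x = \<xi> i0 x"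
    and ls: "ls = P @ i0 # Q" "i0 \<notin> set P" "i0 \<notin> set Q" "length ls = k"
    and X: "tangent_at (base A) (Y x)" "fst (Y x) = x"
  defines "d \<equiv> lie_deriv (base A) (tfib \<phi>) Y (sec_rep \<phi> (\<xi> i0)) x - lie_deriv (base A) (tfib \<phi>) Y (sec_rep \<phi> \<zeta>) x"
  shows "lie_deriv (base A) euclideanreal Y (\<lambda>y. \<omega> y (map (\<lambda>l. \<xi> l y) ls)) x
    - lie_deriv (base A) euclideanreal Y (\<lambda>y. \<omega> y (map (\<lambda>l. (\<xi>(i0 := \<zeta>)) l y) ls)) x
    = \<omega> x (map (\<lambda>l. \<xi> l x) P @ vec x d # map (\<lambda>l. \<xi> l x) Q)"
    and "d \<in> topspace (tfib \<phi>)"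
proof -
  interpret T: tangent_at "base A" "Y x" using X by simp
  let ?c = "curve (base A) (Y x)"
  let ?h = "\<lambda>y. \<omega> y (map (\<lambda>l. \<xi> l y) ls)" and ?h' = "\<lambda>y. \<omega> y (map (\<lambda>l. (\<xi>(i0 := \<zeta>)) l y) ls)"
  have i0: "i0 \<in> set ls" using ls by simp
  have \<xi>': "(\<xi>(i0 := \<zeta>)) l \<in> sections A (tdom \<phi>)" if "l \<in> set ls" for l using \<xi>[OF that] \<zeta> by simp
  have cx: "limitin (mtop (base A)) ?c x (at 0)" using T.curve_limit by (simp add: X)
  have cev: "\<forall>\<^sub>F t in at 0. ?c t \<in> tdom \<phi>" using T.curve_eventually[OF dom_open] x X by simp
  have h: "smooth_map_on (base A) (tdom \<phi>) (lcs_mfd euclideanreal) ?h"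
    by (rule form_eval_smooth[OF \<omega>(1) dom_open U(2) order_refl \<xi> ls(4)])
  have h': "smooth_map_on (base A) (tdom \<phi>) (lcs_mfd euclideanreal) ?h'"
    by (rule form_eval_smooth[OF \<omega>(1) dom_open U(2) order_refl \<xi>' ls(4)])
  have s: "smooth_map_on (base A) (tdom \<phi>) (lcs_mfd (tfib \<phi>)) (sec_rep \<phi> \<eta>)" if "\<eta> \<in> sections A (tdom \<phi>)" for \<eta>
    unfolding sec_rep_eq by (rule section_rep_smooth[OF that]) simp
  \<comment> \<open>Hence the constant terms of the two difference quotients cancel and their
    difference is \<open>(?h (?c t) - ?h' (?c t)) / t\<close>.\<close>
  have hx: "?h x = ?h' x" using \<zeta>(2) by (intro arg_cong[of _ _ "\<omega> x"] map_cong) auto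
  note lim = T.lie_deriv_limit[where Y = Y, unfolded X(2), OF _ _ x refl]
  have lh: "limitin euclideanreal (\<lambda>t. (1 / t) *\<^sub>R (?h (?c t) - ?h x) - (1 / t) *\<^sub>R (?h' (?c t) - ?h' x))
     (lie_deriv (base A) euclideanreal Y ?h x - lie_deriv (base A) euclideanreal Y ?h' x) (at 0)"
    by (intro limitin_diff[OF lcs_real] lim[OF h lcs_real] lim[OF h' lcs_real])
  have ld: "limitin (tfib \<phi>) (\<lambda>t. (1 / t) *\<^sub>R (sec_rep \<phi> (\<xi> i0) (?c t) - sec_rep \<phi> (\<xi> i0) x)
      - (1 / t) *\<^sub>R (sec_rep \<phi> \<zeta> (?c t) - sec_rep \<phi> \<zeta> x)) d (at 0)"
    unfolding d_def by (intro limitin_diff[OF lcs_fib] lim[OF s[OF \<xi>[OF i0]] lcs_fib] lim[OF s[OF \<zeta>(1)] lcs_fib])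
  then show "d \<in> topspace (tfib \<phi>)" by (rule limitin_topspace)
  \<comment> \<open>Slot \<open>i0\<close> carries the quotient of the difference of the two
    sections. They agree at \<open>x\<close>, so it tends to the difference \<open>d\<close> of
    their derivatives; the other slots merely follow the curve.\<close>
  define u where "u l t = (if l = i0 then (1 / t) *\<^sub>R (rep (\<xi> i0 (?c t)) - rep (\<zeta> (?c t))) else rep (\<xi> l (?c t)))" for l t
  have lu: "limitin (tfib \<phi>) (u l) (if l = i0 then d else rep (\<xi> l x)) (at 0)" if l: "l \<in> set ls" for l
  proof (cases "l = i0")
    case True
    have "(1 / t) *\<^sub>R (sec_rep \<phi> (\<xi> i0) (?c t) - sec_rep \<phi> (\<xi> i0) x)
      - (1 / t) *\<^sub>R (sec_rep \<phi> \<zeta> (?c t) - sec_rep \<phi> \<zeta> x) = u i0 t" for t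
      using \<zeta>(2) by (simp add: u_def sec_rep_eq algebra_simps)
    then show ?thesis using ld True by simp
  next
    case False
    have "continuous_map (subtopology (mtop (base A)) (tdom \<phi>)) (tfib \<phi>) (\<lambda>x. rep (\<xi> l x))"
      using smooth_cont[OF section_rep_smooth[OF \<xi>[OF l]]] by (simp add: lcs_mfd_def)
    moreover have "limitin (subtopology (mtop (base A)) (tdom \<phi>)) ?c x (at 0)"
      using cx cev x by (simp add: limitin_subtopology)
    ultimately have "limitin (tfib \<phi>) (\<lambda>t. rep (\<xi> l (?c t))) (rep (\<xi> l x)) (at 0)" by (rule limitin_map)
    moreover have "u l = (\<lambda>t. rep (\<xi> l (?c t)))" using False by (simp add: u_def fun_eq_iff)
    ultimately show ?thesis using False by simp
  qed
  have "((\<lambda>t. \<omega> (?c t) (map (\<lambda>l. vec (?c t) (u l t)) ls)) \<longlongrightarrow> \<omega> x (map (\<lambda>l. vec x (if l = i0 then d else rep (\<xi> l x))) ls)) (at 0)"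
    using x U(2) by (intro form_limit[OF \<omega> _ x U(1) cx lu ls(4)]) auto
  moreover have vP: "map (\<lambda>l. vec y (if l = i0 then g else rep (\<xi> l y))) ls = map (\<lambda>l. \<xi> l y) P @ vec y g # map (\<lambda>l. \<xi> l y) Q"
    if y: "y \<in> tdom \<phi>" for y g
  proof -
    have "vec y (rep (\<xi> l y)) = \<xi> l y" if "l \<in> set ls" for l using vec_rep[OF y sectionD(2)[OF \<xi>[OF that] y]] .
    then show ?thesis using ls by (auto intro!: map_cong)
  qed
  moreover have "\<forall>\<^sub>F t in at 0. \<omega> (?c t) (map (\<lambda>l. vec (?c t) (u l t)) ls)
      = (1 / t) *\<^sub>R (?h (?c t) - ?h x) - (1 / t) *\<^sub>R (?h' (?c t) - ?h' x)"
    using cev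
  proof eventually_elim
    case (elim t)
    let ?y = "?c t"
    have f: "\<xi> l ?y \<in> fiber A ?y" if "l \<in> set ls" for l using sectionD(2)[OF \<xi>[OF that] elim] .
    have z: "\<zeta> ?y \<in> fiber A ?y" using sectionD(2)[OF \<zeta>(1) elim] .
    let ?P = "map (\<lambda>l. \<xi> l ?y) P" and ?Q = "map (\<lambda>l. \<xi> l ?y) Q"
    have "map (\<lambda>l. vec ?y (u l t)) ls = ?P @ vec ?y ((1 / t) *\<^sub>R (rep (\<xi> i0 ?y) - rep (\<zeta> ?y))) # ?Q"
      using vP[OF elim, of "(1 / t) *\<^sub>R (rep (\<xi> i0 ?y) - rep (\<zeta> ?y))"] by (simp add: u_def)
    moreover have "\<omega> ?y (?P @ vec ?y ((1 / t) *\<^sub>R (rep (\<xi> i0 ?y) - rep (\<zeta> ?y))) # ?Q)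
        = (1 / t) * (\<omega> ?y (?P @ vec ?y (rep (\<xi> i0 ?y)) # ?Q) - \<omega> ?y (?P @ vec ?y (rep (\<zeta> ?y)) # ?Q))"
      by (rule form_rep_diff[OF forms_fiber[OF \<omega>] elim rep_topspace[OF elim f[OF i0]] rep_topspace[OF elim z]])
         (use elim U(2) f ls in auto)
    ultimately have "\<omega> ?y (map (\<lambda>l. vec ?y (u l t)) ls) = (1 / t) * (\<omega> ?y (?P @ vec ?y (rep (\<xi> i0 ?y)) # ?Q) - \<omega> ?y (?P @ vec ?y (rep (\<zeta> ?y)) # ?Q))"
      by (simp only:)
    also have "\<dots> = (1 / t) * (\<omega> ?y (?P @ \<xi> i0 ?y # ?Q) - \<omega> ?y (?P @ \<zeta> ?y # ?Q))"
      using vec_rep[OF elim f[OF i0]] vec_rep[OF elim z] by simp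
    also have "?P @ \<xi> i0 ?y # ?Q = map (\<lambda>l. \<xi> l ?y) ls" using ls by simp
    also have "?P @ \<zeta> ?y # ?Q = map (\<lambda>l. (\<xi>(i0 := \<zeta>)) l ?y) ls" using ls by (auto intro!: map_cong)
    finally show ?case using hx by (simp add: algebra_simps)
  qed
  ultimately have "((\<lambda>t. (1 / t) *\<^sub>R (?h (?c t) - ?h x) - (1 / t) *\<^sub>R (?h' (?c t) - ?h' x)) \<longlongrightarrow>
      \<omega> x (map (\<lambda>l. \<xi> l x) P @ vec x d # map (\<lambda>l. \<xi> l x) Q)) (at 0)"
    using vP[OF x, of d] by (simp only: Lim_transform_eventually)
  with lh show "lie_deriv (base A) euclideanreal Y ?h x - lie_deriv (base A) euclideanreal Y ?h' x
    = \<omega> x (map (\<lambda>l. \<xi> l x) P @ vec x d # map (\<lambda>l. \<xi> l x) Q)"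
    by (simp only: limitin_canonical_iff) (rule tendsto_unique[OF at_neq_bot])
qed

text \<open>With \<open>w j\<close> the value of \<omega> on \<open>d j\<close> followed by the
  untouched arguments, the Lie term of \<open>j \<noteq> i0\<close> changes by \<open>w j\<close> up
  to the sign of moving slot \<open>i0\<close> to the front, and the bracket term of the pair
  \<open>{i0, j}\<close> by plus or minus \<open>w j\<close>. With the signs of the Koszul formula
  these changes cancel for each \<open>j\<close> separately.\<close>

lemma koszul_step:
  assumes \<omega>: "\<omega> \<in> forms A k U" and U: "openin (mtop (base A)) U" "tdom \<phi> \<subseteq> U" and x: "x \<in> tdom \<phi>"
    and \<xi>: "\<And>i. i \<le> k \<Longrightarrow> \<xi> i \<in> sections A (tdom \<phi>)" and \<zeta>: "\<zeta> \<in> sections A (tdom \<phi>)" "\<zeta> x = \<xi> i0 x" and i0: "i0 \<le> k"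
  shows "koszul A k (tdom \<phi>) \<omega> (\<xi>(i0 := \<zeta>)) x = koszul A k (tdom \<phi>) \<omega> \<xi> x"
proof -
  let ?V = "tdom \<phi>" and ?\<xi> = "\<xi>(i0 := \<zeta>)"
  define d where "d j = lie_deriv (base A) (tfib \<phi>) (anchor A \<circ> \<xi> j) (sec_rep \<phi> (\<xi> i0)) x
    - lie_deriv (base A) (tfib \<phi>) (anchor A \<circ> \<xi> j) (sec_rep \<phi> \<zeta>) x" for j
  define w where "w j = \<omega> x (vec x (d j) # map (\<lambda>l. \<xi> l x) [l\<leftarrow>[0..<Suc k]. l \<noteq> i0 \<and> l \<noteq> j])" for j
  let ?L = "\<lambda>\<xi>. lie_term A k \<omega> \<xi> x" and ?b = "\<lambda>\<xi>. bracket_term A k ?V \<omega> \<xi> x"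
  have f: "\<xi> i x \<in> fiber A x" if "i \<le> k" for i using sectionD(2)[OF \<xi>[OF that] x] .
  have T: "tangent_at (base A) ((anchor A \<circ> \<xi> j) x)" "fst ((anchor A \<circ> \<xi> j) x) = x" if "j \<le> k" for j
    using anchor_fiber[OF f[OF that]] by simp_all
  have val: "?\<xi> l x = \<xi> l x" for l using \<zeta>(2) by simp
  have ff: "fiber_form A k x (\<omega> x)" if "k > 0" using forms_fiber[OF \<omega> that] x U(2) by auto
  have sub: "set (map (\<lambda>l. \<xi> l x) [l\<leftarrow>[m..<n]. P l]) \<subseteq> fiber A x" if "n \<le> Suc k" for m n P
    using f that by auto
  have lists: "set [l\<leftarrow>[0..<Suc k]. l \<noteq> j] \<subseteq> {..k}" for j by (auto simp del: upt_Suc)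
  have Ld: "?L \<xi> j - ?L ?\<xi> j = (-1) ^ (if j < i0 then i0 - 1 else i0) * w j" and dtop: "d j \<in> topspace (tfib \<phi>)"
    if j: "j \<le> k" "j \<noteq> i0" for j
  proof -
    have k: "k > 0" using i0 j by auto
    let ?ls = "[l\<leftarrow>[0..<Suc k]. l \<noteq> j]" and ?P = "[l\<leftarrow>[0..<i0]. l \<noteq> j]" and ?Q = "[l\<leftarrow>[Suc i0..<Suc k]. l \<noteq> j]"
    have ls: "?ls = ?P @ i0 # ?Q" using filter_upt_split(1)[of i0 k j] i0 j by simp
    have len: "length ?ls = k" using length_filter_upt[where i = "Suc k" and j = j] j by simp
    have sec: "\<xi> i \<in> sections A ?V" if "i \<in> set ?ls" for i
    proof -
      have "i \<le> k" using that lists by blast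
      then show ?thesis by (rule \<xi>)
    qed
    have ni: "i0 \<notin> set ?P" "i0 \<notin> set ?Q" by auto
    note dd = lie_deriv_form_diff[where Y = "anchor A \<circ> \<xi> j" and \<xi> = \<xi> and ?i0.0 = i0 and x = x, OF \<omega> k U x sec \<zeta> ls ni len T[OF j(1)], folded d_def]
    show "d j \<in> topspace (tfib \<phi>)" by (rule dd(2))
    then have df: "vec x (d j) \<in> fiber A x" by (rule vec_fiber[OF x])
    have "?L \<xi> j - ?L ?\<xi> j = \<omega> x (map (\<lambda>l. \<xi> l x) ?P @ vec x (d j) # map (\<lambda>l. \<xi> l x) ?Q)"
      using dd(1) j unfolding lie_term_def by simp
    also have "\<dots> = (-1) ^ length (map (\<lambda>l. \<xi> l x) ?P) * \<omega> x (vec x (d j) # map (\<lambda>l. \<xi> l x) ?P @ map (\<lambda>l. \<xi> l x) ?Q)"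
    proof (rule form_move[OF ff[OF k] dom_pts[OF x] _ _ df])
      show "set (map (\<lambda>l. \<xi> l x) ?P) \<subseteq> fiber A x" using i0 by (intro sub) simp
      show "set (map (\<lambda>l. \<xi> l x) ?Q) \<subseteq> fiber A x" by (rule sub) simp
      show "length (map (\<lambda>l. \<xi> l x) ?P) + Suc (length (map (\<lambda>l. \<xi> l x) ?Q)) = k"
        using arg_cong[OF ls, of length] len by (simp del: upt_Suc)
    qed
    also have "map (\<lambda>l. \<xi> l x) ?P @ map (\<lambda>l. \<xi> l x) ?Q = map (\<lambda>l. \<xi> l x) [l\<leftarrow>[0..<Suc k]. l \<noteq> i0 \<and> l \<noteq> j]"
      using filter_upt_split(2)[of i0 k j] i0 j by (simp del: upt_Suc)
    finally show "?L \<xi> j - ?L ?\<xi> j = (-1) ^ (if j < i0 then i0 - 1 else i0) * w j"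
      by (simp only: length_map length_filter_upt w_def)
  qed
  \<comment> \<open>Here the exchanged section enters only as direction of differentiation, through
    its value at \<open>x\<close>.\<close>
  have Li0: "?L ?\<xi> i0 = ?L \<xi> i0"
  proof -
    have e: "map (\<lambda>l. ?\<xi> l y) [l\<leftarrow>[0..<Suc k]. l \<noteq> i0] = map (\<lambda>l. \<xi> l y) [l\<leftarrow>[0..<Suc k]. l \<noteq> i0]" for y
      by (intro map_cong) (auto simp del: upt_Suc)
    show ?thesis unfolding lie_term_def e by (rule lie_deriv_pointwise) (simp add: \<zeta>(2))
  qed
  obtain C where C: "\<And>\<xi> \<eta> y. \<xi> \<in> sections A ?V \<Longrightarrow> \<eta> \<in> sections A ?V \<Longrightarrow> y \<in> ?V \<Longrightarrow>
              sec_rep \<phi> (bracket A ?V \<xi> \<eta>) y =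
                lie_deriv (base A) (tfib \<phi>) (anchor A \<circ> \<xi>) (sec_rep \<phi> \<eta>) y
                - lie_deriv (base A) (tfib \<phi>) (anchor A \<circ> \<eta>) (sec_rep \<phi> \<xi>) y
                + C y (sec_rep \<phi> \<xi> y) (sec_rep \<phi> \<eta> y)"
    using first_order lt unfolding first_order_def by metis
  have lp: "lie_deriv (base A) (tfib \<phi>) (anchor A \<circ> \<zeta>) h x = lie_deriv (base A) (tfib \<phi>) (anchor A \<circ> \<xi> i0) h x" for h
    by (rule lie_deriv_pointwise) (simp add: \<zeta>(2))
  have rz: "sec_rep \<phi> \<zeta> x = sec_rep \<phi> (\<xi> i0) x" by (simp add: sec_rep_eq \<zeta>(2))
  \<comment> \<open>In the first-order formula the \<open>C\<close> terms and the derivatives in the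
    direction of the exchanged section depend only on its value at \<open>x\<close> and cancel; the
    derivatives of its own representative remain.\<close>
  have r1: "rep (bracket A ?V (\<xi> i0) (\<xi> j) x) - rep (bracket A ?V \<zeta> (\<xi> j) x) = - d j" if "j \<le> k" for j
    using C[OF \<xi>[OF i0] \<xi>[OF that] x] C[OF \<zeta>(1) \<xi>[OF that] x] by (simp add: sec_rep_eq[of \<phi> "bracket A ?V _ _"] lp rz d_def)
  have r2: "rep (bracket A ?V (\<xi> j) (\<xi> i0) x) - rep (bracket A ?V (\<xi> j) \<zeta> x) = d j" if "j \<le> k" for j
    using C[OF \<xi>[OF that] \<xi>[OF i0] x] C[OF \<xi>[OF that] \<zeta>(1) x] by (simp add: sec_rep_eq[of \<phi> "bracket A ?V _ _"] lp rz d_def)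
  have mv: "map (\<lambda>l. ?\<xi> l x) ls = map (\<lambda>l. \<xi> l x) ls" for ls using val by (intro map_cong) auto
  have om: "\<omega> x (a # R) - \<omega> x (a' # R) = \<omega> x (vec x (rep a - rep a') # R)"
    if "a \<in> fiber A x" "a' \<in> fiber A x" "set R \<subseteq> fiber A x" "Suc (length R) = k" for a a' R
    using form_rep_diff[OF ff x rep_topspace[OF x that(1)] rep_topspace[OF x that(2)], of "[]" R 1]
      vec_rep[OF x that(1)] vec_rep[OF x that(2)] that by force
  have bf: "bracket A ?V \<eta> \<theta> x \<in> fiber A x" if "\<eta> \<in> sections A ?V" "\<theta> \<in> sections A ?V" for \<eta> \<theta>
    using sectionD(2)[OF bracket_section[OF that] x] .
  have Rsub: "set (map (\<lambda>l. \<xi> l x) [l\<leftarrow>[0..<Suc k]. l \<noteq> i0 \<and> l \<noteq> j]) \<subseteq> fiber A x" for j by (rule sub) simp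
  have Rlen: "Suc (length (map (\<lambda>l. \<xi> l x) [l\<leftarrow>[0..<Suc k]. l \<noteq> i0 \<and> l \<noteq> j])) = k" if "j \<le> k" "j \<noteq> i0" for j
  proof -
    have "k > 0" using that i0 by auto
    then show ?thesis using length_filter_upt2[OF i0 that(1)] that by (simp del: upt_Suc)
  qed
  have b1: "?b \<xi> i0 j - ?b ?\<xi> i0 j = - w j" if j: "j \<le> k" "j \<noteq> i0" for j
  proof -
    have "?b \<xi> i0 j - ?b ?\<xi> i0 j = \<omega> x (vec x (- d j) # map (\<lambda>l. \<xi> l x) [l\<leftarrow>[0..<Suc k]. l \<noteq> i0 \<and> l \<noteq> j])"
      using om[OF bf[OF \<xi>[OF i0] \<xi>[OF j(1)]] bf[OF \<zeta>(1) \<xi>[OF j(1)]] Rsub Rlen[OF j]] r1[OF j(1)] j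
      unfolding bracket_term_def mv by (simp del: upt_Suc)
    also have "vec x (- d j) = vscale A (-1) (vec x (d j))" using vec_scale[OF x dtop[OF j], of "-1"] by simp
    finally have e: "?b \<xi> i0 j - ?b ?\<xi> i0 j = \<omega> x (vscale A (-1) (vec x (d j)) # map (\<lambda>l. \<xi> l x) [l\<leftarrow>[0..<Suc k]. l \<noteq> i0 \<and> l \<noteq> j])" .
    have k: "k > 0" using i0 j by auto
    have "\<omega> x ([] @ vscale A (-1) (vec x (d j)) # map (\<lambda>l. \<xi> l x) [l\<leftarrow>[0..<Suc k]. l \<noteq> i0 \<and> l \<noteq> j]) =
      - 1 * \<omega> x ([] @ vec x (d j) # map (\<lambda>l. \<xi> l x) [l\<leftarrow>[0..<Suc k]. l \<noteq> i0 \<and> l \<noteq> j])"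
      by (rule form_vscale[OF ff[OF k] dom_pts[OF x] _ Rsub vec_fiber[OF x dtop[OF j]]])
         (use Rlen[OF j] in \<open>simp_all del: upt_Suc\<close>)
    then show ?thesis unfolding e w_def by (simp del: upt_Suc)
  qed
  have b2: "?b \<xi> j i0 - ?b ?\<xi> j i0 = w j" if j: "j \<le> k" "j \<noteq> i0" for j
  proof -
    have c: "[l\<leftarrow>[0..<Suc k]. l \<noteq> j \<and> l \<noteq> i0] = [l\<leftarrow>[0..<Suc k]. l \<noteq> i0 \<and> l \<noteq> j]" by (rule filter_cong) auto
    show ?thesis
      using om[OF bf[OF \<xi>[OF j(1)] \<xi>[OF i0]] bf[OF \<xi>[OF j(1)] \<zeta>(1)] Rsub Rlen[OF j]] r2[OF j(1)] j
      unfolding bracket_term_def mv c w_def by (simp del: upt_Suc)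
  qed
  have b0: "?b \<xi> i j - ?b ?\<xi> i j = 0" if "i \<noteq> i0" "j \<noteq> i0" for i j
    using that unfolding bracket_term_def mv by simp
  have "koszul A k ?V \<omega> \<xi> x - koszul A k ?V \<omega> ?\<xi> x =
      (\<Sum>j\<le>k. (-1) ^ j * (?L \<xi> j - ?L ?\<xi> j)) + (\<Sum>(i, j) | i < j \<and> j \<le> k. (-1) ^ (i + j) * (?b \<xi> i j - ?b ?\<xi> i j))"
    unfolding koszul_terms by (simp add: case_prod_unfold right_diff_distrib sum_subtractf)
  also have "\<dots> = (\<Sum>j<i0. (-1) ^ j * (?L \<xi> j - ?L ?\<xi> j) + (-1) ^ (j + i0) * (?b \<xi> j i0 - ?b ?\<xi> j i0))
      + (\<Sum>j\<in>{i0<..k}. (-1) ^ j * (?L \<xi> j - ?L ?\<xi> j) + (-1) ^ (i0 + j) * (?b \<xi> i0 j - ?b ?\<xi> i0 j))"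
    using sum_pairs_through[OF i0, of "\<lambda>i j. (-1) ^ (i + j) * (?b \<xi> i j - ?b ?\<xi> i j)"] b0
      sum_atMost_split[OF i0, of "\<lambda>j. (-1) ^ j * (?L \<xi> j - ?L ?\<xi> j)"] Li0
    by (simp add: sum.distrib)
  also have "\<dots> = 0"
  proof -
    have "(-1) ^ j * (?L \<xi> j - ?L ?\<xi> j) + (-1) ^ (j + i0) * (?b \<xi> j i0 - ?b ?\<xi> j i0) = 0" if "j < i0" for j
    proof -
      \<comment> \<open>Removes the truncated subtraction from the exponent: the signs are those of
        \<open>j + m\<close> and \<open>j + m + 1\<close>.\<close>
      have "i0 = Suc (i0 - 1)" using that by simp
      then obtain m where m: "i0 = Suc m" by blast
      show ?thesis using that Ld[of j] b2[of j] i0 by (simp add: m power_add)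
    qed
    moreover have "(-1) ^ j * (?L \<xi> j - ?L ?\<xi> j) + (-1) ^ (i0 + j) * (?b \<xi> i0 j - ?b ?\<xi> i0 j) = 0" if "j \<in> {i0<..k}" for j
      using that Ld[of j] b1[of j] by (simp add: power_add)
    ultimately show ?thesis by simp
  qed
  finally show ?thesis by simp
qed

text \<open>The sections are exchanged one index at a time by \<open>koszul_step\<close>.\<close>

lemma koszul_unique:
  assumes \<omega>: "\<omega> \<in> forms A k U" and U: "openin (mtop (base A)) U" "tdom \<phi> \<subseteq> U" and x: "x \<in> tdom \<phi>"
    and \<xi>: "\<And>i. i \<le> k \<Longrightarrow> \<xi> i \<in> sections A (tdom \<phi>)" and \<zeta>: "\<And>i. i \<le> k \<Longrightarrow> \<zeta> i \<in> sections A (tdom \<phi>)"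
    and eq: "\<And>i. i \<le> k \<Longrightarrow> \<zeta> i x = \<xi> i x"
  shows "koszul A k (tdom \<phi>) \<omega> \<zeta> x = koszul A k (tdom \<phi>) \<omega> \<xi> x"
proof -
  let ?h = "\<lambda>n i. if i < n then \<zeta> i else \<xi> i"
  have "koszul A k (tdom \<phi>) \<omega> (?h n) x = koszul A k (tdom \<phi>) \<omega> \<xi> x" if "n \<le> Suc k" for n
    using that
  proof (induction n)
    case (Suc n)
    have "?h (Suc n) = (?h n)(n := \<zeta> n)" by (auto simp: less_Suc_eq)
    moreover have "koszul A k (tdom \<phi>) \<omega> ((?h n)(n := \<zeta> n)) x = koszul A k (tdom \<phi>) \<omega> (?h n) x"
      using Suc.prems by (intro koszul_step[OF \<omega> U x]) (auto simp: \<xi> \<zeta> eq)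
    ultimately show ?case using Suc by simp
  qed simp
  from this[of "Suc k"] have "koszul A k (tdom \<phi>) \<omega> (?h (Suc k)) x = koszul A k (tdom \<phi>) \<omega> \<xi> x" by simp
  \<comment> \<open>The last hybrid agrees with \<zeta> only up to index \<open>k\<close>; the
    Koszul formula reads no further.\<close>
  moreover have "koszul A k (tdom \<phi>) \<omega> (?h (Suc k)) x = koszul A k (tdom \<phi>) \<omega> \<zeta> x"
    by (rule koszul_restrict[OF dom_open x order_refl])
       (use \<zeta> in \<open>auto simp: less_Suc_eq_le sections_def extensional_restrict\<close>)
  ultimately show ?thesis by simp
qed

end

context algebroid_loc
begin

text \<open>Any two systems of sections through the same vectors are restricted to a common set
  inside one trivialization, where \<open>koszul_unique\<close> compares them.\<close>

lemma differential_form: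
  assumes \<omega>: "\<omega> \<in> forms A k U" and V: "openin (mtop (base A)) V" "x \<in> V" "V \<subseteq> U" and U: "openin (mtop (base A)) U"
    and \<xi>: "\<And>i. i \<le> k \<Longrightarrow> \<xi> i \<in> sections A V" and vs: "vs = map (\<lambda>i. \<xi> i x) [0..<Suc k]"
  shows "differential A k U \<omega> x vs = koszul A k V \<omega> \<xi> x"
proof (rule differential_eqI[OF U])
  show "x \<in> U" using V by auto
  show "vs \<in> args A (Suc k) x" using sectionD(2)[OF \<xi> V(2)] unfolding vs args_def by (auto simp: less_Suc_eq_le simp del: upt_Suc)
  fix W \<zeta> assume W: "openin (mtop (base A)) W" "x \<in> W" "W \<subseteq> U" and \<zeta>: "\<And>i. i \<le> k \<Longrightarrow> \<zeta> i \<in> sections A W"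
    and eq: "\<And>i. i \<le> k \<Longrightarrow> \<zeta> i x = vs ! i"
  have "x \<in> pts (base A)" using V(2) openin_subset[OF V(1)] by auto
  then obtain \<phi> where \<phi>: "local_trivialization A \<phi>" "x \<in> tdom \<phi>" by (rule ex_trivialization)
  let ?T = "V \<inter> W \<inter> tdom \<phi>"
  have T: "openin (mtop (base A)) ?T" "x \<in> ?T" using V W \<phi> by (auto simp: local_trivialization_def)
  \<comment> \<open>The trivialization is shrunk so that its domain is exactly the common domain of
    the restricted sections.\<close>
  interpret trivialized_algebroid A "\<phi>\<lparr>tdom := ?T\<rparr>"
    using local_trivialization_restrict[OF \<phi>(1) T(1)] by unfold_locales auto
  have "koszul A k W \<omega> \<zeta> x = koszul A k ?T \<omega> (\<lambda>i. restrict (\<zeta> i) ?T) x"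
    by (rule koszul_restrict[OF T, symmetric]) (use \<zeta> in auto)
  also have "\<dots> = koszul A k ?T \<omega> (\<lambda>i. restrict (\<xi> i) ?T) x"
  proof (rule koszul_unique[simplified, OF \<omega> U])
    show "restrict (\<xi> i) ?T \<in> sections A ?T" if "i \<le> k" for i
      by (rule section_restrict[OF \<xi>[OF that] T(1)]) auto
    show "restrict (\<zeta> i) ?T \<in> sections A ?T" if "i \<le> k" for i
      by (rule section_restrict[OF \<zeta>[OF that] T(1)]) auto
    show "restrict (\<zeta> i) ?T x = restrict (\<xi> i) ?T x" if "i \<le> k" for i
      using T(2) eq[OF that] that unfolding vs by (simp add: less_Suc_eq_le del: upt_Suc)
  qed (use V T in auto)
  also have "\<dots> = koszul A k V \<omega> \<xi> x"
    by (rule koszul_restrict[OF T]) (use \<xi> in auto)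
  finally show "koszul A k W \<omega> \<zeta> x = koszul A k V \<omega> \<xi> x" .
qed

end

section \<open>Morphisms\<close>

text \<open>A continuous linear functional commutes with difference quotients and with their
  limit.\<close>

lemma (in tangent_at) lie_deriv_functional:
  assumes h: "smooth_map_on M U (lcs_mfd E) h" and E: "lcs E" and xU: "x \<in> U" and Y: "Y x = X"
    and l: "cont_functional E l"
  shows "lie_deriv M euclideanreal Y (\<lambda>y. l (h y)) x = l (lie_deriv M E Y h x)"
proof (rule lie_derivI[where Y = Y, OF lcs_real Y])
  have hU: "h y \<in> topspace E" if "y \<in> U" for y using smooth_maps[OF h that] by (simp add: lcs_mfd_def)
  have add: "l (a + b) = l a + l b" and scale: "l (r *\<^sub>R a) = r * l a"
    if "a \<in> topspace E" "b \<in> topspace E" for a b r using l that by (auto simp: cont_functional_def)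
  have "limitin euclideanreal (\<lambda>t. l ((1 / t) *\<^sub>R (h (curve M X t) - h x))) (l (lie_deriv M E Y h x)) (at 0)"
    by (rule limitin_map[OF _ lie_deriv_limit[where Y = Y, OF h E xU Y]]) (use l in \<open>simp add: cont_functional_def\<close>)
  moreover have "\<forall>\<^sub>F t in at 0. l ((1 / t) *\<^sub>R (h (curve M X t) - h x)) = (1 / t) *\<^sub>R (l (h (curve M X t)) - l (h x))"
    using curve_eventually[OF smooth_openin[OF h] xU]
  proof eventually_elim
    case (elim t)
    let ?a = "h (curve M X t)" and ?b = "h x"
    have ab: "?a \<in> topspace E" "?b \<in> topspace E" "?a - ?b \<in> topspace E"
      using hU elim xU lcs_topspace[OF E] by auto
    have "l ((?a - ?b) + ?b) = l (?a - ?b) + l ?b" by (rule add[OF ab(3,2)])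
    then show ?case using scale[OF ab(3,2)] by simp
  qed
  ultimately show "limitin euclideanreal (\<lambda>t. (1 / t) *\<^sub>R (l (h (curve M X t)) - l (h x))) (l (lie_deriv M E Y h x)) (at 0)"
    by (rule limitin_cong_ev)
qed simp

lemma koszul_0: "koszul A 0 V \<omega> \<xi> x = lie_deriv (base A) euclideanreal (anchor A \<circ> \<xi> 0) (\<lambda>y. \<omega> y []) x"
proof -
  have e: "{(i, j). i < j \<and> j \<le> (0::nat)} = {}" by auto
  show ?thesis unfolding koszul_def e by simp
qed

lemma koszul_1:
  "koszul A 1 V \<omega> \<xi> x = lie_deriv (base A) euclideanreal (anchor A \<circ> \<xi> 0) (\<lambda>y. \<omega> y [\<xi> 1 y]) x
     - lie_deriv (base A) euclideanreal (anchor A \<circ> \<xi> 1) (\<lambda>y. \<omega> y [\<xi> 0 y]) x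
     - \<omega> x [bracket A V (\<xi> 0) (\<xi> 1) x]"
proof -
  have e: "{(i, j). i < j \<and> j \<le> (1::nat)} = {(0, 1)}" "{..1::nat} = {0, 1}" by auto
  show ?thesis unfolding koszul_def e by simp
qed

section \<open>Germs and the inverse image sheaf\<close>

lemma germ_at_self: "openin (mtop N) V \<Longrightarrow> y \<in> V \<Longrightarrow> (V, \<alpha>) \<in> germ_at N y (V, \<alpha>)"
  by (auto simp: germ_at_def)

text \<open>All that is known of the representative chosen by \<open>SOME\<close>: it lives on an
  open set around \<open>y\<close> and agrees with \<alpha> near \<open>y\<close>.\<close>

lemma germ_at_representative:
  assumes V: "openin (mtop N) V" "y \<in> V" and p: "p = (SOME p. p \<in> germ_at N y (V, \<alpha>))"
  obtains W where "openin (mtop N) (fst p)" "openin (mtop N) W" "y \<in> W" "W \<subseteq> V" "W \<subseteq> fst p"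
    "\<And>z. z \<in> W \<Longrightarrow> \<alpha> z = snd p z" "y \<in> fst p"
proof -
  have "p \<in> germ_at N y (V, \<alpha>)" unfolding p by (rule someI, rule germ_at_self[OF V])
  then show thesis using that by (auto simp: germ_at_def)
qed

locale bundle_morphism = A: algebroid_loc A + B: algebroid_loc B
  for A :: "('a, 'ae::real_vector, 'm, 'e::real_vector, 'f::real_vector) algebroid"
    and B :: "('b, 'be::real_vector, 'n, 'g::real_vector, 'h::real_vector) algebroid" +
  fixes F :: "'a \<Rightarrow> 'b" and f :: "'m \<Rightarrow> 'n"
  assumes morph: "vb_morphism A B F f"
begin

lemma smooth_base: "smooth_map (base A) (base B) f"
  and smooth_total: "smooth_map (total A) (total B) F"
  and F_vadd: "x \<in> pts (base A) \<Longrightarrow> a \<in> fiber A x \<Longrightarrow> b \<in> fiber A x \<Longrightarrow> F (vadd A a b) = vadd B (F a) (F b)"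
  and F_vscale: "x \<in> pts (base A) \<Longrightarrow> a \<in> fiber A x \<Longrightarrow> F (vscale A r a) = vscale B r (F a)"
  using morph unfolding vb_morphism_def by blast+

lemma F_fiber:
  assumes "a \<in> fiber A x"
  shows "F a \<in> fiber B (f x)"
proof -
  have a: "a \<in> pts (total A)" "proj A a = x" using assms by (auto simp: fiber_iff)
  have "proj B (F a) = f (proj A a)" using morph a(1) unfolding vb_morphism_def by blast
  then show ?thesis using smooth_maps[OF smooth_total a(1)] a(2) by (simp add: fiber_iff)
qed

lemma F_args: "vs \<in> args A k x \<Longrightarrow> map F vs \<in> args B k (f x)"
  using F_fiber by (auto simp: args_def)

lemma sharp_outside: "\<not> (x \<in> U \<and> vs \<in> args A k x) \<Longrightarrow> sharp A F f k U s x vs = 0"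
  by (auto simp: sharp_def pullback_form_def case_prod_unfold Let_def)

lemma sharp_germ:
  assumes "s z = germ_at (base B) (f z) (V, \<alpha>)" "openin (mtop (base B)) V" "f z \<in> V"
  shows "sharp A F f k U s z = pullback_form A F f k U \<alpha> z"
proof -
  define p where "p = (SOME p. p \<in> germ_at (base B) (f z) (V, \<alpha>))"
  obtain W where "f z \<in> W" "\<And>z. z \<in> W \<Longrightarrow> \<alpha> z = snd p z"
    using germ_at_representative[OF assms(2,3) p_def] by metis
  then have "\<alpha> (f z) = snd p (f z)" by blast
  moreover have "sharp A F f k U s z = pullback_form A F f k U (snd p) z"
    by (simp add: sharp_def assms(1) case_prod_unfold p_def Let_def)
  ultimately show ?thesis by (auto simp: pullback_form_def fun_eq_iff)
qed

text \<open>The chosen representative may be no form at all; \<open>differential_local\<close>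
  transfers its differential to that of \<alpha> on a set where both agree.\<close>

lemma sharp_differential_germ:
  assumes s: "s x = germ_at (base B) (f x) (V, \<alpha>)" and V: "openin (mtop (base B)) V" "f x \<in> V" and x: "x \<in> U"
  shows "sharp A F f (Suc k) U (inv_image_differential B f k U s) x = pullback_form A F f (Suc k) U (differential B k V \<alpha>) x"
proof -
  define p where "p = (SOME p. p \<in> germ_at (base B) (f x) (V, \<alpha>))"
  obtain W where W: "openin (mtop (base B)) (fst p)" "openin (mtop (base B)) W" "f x \<in> W" "W \<subseteq> V" "W \<subseteq> fst p"
    "\<And>z. z \<in> W \<Longrightarrow> \<alpha> z = snd p z" "f x \<in> fst p"
    using germ_at_representative[OF V p_def] by metis
  have "inv_image_differential B f k U s x = germ_at (base B) (f x) (fst p, differential B k (fst p) (snd p))"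
    using x by (simp add: inv_image_differential_def s case_prod_unfold p_def Let_def)
  from sharp_germ[where s = "inv_image_differential B f k U s", OF this W(1,7)]
  have "sharp A F f (Suc k) U (inv_image_differential B f k U s) x
    = pullback_form A F f (Suc k) U (differential B k (fst p) (snd p)) x" .
  moreover have "differential B k (fst p) (snd p) (f x) = differential B k V \<alpha> (f x)"
  proof
    fix vs
    have "differential B k V \<alpha> (f x) vs = differential B k W \<alpha> (f x) vs"
      by (rule B.differential_local[OF W(2,3,4)]) simp
    moreover have "differential B k (fst p) (snd p) (f x) vs = differential B k W \<alpha> (f x) vs"
      by (rule B.differential_local[OF W(2,3,5)]) (simp add: W(6))
    ultimately show "differential B k (fst p) (snd p) (f x) vs = differential B k V \<alpha> (f x) vs" by simp
  qed
  ultimately show ?thesis by (auto simp: pullback_form_def fun_eq_iff)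
qed

text \<open>A single form \<alpha> defines the section of germs \<open>s\<close>; on it the sheaf
  condition becomes the commutation of the differential with the pullback.\<close>

lemma morphismD:
  assumes m: "lie_algebroid_morphism A B F f" and U: "openin (mtop (base A)) U" and V: "openin (mtop (base B)) V" "f ` U \<subseteq> V"
    and \<alpha>: "\<alpha> \<in> forms B k V" and x: "x \<in> U" and vs: "vs \<in> args A (Suc k) x"
  shows "differential B k V \<alpha> (f x) (map F vs) = differential A k U (pullback_form A F f k U \<alpha>) x vs"
proof -
  define s where "s = (\<lambda>z\<in>U. germ_at (base B) (f z) (V, \<alpha>))"
  have "s \<in> inv_image_forms (base A) B f k U"
    unfolding inv_image_forms_def s_def using U V \<alpha> by (intro CollectI conjI ballI exI[of _ U] exI[of _ V] exI[of _ \<alpha>]) auto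
  then have "sharp A F f (Suc k) U (inv_image_differential B f k U s) = differential A k U (sharp A F f k U s)"
    using m U unfolding lie_algebroid_morphism_def by blast
  moreover have "sharp A F f k U s = pullback_form A F f k U \<alpha>"
  proof (intro ext)
    fix z ws
    show "sharp A F f k U s z ws = pullback_form A F f k U \<alpha> z ws"
    proof (cases "z \<in> U")
      case True
      then have "s z = germ_at (base B) (f z) (V, \<alpha>)" "f z \<in> V" using V by (auto simp: s_def)
      from sharp_germ[where s = s and z = z, OF this(1) V(1) this(2)] show ?thesis by simp
    next
      case False
      then show ?thesis using sharp_outside by (simp add: pullback_form_def)
    qed
  qed
  moreover have "sharp A F f (Suc k) U (inv_image_differential B f k U s) x = pullback_form A F f (Suc k) U (differential B k V \<alpha>) x"
    using x V by (intro sharp_differential_germ) (auto simp: s_def)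
  ultimately show ?thesis using x vs by (simp add: pullback_form_def fun_eq_iff)
qed

text \<open>A section of the inverse image sheaf is induced by one form near each point, and both
  sides of the sheaf condition are local.\<close>

lemma morphismI:
  assumes d: "\<And>k U V \<alpha> x vs. openin (mtop (base A)) U \<Longrightarrow> openin (mtop (base B)) V \<Longrightarrow> f ` U \<subseteq> V \<Longrightarrow>
      \<alpha> \<in> forms B k V \<Longrightarrow> x \<in> U \<Longrightarrow> vs \<in> args A (Suc k) x \<Longrightarrow>
      differential B k V \<alpha> (f x) (map F vs) = differential A k U (pullback_form A F f k U \<alpha>) x vs"
  shows "lie_algebroid_morphism A B F f"
  unfolding lie_algebroid_morphism_def
proof (intro conjI allI impI ballI ext morph)
  fix k U s x vs assume U: "openin (mtop (base A)) U" and s: "s \<in> inv_image_forms (base A) B f k U"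
  show "sharp A F f (Suc k) U (inv_image_differential B f k U s) x vs = differential A k U (sharp A F f k U s) x vs"
  proof (cases "x \<in> U \<and> vs \<in> args A (Suc k) x")
    case True
    have "\<exists>U' V \<alpha>. openin (mtop (base A)) U' \<and> x \<in> U' \<and> U' \<subseteq> U \<and> openin (mtop (base B)) V \<and> f ` U' \<subseteq> V \<and>
       \<alpha> \<in> forms B k V \<and> (\<forall>z\<in>U'. s z = germ_at (base B) (f z) (V, \<alpha>))"
      using s True unfolding inv_image_forms_def by simp
    then obtain U' V \<alpha> where h': "openin (mtop (base A)) U' \<and> x \<in> U' \<and> U' \<subseteq> U \<and> openin (mtop (base B)) V \<and> f ` U' \<subseteq> V \<and>
       \<alpha> \<in> forms B k V \<and> (\<forall>z\<in>U'. s z = germ_at (base B) (f z) (V, \<alpha>))"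
      by (elim exE)
    then have h: "openin (mtop (base A)) U'" "x \<in> U'" "U' \<subseteq> U" "openin (mtop (base B)) V" "f ` U' \<subseteq> V"
       "\<alpha> \<in> forms B k V" "\<And>z. z \<in> U' \<Longrightarrow> s z = germ_at (base B) (f z) (V, \<alpha>)"
      by simp_all
    have "sharp A F f (Suc k) U (inv_image_differential B f k U s) x vs = differential B k V \<alpha> (f x) (map F vs)"
      using sharp_differential_germ[of s x V \<alpha> U k] h True by (auto simp: pullback_form_def)
    also have "\<dots> = differential A k U' (pullback_form A F f k U' \<alpha>) x vs"
      using True by (intro d h) simp
    also have "\<dots> = differential A k U (sharp A F f k U s) x vs"
    proof (rule A.differential_local[OF h(1-3), symmetric])
      fix y assume y: "y \<in> U'"
      then have "f y \<in> V" using h(5) by blast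
      from sharp_germ[where s = s and z = y, OF h(7)[OF y] h(4) this]
      show "sharp A F f k U s y = pullback_form A F f k U' \<alpha> y" using y h(3) by (auto simp: pullback_form_def)
    qed
    finally show ?thesis .
  next
    case False
    then show ?thesis using sharp_outside[OF False] by (auto simp: differential_def)
  qed
qed

text \<open>Both tangent vectors sit over \<open>f x\<close>, so their components in each chart
  \<open>\<kappa>'\<close> are compared. Applying a functional \<open>l\<close> to a component gives
  a value of the differential of the function \<open>l \<circ> \<kappa>'\<close> or of its pullback,
  and these agree in degree 0.\<close>

lemma morphism_anchor:
  assumes m: "lie_algebroid_morphism A B F f"
  shows "anchor_compatible A B F f"
  unfolding anchor_compatible_def
proof
  fix a assume a: "a \<in> pts (total A)"
  define x where "x = proj A a"
  let ?X = "anchor A a" and ?Y = "anchor B (F a)"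
  have af: "a \<in> fiber A x" using a by (simp add: fiber_iff x_def)
  have Ff: "F a \<in> fiber B (f x)" using F_fiber[OF af] .
  have xp: "x \<in> pts (base A)" using A.proj_pts[OF a] by (simp add: x_def)
  interpret T: tangent_at "base A" ?X using A.anchor_fiber[OF af] by simp
  interpret S: tangent_at "base B" ?Y using B.anchor_fiber[OF Ff] by simp
  have fX: "fst ?X = x" and fY: "fst ?Y = f x" using A.anchor_fiber[OF af] B.anchor_fiber[OF Ff] by simp_all
  have "snd ?Y \<kappa>' = snd (tangent_map (base A) (base B) f ?X) \<kappa>'" for \<kappa>'
  proof (cases "\<kappa>' \<in> charts_at (base B) (f x)")
    \<comment> \<open>Tangent vectors are functions of all charts; off the charts around
      \<open>f x\<close> both sides have the default value 0.\<close>
    case False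
    then show ?thesis using tangent_vector_off[OF S.tvec] by (simp add: tangent_map_def case_prod_unfold fX fY)
  next
    case True
    then have \<kappa>': "\<kappa>' \<in> atlas (base B)" "f x \<in> cdom \<kappa>'" by (auto simp: charts_at_def)
    interpret c: chart_of "base B" \<kappa>' using chart_ofI[OF B.base_mfd \<kappa>'(1)] .
    let ?E = "cmodel \<kappa>'"
    let ?U = "{z \<in> pts (base A). f z \<in> cdom \<kappa>'}"
    have U: "openin (mtop (base A)) ?U" using smooth_preimage[OF smooth_base c.openin_cdom] .
    have xU: "x \<in> ?U" using xp \<kappa>' by simp
    have f: "smooth_map_on (base A) ?U (base B) f"
      by (rule smooth_subset[OF A.charted_base B.charted_base smooth_base U]) auto
    have sB: "smooth_map_on (base B) (cdom \<kappa>') (lcs_mfd ?E) (cmap \<kappa>')" using smooth_chart[OF B.base_mfd \<kappa>'(1)] .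
    have sA: "smooth_map_on (base A) ?U (lcs_mfd ?E) (\<lambda>z. cmap \<kappa>' (f z))"
      by (rule smooth_compose[OF A.charted_base B.charted_base charted_lcs[OF c.lcs] f sB]) simp
    define dA where "dA = lie_deriv (base A) ?E (\<lambda>_. ?X) (\<lambda>z. cmap \<kappa>' (f z)) x"
    define dB where "dB = lie_deriv (base B) ?E (\<lambda>_. ?Y) (cmap \<kappa>') (f x)"
    \<comment> \<open>A component in \<open>\<kappa>'\<close> is the derivative of
      \<open>\<kappa>'\<close> along the vector: for \<open>?Y\<close> by the change-of-chart
      condition in \<open>tangent_vectors\<close>, for the image of \<open>?X\<close> by the
      definition of \<open>tangent_map\<close>.\<close>
    have "dirderiv ?E (cmap \<kappa>' \<circ> cinv (chart_at (base B) (f x))) (cmap (chart_at (base B) (f x)) (f x)) (snd ?Y (chart_at (base B) (f x))) = snd ?Y \<kappa>'"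
      using tangent_vector_change[OF S.tvec S.chart, of \<kappa>'] True by (simp add: fY)
    then have B1: "dB = snd ?Y \<kappa>'"
      using S.lie_deriv_eq[of "\<lambda>_. ?Y" "cmap \<kappa>'" ?E] c.cmap_topspace[OF \<kappa>'(2)] by (simp add: dB_def fY)
    have A1: "dA = snd (tangent_map (base A) (base B) f ?X) \<kappa>'"
      using T.lie_deriv_eq[of "\<lambda>_. ?X" "\<lambda>z. cmap \<kappa>' (f z)" ?E] c.cmap_topspace[OF \<kappa>'(2)] True
      by (simp add: dA_def fX tangent_map_def case_prod_unfold chart_at_def o_def Let_def)
    have "dB = dA"
    proof (rule functionals_separate[OF c.lcs])
      show "dB \<in> topspace ?E" "dA \<in> topspace ?E"
        using limitin_topspace[OF S.lie_deriv_limit[of _ ?E "cmap \<kappa>'" "\<lambda>_. ?Y", OF sB c.lcs]] \<kappa>'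
          limitin_topspace[OF T.lie_deriv_limit[of _ ?E "\<lambda>z. cmap \<kappa>' (f z)" "\<lambda>_. ?X", OF sA c.lcs]] xU
        by (simp_all add: dA_def dB_def fX fY)
      fix l assume l: "cont_functional ?E l"
      define \<alpha> :: "('n, 'b) family" where "\<alpha> = (\<lambda>y vs. if y \<in> cdom \<kappa>' \<and> vs = [] then l (cmap \<kappa>' y) else 0)"
      have lB: "smooth_map_on (base B) (cdom \<kappa>') (lcs_mfd euclideanreal) (\<lambda>y. l (cmap \<kappa>' y))"
        by (rule smooth_compose[OF B.charted_base charted_lcs[OF c.lcs] charted_lcs[OF lcs_real] sB functional_smooth[OF c.lcs l]])
           (rule c.cmap_topspace)
      have \<alpha>: "\<alpha> \<in> forms B 0 (cdom \<kappa>')"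
        unfolding forms_def using smooth_cong[OF B.charted_base lB, of "\<lambda>y. \<alpha> y []"] by (auto simp: \<alpha>_def args_def)
      let ?\<beta> = "pullback_form A F f 0 ?U \<alpha>"
      have \<beta>y: "?\<beta> z [] = l (cmap \<kappa>' (f z))" if "z \<in> ?U" for z using that by (simp add: pullback_form_def args_def \<alpha>_def)
      have lA: "smooth_map_on (base A) ?U (lcs_mfd euclideanreal) (\<lambda>z. l (cmap \<kappa>' (f z)))"
        by (rule smooth_compose[OF A.charted_base B.charted_base charted_lcs[OF lcs_real] f lB]) simp
      have \<beta>: "?\<beta> \<in> forms A 0 ?U"
        unfolding forms_def using smooth_cong[OF A.charted_base lA, of "\<lambda>y. ?\<beta> y []"] \<beta>y by (auto simp: pullback_form_def)
      obtain V \<xi> where V: "openin (mtop (base A)) V" "x \<in> V" "V \<subseteq> ?U" "\<xi> (0::nat) \<in> sections A V" "\<xi> 0 x = a"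
        using A.ex_sections[OF xU U, of "[a]"] af by auto
      obtain W \<eta> where W: "openin (mtop (base B)) W" "f x \<in> W" "W \<subseteq> cdom \<kappa>'" "\<eta> (0::nat) \<in> sections B W" "\<eta> 0 (f x) = F a"
        using B.ex_sections[OF \<kappa>'(2) c.openin_cdom, of "[F a]"] Ff by auto
      have "differential B 0 (cdom \<kappa>') \<alpha> (f x) [F a] = koszul B 0 W \<alpha> \<eta> (f x)"
        using W by (intro B.differential_form[OF \<alpha> W(1-3) c.openin_cdom]) auto
      also have "\<dots> = lie_deriv (base B) euclideanreal (\<lambda>_. ?Y) (\<lambda>y. l (cmap \<kappa>' y)) (f x)"
        unfolding koszul_0
        by (rule S.lie_deriv_cong[unfolded fY, OF c.openin_cdom \<kappa>'(2)]) (simp_all add: \<alpha>_def W)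
      also have "\<dots> = l dB" unfolding dB_def
        by (rule S.lie_deriv_functional[unfolded fY, OF sB c.lcs \<kappa>'(2) _ l]) simp
      finally have 1: "differential B 0 (cdom \<kappa>') \<alpha> (f x) [F a] = l dB" .
      have "differential A 0 ?U ?\<beta> x [a] = koszul A 0 V ?\<beta> \<xi> x"
        using V by (intro A.differential_form[OF \<beta> V(1-3) U]) auto
      also have "\<dots> = lie_deriv (base A) euclideanreal (\<lambda>_. ?X) (\<lambda>z. l (cmap \<kappa>' (f z))) x"
        unfolding koszul_0
        by (rule T.lie_deriv_cong[unfolded fX, OF U xU]) (simp_all add: \<beta>y V)
      also have "\<dots> = l dA" unfolding dA_def
        by (rule T.lie_deriv_functional[unfolded fX, OF sA c.lcs xU _ l]) simp
      finally have 2: "differential A 0 ?U ?\<beta> x [a] = l dA" .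
      have "differential B 0 (cdom \<kappa>') \<alpha> (f x) (map F [a]) = differential A 0 ?U ?\<beta> x [a]"
        by (rule morphismD[OF m U c.openin_cdom _ \<alpha> xU]) (use af in \<open>auto simp: args_def\<close>)
      then show "l dB = l dA" using 1 2 by simp
    qed
    then show ?thesis using A1 B1 by simp
  qed
  moreover have "fst (tangent_map (base A) (base B) f ?X) = f x" by (simp add: tangent_map_def case_prod_unfold fX)
  ultimately show "?Y = tangent_map (base A) (base B) f ?X" using fY by (intro prod_eqI ext) simp_all
qed

text \<open>The chain rule, with anchor compatibility identifying the image of the anchor of
  \<open>a\<close> under the tangent map of \<open>f\<close>.\<close>

lemma lie_deriv_related:
  assumes ac: "anchor_compatible A B F f" and a: "a \<in> fiber A x" and U: "openin (mtop (base A)) U" "x \<in> U"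
    and h: "smooth_map_on (base B) W (lcs_mfd euclideanreal) h" and fW: "\<And>z. z \<in> U \<Longrightarrow> f z \<in> W"
    and g: "\<And>z. z \<in> U \<Longrightarrow> g z = h (f z)" and Y: "Y x = anchor A a" and Z: "Z (f x) = anchor B (F a)"
  shows "lie_deriv (base A) euclideanreal Y g x = lie_deriv (base B) euclideanreal Z h (f x)"
proof -
  interpret T: tangent_at "base A" "anchor A a" using A.anchor_fiber[OF a] by simp
  note fX = A.anchor_fiber(2)[OF a]
  have Ua: "U \<subseteq> pts (base A)" using openin_subset[OF U(1)] .
  have f: "smooth_map_on (base A) U (base B) f"
    by (rule smooth_subset[OF A.charted_base B.charted_base smooth_base U(1) Ua])
  have Z': "Z (f x) = tangent_map (base A) (base B) f (anchor A a)"
    using ac a Z by (simp add: anchor_compatible_def fiber_iff)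
  have "lie_deriv (base A) euclideanreal Y g x = lie_deriv (base A) euclideanreal Y (\<lambda>z. h (f z)) x"
    by (rule T.lie_deriv_cong[unfolded fX, OF U]) (simp_all add: g Y)
  also have "\<dots> = lie_deriv (base B) euclideanreal Z h (f x)"
    by (rule T.lie_deriv_compose[where Y = Y and Z = Z and f = f and h = h and N = "base B", unfolded fX, OF B.base_mfd f h lcs_real U(2) fW[OF U(2)] Y Z'])
  finally show ?thesis .
qed

text \<open>For a 1-form and related sections the Lie derivative terms of the two Koszul formulas
  agree by anchor compatibility, so the morphism condition forces the bracket terms to agree.
  Functionals of the fibre coordinate then separate the two brackets.\<close>

lemma morphism_bracket:
  assumes m: "lie_algebroid_morphism A B F f"
  shows "bracket_compatible A B F f"
  unfolding bracket_compatible_def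
proof (intro allI impI ballI)
  fix U V \<xi> \<eta> \<xi>' \<eta>' x
  assume UV: "openin (mtop (base A)) U \<and> openin (mtop (base B)) V \<and> f ` U \<subseteq> V"
    and s: "\<xi> \<in> sections A U" "\<eta> \<in> sections A U" "\<xi>' \<in> sections B V" "\<eta>' \<in> sections B V"
    and rel: "(\<forall>x\<in>U. F (\<xi> x) = \<xi>' (f x)) \<and> (\<forall>x\<in>U. F (\<eta> x) = \<eta>' (f x))" and x: "x \<in> U"
  have ac: "anchor_compatible A B F f" using morphism_anchor[OF m] .
  have fx: "f x \<in> V" using UV x by auto
  then have "f x \<in> pts (base B)" using UV openin_subset by blast
  then obtain \<phi> where \<phi>: "local_trivialization B \<phi>" "f x \<in> tdom \<phi>" by (rule B.ex_trivialization)
  interpret tr: trivialized_algebroid B \<phi> using \<phi>(1) by unfold_locales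
  \<comment> \<open>The test forms exist only over the trivialization, so everything is restricted;
    the bracket values at \<open>x\<close> and \<open>f x\<close> are unaffected (\<open>b1\<close>,
    \<open>b2\<close>).\<close>
  let ?W = "V \<inter> tdom \<phi>"
  let ?U = "U \<inter> {z \<in> pts (base A). f z \<in> ?W}"
  have W: "openin (mtop (base B)) ?W" "f x \<in> ?W" using UV tr.dom_open fx \<phi>(2) by auto
  have U: "openin (mtop (base A)) ?U" "x \<in> ?U"
    using smooth_preimage[OF smooth_base W(1)] UV W(2) x A.sectionD(4)[OF s(1) x] by auto
  have fU: "f ` ?U \<subseteq> ?W" by auto
  have br: "bracket A U \<xi> \<eta> x \<in> fiber A x" "bracket B V \<xi>' \<eta>' (f x) \<in> fiber B (f x)"
    using A.sectionD(2)[OF A.bracket_section[OF s(1,2)] x] B.sectionD(2)[OF B.bracket_section[OF s(3,4)] fx] .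
  note Fbr = F_fiber[OF br(1)]
  let ?s = "\<lambda>i::nat. if i = 0 then restrict \<xi> ?U else restrict \<eta> ?U"
  let ?s' = "\<lambda>i::nat. if i = 0 then restrict \<xi>' ?W else restrict \<eta>' ?W"
  have sec: "?s i \<in> sections A ?U" "?s' i \<in> sections B ?W" for i
    using A.section_restrict[OF s(1) U(1)] A.section_restrict[OF s(2) U(1)]
      B.section_restrict[OF s(3) W(1)] B.section_restrict[OF s(4) W(1)] by auto
  have F_s: "F (?s i z) = ?s' i (f z)" if "z \<in> ?U" for i z using rel that by auto
  have "snd (triv \<phi> (F (bracket A U \<xi> \<eta> x))) = snd (triv \<phi> (bracket B V \<xi>' \<eta>' (f x)))"
  proof (rule functionals_separate[OF tr.lcs_fib])
    show "snd (triv \<phi> (F (bracket A U \<xi> \<eta> x))) \<in> topspace (tfib \<phi>)"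
      "snd (triv \<phi> (bracket B V \<xi>' \<eta>' (f x))) \<in> topspace (tfib \<phi>)"
      using tr.rep_topspace[OF \<phi>(2)] Fbr br(2) by auto
    fix l assume l: "cont_functional (tfib \<phi>) l"
    let ?l = "\<lambda>b. l (snd (triv \<phi> b))"
    let ?\<alpha> = "\<lambda>y vs. if y \<in> ?W \<and> vs \<in> args B 1 y then ?l (hd vs) else 0"
    have lin: "?l (vadd B a b) = ?l a + ?l b" "?l (vscale B r a) = r * ?l a"
      if "y \<in> ?W" "a \<in> fiber B y" "b \<in> fiber B y" for y a b r
      using that l tr.rep_vadd[of y a b] tr.rep_vscale[of y a r] tr.rep_topspace[of y a] tr.rep_topspace[of y b]
      by (auto simp: cont_functional_def)
    have "smooth_map_on (total B) (over B (tdom \<phi>)) (lcs_mfd euclideanreal) ?l"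
      by (rule smooth_compose[OF B.charted_total charted_lcs[OF tr.lcs_fib] charted_lcs[OF lcs_real] tr.smooth_rep functional_smooth[OF tr.lcs_fib l]])
         (use smooth_maps[OF tr.smooth_rep] in \<open>simp add: lcs_mfd_def\<close>)
    then have sl: "smooth_map_on (total B) (over B ?W) (lcs_mfd euclideanreal) ?l"
      by (rule smooth_subset[OF B.charted_total charted_lcs[OF lcs_real] _ B.over_open[OF W(1)]]) (auto simp: over_iff)
    have \<alpha>: "?\<alpha> \<in> forms B 1 ?W"
      by (rule B.linear_form[OF sl W(1)]) (use lin in auto)
    \<comment> \<open>The pullback comes from the fibrewise linear function
      \<open>?l \<circ> F\<close>, so \<open>linear_form\<close> also shows that it is a form on the
      source.\<close>
    have pb: "pullback_form A F f 1 ?U ?\<alpha> = (\<lambda>z vs. if z \<in> ?U \<and> vs \<in> args A 1 z then ?l (F (hd vs)) else 0)"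
    proof (intro ext)
      fix z vs
      have "hd (map F vs) = F (hd vs)" if "vs \<in> args A 1 z" using that by (auto simp: args_def length_Suc_conv)
      moreover have "f z \<in> ?W" if "z \<in> ?U" using that by simp
      ultimately show "pullback_form A F f 1 ?U ?\<alpha> z vs = (if z \<in> ?U \<and> vs \<in> args A 1 z then ?l (F (hd vs)) else 0)"
        using F_args[of vs 1 z] by (simp add: pullback_form_def)
    qed
    have sF: "smooth_map_on (total A) (over A ?U) (total B) F"
      by (rule smooth_subset[OF A.charted_total B.charted_total smooth_total A.over_open[OF U(1)]]) (auto simp: over_iff)
    have oF: "F a \<in> over B ?W" if "a \<in> over A ?U" for a
      using F_fiber[of a "proj A a"] that by (auto simp: over_iff)
    have "(\<lambda>z vs. if z \<in> ?U \<and> vs \<in> args A 1 z then ?l (F (hd vs)) else 0) \<in> forms A 1 ?U"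
    proof (rule A.linear_form[OF smooth_compose[OF A.charted_total B.charted_total charted_lcs[OF lcs_real] sF sl oF] U(1)])
      fix z a b assume z: "z \<in> ?U" and ab: "a \<in> fiber A z" "b \<in> fiber A z"
      have zp: "z \<in> pts (base A)" "f z \<in> ?W" using z by auto
      show "?l (F (vadd A a b)) = ?l (F a) + ?l (F b)"
        using lin(1)[OF zp(2) F_fiber[OF ab(1)] F_fiber[OF ab(2)]] F_vadd[OF zp(1) ab] by simp
    next
      fix z a r assume z: "z \<in> ?U" and a: "a \<in> fiber A z"
      have zp: "z \<in> pts (base A)" "f z \<in> ?W" using z by auto
      show "?l (F (vscale A r a)) = r * ?l (F a)"
        using lin(2)[OF zp(2) F_fiber[OF a] F_fiber[OF a]] F_vscale[OF zp(1) a] by simp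
    qed
    then have \<beta>: "pullback_form A F f 1 ?U ?\<alpha> \<in> forms A 1 ?U" unfolding pb .
    let ?\<beta> = "pullback_form A F f 1 ?U ?\<alpha>"
    have \<beta>v: "?\<beta> z [a] = ?\<alpha> (f z) [F a]" if "z \<in> ?U" "a \<in> fiber A z" for z a
      using that by (simp add: pullback_form_def args_def)
    let ?vs = "[\<xi> x, \<eta> x]"
    have lie: "lie_deriv (base A) euclideanreal (anchor A \<circ> ?s i) (\<lambda>z. ?\<beta> z [?s j z]) x
      = lie_deriv (base B) euclideanreal (anchor B \<circ> ?s' i) (\<lambda>y. ?\<alpha> y [?s' j y]) (f x)" for i j
    proof (rule lie_deriv_related[OF ac _ U])
      show "?s i x \<in> fiber A x" using A.sectionD(2)[OF sec(1) U(2)] .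
      have "smooth_map_on (base B) ?W (lcs_mfd euclideanreal) (\<lambda>y. ?\<alpha> y (map (\<lambda>l. ?s' l y) [j]))"
        by (rule tr.form_eval_smooth[OF \<alpha> W(1)]) (use sec in auto)
      then show "smooth_map_on (base B) ?W (lcs_mfd euclideanreal) (\<lambda>y. ?\<alpha> y [?s' j y])" by (simp only: list.map)
      show "?\<beta> z [?s j z] = ?\<alpha> (f z) [?s' j (f z)]" if "z \<in> ?U" for z
        using \<beta>v[OF that A.sectionD(2)[OF sec(1) that]] F_s[OF that] by (simp only:)
      show "(anchor B \<circ> ?s' i) (f x) = anchor B (F (?s i x))" using F_s[OF U(2)] by (simp only: o_apply)
    qed auto
    have dA: "differential A 1 ?U ?\<beta> x ?vs = koszul A 1 ?U ?\<beta> ?s x"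
      by (rule A.differential_form[OF \<beta> U order_refl U(1) sec(1)]) (use U(2) in simp)
    have dB: "differential B 1 ?W ?\<alpha> (f x) (map F ?vs) = koszul B 1 ?W ?\<alpha> ?s' (f x)"
      by (rule B.differential_form[OF \<alpha> W order_refl W(1) sec(2)]) (use W(2) rel x in simp)
    have "differential B 1 ?W ?\<alpha> (f x) (map F ?vs) = differential A 1 ?U ?\<beta> x ?vs"
      by (rule morphismD[OF m U(1) W(1) fU \<alpha> U(2)]) (use A.sectionD(2)[OF s(1) x] A.sectionD(2)[OF s(2) x] in \<open>simp add: args_def\<close>)
    then have "koszul A 1 ?U ?\<beta> ?s x = koszul B 1 ?W ?\<alpha> ?s' (f x)" using dA dB by simp
    then have e: "?\<beta> x [bracket A ?U (?s 0) (?s 1) x] = ?\<alpha> (f x) [bracket B ?W (?s' 0) (?s' 1) (f x)]"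
      unfolding koszul_1 lie by (rule diff_left_imp_eq)
    have b1: "bracket A ?U (?s 0) (?s 1) x = bracket A U \<xi> \<eta> x"
      using A.bracket_restrict[OF s(1,2) U(1)] U(2) by simp
    have b2: "bracket B ?W (?s' 0) (?s' 1) (f x) = bracket B V \<xi>' \<eta>' (f x)"
      using B.bracket_restrict[OF s(3,4) W(1)] W(2) by simp
    have "?\<alpha> (f x) [F (bracket A U \<xi> \<eta> x)] = ?\<alpha> (f x) [bracket B V \<xi>' \<eta>' (f x)]"
      using e \<beta>v[OF U(2) br(1)] unfolding b1 b2 by simp
    moreover have "?\<alpha> (f x) [b] = ?l b" if "b \<in> fiber B (f x)" for b
      using W(2) that by (simp add: args_def)
    ultimately show "?l (F (bracket A U \<xi> \<eta> x)) = ?l (bracket B V \<xi>' \<eta>' (f x))"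
      using Fbr br(2) by simp
  qed
  then show "F (bracket A U \<xi> \<eta> x) = bracket B V \<xi>' \<eta>' (f x)"
    by (rule tr.rep_inj[OF \<phi>(2) Fbr br(2)])
qed

text \<open>By \<open>differential_eqI\<close> it suffices to evaluate the Koszul formula of the
  pullback on every system of sections through \<open>vs\<close>. Each value equals that of \<alpha>
  on the transported sections, so uniqueness of the differential is inherited from the target
  bundle.\<close>

lemma morphism_converse:
  assumes ld: "local_diffeo (base A) (base B) f" and ac: "anchor_compatible A B F f" and bc: "bracket_compatible A B F f"
  shows "lie_algebroid_morphism A B F f"
proof (rule morphismI)
  fix k U V \<alpha> x vs
  assume U: "openin (mtop (base A)) U" and V: "openin (mtop (base B)) V" and fU: "f ` U \<subseteq> V"
    and \<alpha>: "\<alpha> \<in> forms B k V" and x: "x \<in> U" and vs: "vs \<in> args A (Suc k) x"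
  let ?\<beta> = "pullback_form A F f k U \<alpha>"
  have xp: "x \<in> pts (base A)" using x openin_subset[OF U] by auto
  obtain U0 where U0: "openin (mtop (base A)) U0" "x \<in> U0" "openin (mtop (base B)) (f ` U0)"
    "diffeo_on (base A) U0 (base B) (f ` U0) f"
    using ld xp unfolding local_diffeo_def by blast
  define g where "g = inv_into U0 f"
  have inj: "inj_on f U0" and sg: "smooth_map_on (base B) (f ` U0) (base A) g"
    using U0(4) by (auto simp: diffeo_on_def bij_betw_def g_def)
  have gf: "g (f z) = z" if "z \<in> U0" for z using inj that by (simp add: g_def)
  obtain \<phi> where \<phi>: "local_trivialization B \<phi>" "f x \<in> tdom \<phi>"
    using B.ex_trivialization smooth_maps[OF smooth_base xp] by metis
  interpret tr: trivialized_algebroid B \<phi> using \<phi>(1) by unfold_locales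
  show "differential B k V \<alpha> (f x) (map F vs) = differential A k U ?\<beta> x vs"
  proof (rule A.differential_eqI[OF U x vs, symmetric])
    fix W \<xi> assume W: "openin (mtop (base A)) W" "x \<in> W" "W \<subseteq> U" and \<xi>: "\<And>i. i \<le> k \<Longrightarrow> \<xi> i \<in> sections A W"
      and \<xi>x: "\<And>i. i \<le> k \<Longrightarrow> \<xi> i x = vs ! i"
    let ?U = "W \<inter> U0 \<inter> {z \<in> pts (base A). f z \<in> tdom \<phi>}"
    \<comment> \<open>This is the image of \<open>?U\<close> under \<open>f\<close>, written as a
      preimage under the local inverse \<open>g\<close> so that it is visibly open.\<close>
    let ?N = "{y \<in> f ` U0. g y \<in> ?U}"
    have U1: "openin (mtop (base A)) ?U" "x \<in> ?U" "?U \<subseteq> W"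
      using smooth_preimage[OF smooth_base tr.dom_open] W U0 xp \<phi>(2) by auto
    have N: "openin (mtop (base B)) ?N" using smooth_preimage[OF sg U1(1)] .
    have fN: "f z \<in> ?N" if "z \<in> ?U" for z using that gf by auto
    have gN: "g y \<in> ?U" "f (g y) = y" if "y \<in> ?N" for y using that gf by auto
    have NV: "y \<in> V \<and> y \<in> tdom \<phi>" if "y \<in> ?N" for y
    proof -
      have "g y \<in> U" "f (g y) \<in> tdom \<phi>" using gN(1)[OF that] W(3) by auto
      then have "f (g y) \<in> V" "f (g y) \<in> tdom \<phi>" using fU by auto
      then show ?thesis by (simp only: gN(2)[OF that])
    qed
    then have NV: "?N \<subseteq> V" "?N \<subseteq> tdom \<phi>" by blast+
    define \<eta> where "\<eta> i = restrict (\<lambda>y. F (\<xi> i (g y))) ?N" for i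
    have \<eta>: "\<eta> i \<in> sections B ?N" if "i \<le> k" for i
      unfolding sections_def
    proof (intro CollectI conjI ballI)
      have "smooth_map_on (base B) ?N (base A) g"
        by (rule smooth_subset[OF B.charted_base A.charted_base sg N]) auto
      then have "smooth_map_on (base B) ?N (total A) (\<lambda>y. \<xi> i (g y))"
        by (rule smooth_compose[OF B.charted_base A.charted_base A.charted_total _ A.sectionD(1)[OF \<xi>[OF that]]]) auto
      then have "smooth_map_on (base B) ?N (total B) (\<lambda>y. F (\<xi> i (g y)))"
        by (rule smooth_compose[OF B.charted_base A.charted_total B.charted_total _ smooth_total])
           (use A.sectionD(2)[OF \<xi>[OF that]] in \<open>auto simp: fiber_iff\<close>)
      then show "smooth_map_on (base B) ?N (total B) (\<eta> i)"
        by (rule smooth_cong[OF B.charted_base]) (simp add: \<eta>_def)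
      fix y assume y: "y \<in> ?N"
      then have "\<xi> i (g y) \<in> fiber A (g y)" using A.sectionD(2)[OF \<xi>[OF that]] by auto
      from F_fiber[OF this] show "proj B (\<eta> i y) = y" using y gN(2)[OF y] by (simp add: \<eta>_def fiber_iff)
    qed (simp add: \<eta>_def)
    let ?\<xi> = "\<lambda>i. restrict (\<xi> i) ?U"
    have s\<xi>: "?\<xi> i \<in> sections A ?U" if "i \<le> k" for i by (rule A.section_restrict[OF \<xi>[OF that] U1(1,3)])
    have rel: "F (?\<xi> i z) = \<eta> i (f z)" if "z \<in> ?U" for i z
      using that fN[OF that] gf by (simp add: \<eta>_def)
    have \<beta>v: "?\<beta> z ws = \<alpha> (f z) (map F ws)" if "z \<in> ?U" "set ws \<subseteq> fiber A z" "length ws = k" for z ws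
      using that U1(3) W(3) by (auto simp: pullback_form_def args_def)
    have fib: "set (map (\<lambda>l. ?\<xi> l z) [l\<leftarrow>[0..<Suc k]. P l]) \<subseteq> fiber A z" if "z \<in> ?U" for z P
      using A.sectionD(2)[OF s\<xi> that] by (auto simp: less_Suc_eq_le simp del: upt_Suc)
    have mapF: "map F (map (\<lambda>l. ?\<xi> l z) ls) = map (\<lambda>l. \<eta> l (f z)) ls" if "z \<in> ?U" for z ls
      using rel[OF that] by simp
    have lie: "lie_term A k ?\<beta> ?\<xi> x j = lie_term B k \<alpha> \<eta> (f x) j" if j: "j \<le> k" for j
      unfolding lie_term_def
    proof (rule lie_deriv_related[OF ac A.sectionD(2)[OF s\<xi>[OF j] U1(2)] U1(1,2)])
      have len: "length [l\<leftarrow>[0..<Suc k]. l \<noteq> j] = k" using length_filter_upt[where i = "Suc k" and j = j] j by simp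
      show "smooth_map_on (base B) ?N (lcs_mfd euclideanreal) (\<lambda>y. \<alpha> y (map (\<lambda>l. \<eta> l y) [l\<leftarrow>[0..<Suc k]. l \<noteq> j]))"
      proof (rule tr.form_eval_smooth[OF \<alpha> N NV _ len])
        fix l assume "l \<in> set [l\<leftarrow>[0..<Suc k]. l \<noteq> j]"
        then have "l \<le> k" by (auto simp del: upt_Suc)
        then show "\<eta> l \<in> sections B ?N" by (rule \<eta>)
      qed
      show "?\<beta> z (map (\<lambda>l. ?\<xi> l z) [l\<leftarrow>[0..<Suc k]. l \<noteq> j]) = \<alpha> (f z) (map (\<lambda>l. \<eta> l (f z)) [l\<leftarrow>[0..<Suc k]. l \<noteq> j])"
        if "z \<in> ?U" for z
        unfolding mapF[OF that, symmetric] by (rule \<beta>v[OF that fib[OF that]]) (simp only: length_map len)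
      show "(anchor B \<circ> \<eta> j) (f x) = anchor B (F (?\<xi> j x))" using rel[OF U1(2)] by (simp only: o_apply)
    qed (use fN in auto)
    have br: "bracket_term A k ?U ?\<beta> ?\<xi> x i j = bracket_term B k ?N \<alpha> \<eta> (f x) i j" if ij: "i < j" "j \<le> k" for i j
    proof -
      have ik: "i \<le> k" "j \<le> k" "i \<noteq> j" "k > 0" using ij by auto
      let ?ls = "map (\<lambda>l. ?\<xi> l x) [l\<leftarrow>[0..<Suc k]. l \<noteq> i \<and> l \<noteq> j]"
      have "length (bracket A ?U (?\<xi> i) (?\<xi> j) x # ?ls) = k"
        using length_filter_upt2[OF ik(1-3)] ik(4) by (simp del: upt_Suc)
      moreover have "set (bracket A ?U (?\<xi> i) (?\<xi> j) x # ?ls) \<subseteq> fiber A x"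
        using fib[OF U1(2)] A.sectionD(2)[OF A.bracket_section[OF s\<xi>[OF ik(1)] s\<xi>[OF ik(2)]] U1(2)]
        by (simp only: list.set insert_subset)
      ultimately have "bracket_term A k ?U ?\<beta> ?\<xi> x i j = \<alpha> (f x) (map F (bracket A ?U (?\<xi> i) (?\<xi> j) x # ?ls))"
        unfolding bracket_term_def by (intro \<beta>v[OF U1(2)])
      also have "map F (bracket A ?U (?\<xi> i) (?\<xi> j) x # ?ls) = F (bracket A ?U (?\<xi> i) (?\<xi> j) x) # map (\<lambda>l. \<eta> l (f x)) [l\<leftarrow>[0..<Suc k]. l \<noteq> i \<and> l \<noteq> j]"
        by (simp only: list.map mapF[OF U1(2)])
      also have "F (bracket A ?U (?\<xi> i) (?\<xi> j) x) = bracket B ?N (\<eta> i) (\<eta> j) (f x)"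
      proof -
        have "f ` ?U \<subseteq> ?N" using fN by blast
        then show ?thesis
          using bc[unfolded bracket_compatible_def, rule_format, OF conjI[OF U1(1) conjI[OF N]] s\<xi>[OF ik(1)] s\<xi>[OF ik(2)] \<eta>[OF ik(1)] \<eta>[OF ik(2)] _ U1(2)]
            rel by blast
      qed
      finally show ?thesis by (simp only: bracket_term_def)
    qed
    have "koszul A k W ?\<beta> \<xi> x = koszul A k ?U ?\<beta> ?\<xi> x"
      by (rule A.koszul_restrict[OF U1, symmetric]) (use \<xi> in auto)
    also have "\<dots> = koszul B k ?N \<alpha> \<eta> (f x)"
      by (rule koszul_cong[OF lie br])
    also have "\<dots> = differential B k V \<alpha> (f x) (map F vs)"
    proof (rule B.differential_form[OF \<alpha> N fN[OF U1(2)] NV(1) V \<eta>, symmetric])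
      have "vs = map (\<lambda>i. \<xi> i x) [0..<Suc k]"
        using vs \<xi>x by (intro nth_equalityI) (auto simp: args_def less_Suc_eq_le simp del: upt_Suc)
      also have "map F \<dots> = map (\<lambda>i. \<eta> i (f x)) [0..<Suc k]"
        using rel[OF U1(2)] U1(2) by simp
      finally show "map F vs = map (\<lambda>i. \<eta> i (f x)) [0..<Suc k]" .
    qed
    finally show "koszul A k W ?\<beta> \<xi> x = differential B k V \<alpha> (f x) (map F vs)" .
  qed
qed

end

theorem theorem3p8:
  fixes A :: "('a, 'ae::real_vector, 'm, 'e::real_vector, 'f::real_vector) algebroid"
    and B :: "('b, 'be::real_vector, 'n, 'g::real_vector, 'h::real_vector) algebroid"
    and F :: "'a \<Rightarrow> 'b" and f :: "'m \<Rightarrow> 'n"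
  assumes "lie_algebroid A" and "lie_algebroid B"
  shows "(lie_algebroid_morphism A B F f \<longrightarrow>
            anchor_compatible A B F f \<and> bracket_compatible A B F f) \<and>
         (vb_morphism A B F f \<and> local_diffeo (base A) (base B) f \<and>
            anchor_compatible A B F f \<and> bracket_compatible A B F f \<longrightarrow>
            lie_algebroid_morphism A B F f)"
proof -
  have setting: "bundle_morphism A B F f" if "vb_morphism A B F f"
    using assms that by unfold_locales
  moreover have "vb_morphism A B F f" if "lie_algebroid_morphism A B F f"
    using that by (simp add: lie_algebroid_morphism_def)
  ultimately show ?thesis
    using bundle_morphism.morphism_anchor bundle_morphism.morphism_bracket bundle_morphism.morphism_converse
    by blast
qed

end
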